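(* Let $0<\alpha<2<p$ and let $Z=\{Z_t,\ t\ge0\}$ be a real symmetric $\alpha$-stable Lévy process with $\mathbb E[e^{i\lambda Z_t}]=e^{-\kappa t|\lambda|^\alpha}$ for all $t\ge0$, $\lambda\in\mathbb R$, where $\kappa>0$. Let $\mathcal K_{\alpha,p}\in(0,\infty)$ be the constant $$\mathcal K_{\alpha,p}=-\lim_{\varepsilon\downarrow0}\varepsilon^{\frac{p\alpha}{p-\alpha}}\log\mathbb P\left[\|Z\|_p\le\varepsilon\right],$$ where $\|Z\|_p$ is the strong $p$-variation of $Z$ on $[0,1]$, and let $c_p\in(0,\infty)$ be the small ball constant of standard Brownian motion under the $(1/p)$-Hölder semi-norm on $[0,1]$. Then $$D_{\alpha,p}\ \le\ \mathcal K_{\alpha,p}\ \le\ c_p+d_\alpha,$$ where $$D_{\alpha,p}=\left(\frac{p-\alpha}{\alpha}\right)\left(\frac{2\alpha\,\Gamma(\alpha)\sin(\pi\alpha/2)}{p\pi}\,\Gamma(1-\alpha/p)\right)^{\frac{p}{p-\alpha}}\kappa^{\frac{p}{p-\alpha}},\qquad d_\alpha=\left(\frac{2-\alpha}{2}\right)\alpha^{\frac{\alpha}{2-\alpha}}\kappa^{\frac{2}{2-\alpha}}.$$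
   Context: A càdlàg version of $Z$ is used. The strong $p$-variation on $[0,1]$ of a function $f$ is $$\|f\|_p=\left(\sup_{t_0<\dots<t_k\in[0,1]}\sum_{j=1}^k|f(t_j)-f(t_{j-1})|^p\right)^{1/p},$$ the supremum being over all $k$ and all such finite sequences. The limit defining $\mathcal K_{\alpha,p}$ is known to exist in the required range. For a standard linear Brownian motion $W$ and $p>2$, the constant $c_p$ is defined by $$\lim_{\varepsilon\downarrow0}\varepsilon^{\frac{2p}{p-2}}\log\mathbb P\left[\sup_{0\le s<t\le1}\frac{|W_t-W_s|}{|t-s|^{1/p}}\le\varepsilon\right]=-c_p\in(-\infty,0),$$ the existence of this limit being a known result. $\Gamma$ is the Gamma function. *)

theory Defs
  imports "HOL-Probability.Probability"
begin

definition cadlag :: "(real \<Rightarrow> real) \<Rightarrow> bool" where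
  "cadlag f \<longleftrightarrow>
     (\<forall>t\<ge>0. (f \<longlongrightarrow> f t) (at_right t)) \<and>
     (\<forall>t>0. \<exists>l. (f \<longlongrightarrow> l) (at_left t))"

text \<open>Processes are indexed by all reals, but only the values at times \<open>t \<ge> 0\<close> are ever
  constrained or used.\<close>

definition (in prob_space) independent_increments :: "(real \<Rightarrow> 'a \<Rightarrow> real) \<Rightarrow> bool" where
  "independent_increments X \<longleftrightarrow>
     (\<forall>(n::nat) t. 0 \<le> t 0 \<longrightarrow> (\<forall>i<n. t i \<le> t (Suc i)) \<longrightarrow>
        indep_vars (\<lambda>_. borel) (\<lambda>i \<omega>. X (t (Suc i)) \<omega> - X (t i) \<omega>) {..<n})"

text \<open>Every path is required to be cadlag. Stochastic continuity is not listed separately: it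
  follows from right continuity at \<open>0\<close> and stationarity of the increments.\<close>

locale levy_process = prob_space M for M :: "'a measure" +
  fixes X :: "real \<Rightarrow> 'a \<Rightarrow> real"
  assumes random_variable: "t \<ge> 0 \<Longrightarrow> X t \<in> borel_measurable M"
    and starts_at_0: "AE \<omega> in M. X 0 \<omega> = 0"
    and independent_increments: "independent_increments X"
    and stationary_increments:
      "s \<ge> 0 \<Longrightarrow> h \<ge> 0 \<Longrightarrow> distr M borel (\<lambda>\<omega>. X (s + h) \<omega> - X s \<omega>) = distr M borel (X h)"
    and cadlag_paths: "\<omega> \<in> space M \<Longrightarrow> cadlag (\<lambda>t. X t \<omega>)"

text \<open>The second parameter of \<^const>\<open>normal_density\<close> is the standard deviation.\<close>

locale standard_brownian_motion = prob_space M for M :: "'a measure" +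
  fixes W :: "real \<Rightarrow> 'a \<Rightarrow> real"
  assumes random_variable: "t \<ge> 0 \<Longrightarrow> W t \<in> borel_measurable M"
    and starts_at_0: "AE \<omega> in M. W 0 \<omega> = 0"
    and independent_increments: "independent_increments W"
    and gaussian_increments:
      "0 \<le> s \<Longrightarrow> s < t \<Longrightarrow>
         distributed M lborel (\<lambda>\<omega>. W t \<omega> - W s \<omega>) (normal_density 0 (sqrt (t - s)))"
    and continuous_paths: "\<omega> \<in> space M \<Longrightarrow> continuous_on {0..} (\<lambda>t. W t \<omega>)"

text \<open>Both path functionals take values in \<^typ>\<open>ennreal\<close>, since the supremum may be infinite.\<close>

definition variation_sum :: "real \<Rightarrow> (real \<Rightarrow> real) \<Rightarrow> ennreal" where
  "variation_sum p f =
     (SUP (k, t) \<in> {(k::nat, t). strict_mono_on {..k} t \<and> t ` {..k} \<subseteq> {0..1}}.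
        ennreal (\<Sum>j=1..k. \<bar>f (t j) - f (t (j - 1))\<bar> powr p))"

definition strong_variation :: "real \<Rightarrow> (real \<Rightarrow> real) \<Rightarrow> ennreal" where
  "strong_variation p f =
     (if variation_sum p f = \<top> then \<top>
      else ennreal (enn2real (variation_sum p f) powr (1 / p)))"

definition holder_seminorm :: "real \<Rightarrow> (real \<Rightarrow> real) \<Rightarrow> ennreal" where
  "holder_seminorm \<gamma> f =
     (SUP (s, t) \<in> {(s, t). 0 \<le> s \<and> s < t \<and> t \<le> 1}. ennreal (\<bar>f t - f s\<bar> / \<bar>t - s\<bar> powr \<gamma>))"

end

theory Submission
  imports Defs
begin

text \<open>
  Lower bound. The sum of the \<open>p\<close>-th powers of the increments of \<open>Z\<close> over a regular grid is at most
  \<open>\<parallel>Z\<parallel>\<^sub>p\<^sup>p\<close>. As the mesh tends to \<open>0\<close>, its Laplace transform at \<open>s\<close> tends to \<open>exp (- B s powr (\<alpha> / p))\<close>,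
  that of the sum of the \<open>p\<close>-th powers of the jumps, because the law of \<open>Z\<close> at a small time \<open>h\<close>, divided
  by \<open>h\<close>, converges vaguely to the Levy measure. Chernoff's inequality, optimised in \<open>s\<close>, gives the bound.

  Upper bound. \<open>Z\<close> is a Brownian motion \<open>W\<close> subordinated by an \<open>\<alpha> / 2\<close>-stable subordinator \<open>A\<close>. On the event
  \<open>A\<^sub>1 \<le> a\<close> the \<open>p\<close>-variation of \<open>Z\<close> is at most \<open>sqrt a\<close> times the \<open>1/p\<close>-Hoelder seminorm of a Brownian
  motion on \<open>[0, 1]\<close>. The probability of \<open>A\<^sub>1 \<le> a\<close> is bounded below by exponential tilting, and with
  \<open>a = \<epsilon> powr (p (2 - \<alpha>) / (p - \<alpha>))\<close> both factors contribute at the order \<open>\<epsilon> powr (- p \<alpha> / (p - \<alpha>))\<close>.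
  Subordination is only needed on finite grids, hence as an identity between finite product measures;
  dyadic grids and right continuity recover the whole path.
\<close>

section \<open>Power integrals\<close>

text \<open>Neither the jumps of \<open>Z\<close> nor a subordinator ever appears as a process, and
  \<open>Z\<close> and \<open>W\<close> live on unrelated probability spaces. Both bounds therefore
  compare laws on finite grids, identified through explicit characteristic functions and Laplace
  transforms; the integrals below supply their constants. A Gaussian of variance \<open>a\<close>
  has characteristic function \<open>exp (- u^2 a / 2)\<close>, and \<open>s = u^2 / 2\<close> has
  to produce \<open>\<kappa> |u|^\<alpha>\<close>, so the Laplace exponent of \<open>A\<close> at
  time 1 must be \<open>\<kappa> (2 s)^(\<alpha>/2)\<close>; optimising the tilt for this exponent
  yields the constant of the upper bound. The Brownian estimate survives an arbitrary time change
  because a 1/p-Hoelder bound makes the p-th power of an increment at most a multiple of the length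
  of its time interval, and these lengths telescope. The event that the p-variation is at most
  \<open>\<epsilon>\<close> is not assumed measurable. From above this is harmless: it lies in a
  measurable grid event, and \<open>measure\<close> is 0 off the sigma-algebra. From below, its
  measurability has to be extracted from the assumed limit.\<close>

lemma nn_integral_Gamma:
  fixes a s :: real
  assumes "a > 0" "s > 0"
  shows "(\<integral>\<^sup>+x. ennreal (x powr (a - 1) * exp (- (s * x))) * indicator {0<..} x \<partial>lborel)
    = ennreal (Gamma a / s powr a)"
proof -
  have "(\<integral>\<^sup>+x. ennreal (x powr (a - 1) / exp x) * indicator {0..} x \<partial>lborel) = ennreal (Gamma a)"
    by (rule nn_integral_has_integral_lebesgue'[OF _ Gamma_integral_real]) (use assms in auto)
  also have "(\<integral>\<^sup>+x. ennreal (x powr (a - 1) / exp x) * indicator {0..} x \<partial>lborel)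
    = (\<integral>\<^sup>+x. ennreal (x powr (a - 1) / exp x) * indicator {0<..} x \<partial>lborel)"
    by (intro nn_integral_cong) (auto simp: indicator_def)
  also have "\<dots> = ennreal \<bar>s\<bar> * (\<integral>\<^sup>+x. ennreal ((0 + s * x) powr (a - 1) / exp (0 + s * x)) * indicator {0<..} (0 + s * x) \<partial>lborel)"
    by (rule nn_integral_real_affine) (use assms in auto)
  also have "\<dots> = ennreal \<bar>s\<bar> * (\<integral>\<^sup>+x. ennreal (s powr (a - 1)) * (ennreal (x powr (a - 1) * exp (- (s * x))) * indicator {0<..} x) \<partial>lborel)"
  proof (rule arg_cong[where f="\<lambda>y. ennreal \<bar>s\<bar> * y"], rule nn_integral_cong)
    fix x :: real
    show "ennreal ((0 + s * x) powr (a - 1) / exp (0 + s * x)) * indicator {0<..} (0 + s * x)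
      = ennreal (s powr (a - 1)) * (ennreal (x powr (a - 1) * exp (- (s * x))) * indicator {0<..} x)"
      using assms
      by (cases "x > 0") (simp_all add: powr_mult exp_minus divide_inverse zero_less_mult_iff mult_ac ennreal_mult'[symmetric])
  qed
  also have "\<dots> = ennreal \<bar>s\<bar> * (ennreal (s powr (a - 1)) * (\<integral>\<^sup>+x. ennreal (x powr (a - 1) * exp (- (s * x))) * indicator {0<..} x \<partial>lborel))"
    by (subst nn_integral_cmult) auto
  also have "\<dots> = ennreal (s powr a) * (\<integral>\<^sup>+x. ennreal (x powr (a - 1) * exp (- (s * x))) * indicator {0<..} x \<partial>lborel)"
    using assms by (simp add: mult.assoc[symmetric] ennreal_mult[symmetric] powr_diff)
  finally have "ennreal (1 / s powr a) * ennreal (Gamma a) =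
     ennreal (1 / s powr a) * (ennreal (s powr a) * (\<integral>\<^sup>+x. ennreal (x powr (a - 1) * exp (- (s * x))) * indicator {0<..} x \<partial>lborel))"
    by simp
  then show ?thesis
    using assms by (simp add: mult.assoc[symmetric] ennreal_mult[symmetric])
qed

lemma nn_integral_powr_tail:
  fixes a y :: real
  assumes "a > 0" "y > 0"
  shows "(\<integral>\<^sup>+x. ennreal (x powr (- 1 - a)) * indicator {y..} x \<partial>lborel) = ennreal (y powr (- a) / a)"
proof -
  have "(\<integral>\<^sup>+x. ennreal (x powr (- 1 - a)) * indicator {y..} x \<partial>lborel) = ennreal (0 - (- (y powr (- a) / a)))"
  proof (rule nn_integral_FTC_atLeast)
    fix x assume "y \<le> x"
    then show "((\<lambda>x. - (x powr (- a) / a)) has_real_derivative x powr (- 1 - a)) (at x)"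
      using assms by (auto intro!: derivative_eq_intros simp: powr_diff powr_minus field_simps)
  next
    show "((\<lambda>x. - (x powr (- a) / a)) \<longlongrightarrow> 0) at_top"
      using assms by real_asymp
  qed auto
  then show ?thesis by simp
qed

lemma nn_integral_exp_between:
  fixes c :: real
  assumes "c \<ge> 0"
  shows "(\<integral>\<^sup>+v. ennreal (exp (- v)) * indicator {0..c} v \<partial>lborel) = ennreal (1 - exp (- c))"
proof -
  have "(\<integral>\<^sup>+v. ennreal (exp (- v)) * indicator {0..c} v \<partial>lborel) = ennreal (- exp (- c) - (- exp (- 0)))"
    using assms by (intro nn_integral_FTC_Icc) (auto intro!: derivative_eq_intros)
  then show ?thesis by simp
qed

text \<open>Write \<open>1 - exp (- c)\<close> as the integral of \<open>exp (- v)\<close> over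
  \<open>[0, c]\<close> and exchange the integrals: the inner one becomes a power tail starting at
  \<open>(v / s) powr (1 / p)\<close>, and a Gamma integral in \<open>v\<close> remains. The case
  \<open>p = 1\<close> serves the Pareto law, general \<open>p\<close> the p-th powers of the
  jumps.\<close>

lemma nn_integral_one_minus_exp_powr:
  fixes a p s :: real
  assumes "0 < a" "a < p" "0 < s"
  shows "(\<integral>\<^sup>+x. ennreal ((1 - exp (- (s * x powr p))) * x powr (- 1 - a)) * indicator {0<..} x \<partial>lborel)
    = ennreal (s powr (a / p) * Gamma (1 - a / p) / a)"
proof -
  have "(\<integral>\<^sup>+x. ennreal ((1 - exp (- (s * x powr p))) * x powr (- 1 - a)) * indicator {0<..} x \<partial>lborel)
    = (\<integral>\<^sup>+x. (\<integral>\<^sup>+v. ennreal (exp (- v)) * indicator {0..s * x powr p} v *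
         (ennreal (x powr (- 1 - a)) * indicator {0<..} x) \<partial>lborel) \<partial>lborel)"
  proof (intro nn_integral_cong)
    fix x :: real
    show "ennreal ((1 - exp (- (s * x powr p))) * x powr (- 1 - a)) * indicator {0<..} x
      = (\<integral>\<^sup>+v. ennreal (exp (- v)) * indicator {0..s * x powr p} v *
         (ennreal (x powr (- 1 - a)) * indicator {0<..} x) \<partial>lborel)"
      using assms by (cases "x > 0") (simp_all add: nn_integral_multc nn_integral_exp_between ennreal_mult)
  qed
  also have "\<dots> = (\<integral>\<^sup>+v. (\<integral>\<^sup>+x. ennreal (exp (- v)) * indicator {0..s * x powr p} v *
         (ennreal (x powr (- 1 - a)) * indicator {0<..} x) \<partial>lborel) \<partial>lborel)"
    by (rule lborel_pair.Fubini') (unfold indicator_def atLeastAtMost_iff greaterThan_iff, measurable)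
  also have "\<dots> = (\<integral>\<^sup>+v. ennreal (s powr (a / p) / a) *
        (ennreal (v powr ((1 - a / p) - 1) * exp (- (1 * v))) * indicator {0<..} v) \<partial>lborel)"
  proof (rule nn_integral_cong_AE)
    \<comment> \<open>At \<open>v = 0\<close> the inner integral is a divergent full power integral
      while the right side is 0, so this null point has to be removed.\<close>
    have "AE v::real in lborel. v \<noteq> 0" by (rule AE_lborel_singleton)
    then show "AE v in lborel. (\<integral>\<^sup>+x. ennreal (exp (- v)) * indicator {0..s * x powr p} v *
         (ennreal (x powr (- 1 - a)) * indicator {0<..} x) \<partial>lborel) = ennreal (s powr (a / p) / a) *
        (ennreal (v powr ((1 - a / p) - 1) * exp (- (1 * v))) * indicator {0<..} v)"
    proof eventually_elim
      case (elim v)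
      show ?case
      proof (cases "v > 0")
        case False
        then show ?thesis using elim by (auto simp: indicator_def)
      next
        case True
        have *: "v \<le> s * x powr p \<longleftrightarrow> (v / s) powr (1 / p) \<le> x" if "x > 0" for x
        proof -
          have "v \<le> s * x powr p \<longleftrightarrow> v / s \<le> x powr p"
            using assms by (simp add: field_simps)
          also have "\<dots> \<longleftrightarrow> (v / s) powr (1 / p) \<le> (x powr p) powr (1 / p)"
            using assms True powr_mono2[of "1 / p" "v / s" "x powr p"]
              powr_less_mono2[of "1 / p" "x powr p" "v / s"] by force
          also have "(x powr p) powr (1 / p) = x"
            using assms that by (simp add: powr_powr)
          finally show ?thesis .
        qed
        have "(\<integral>\<^sup>+x. ennreal (exp (- v)) * indicator {0..s * x powr p} v *
         (ennreal (x powr (- 1 - a)) * indicator {0<..} x) \<partial>lborel) =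
          (\<integral>\<^sup>+x. ennreal (exp (- v)) * (ennreal (x powr (- 1 - a)) * indicator {(v / s) powr (1 / p)..} x) \<partial>lborel)"
        proof (intro nn_integral_cong)
          fix x :: real
          have "x > 0" if "(v / s) powr (1 / p) \<le> x"
            using that True assms by (smt (verit) divide_pos_pos powr_gt_zero)
          then show "ennreal (exp (- v)) * indicator {0..s * x powr p} v * (ennreal (x powr (- 1 - a)) * indicator {0<..} x)
            = ennreal (exp (- v)) * (ennreal (x powr (- 1 - a)) * indicator {(v / s) powr (1 / p)..} x)"
            using *[of x] True by (auto simp: indicator_def)
        qed
        also have "\<dots> = ennreal (exp (- v)) * ennreal (((v / s) powr (1 / p)) powr (- a) / a)"
          using assms True by (subst nn_integral_cmult) (auto simp: nn_integral_powr_tail)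
        also have "\<dots> = ennreal (s powr (a / p) / a) *
        (ennreal (v powr ((1 - a / p) - 1) * exp (- (1 * v))) * indicator {0<..} v)"
          using assms True
          by (simp add: ennreal_mult[symmetric] powr_powr powr_divide powr_minus field_simps)
        finally show ?thesis .
      qed
    qed
  qed
  also have "\<dots> = ennreal (s powr (a / p) / a) * ennreal (Gamma (1 - a / p) / 1 powr (1 - a / p))"
    using assms by (subst nn_integral_cmult, simp, subst nn_integral_Gamma) auto
  also have "\<dots> = ennreal (s powr (a / p) * Gamma (1 - a / p) / a)"
    using assms by (subst ennreal_mult[symmetric]) (auto simp: field_simps)
  finally show ?thesis .
qed

section \<open>The integral of \<open>1 - cos\<close> against a power, in stages\<close>

lemma nn_integral_one_minus_cos_exp:
  fixes t :: real
  assumes "t > 0"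
  shows "(\<integral>\<^sup>+x. ennreal ((1 - cos x) * exp (- (t * x))) * indicator {0..} x \<partial>lborel) = ennreal (1 / (t * (1 + t\<^sup>2)))"
proof -
  \<comment> \<open>An antiderivative of the integrand: the first term has derivative
    \<open>exp (- (t x))\<close>, the second \<open>- cos x exp (- (t x))\<close>.\<close>
  define F where "F x = - exp (- (t * x)) / t + exp (- (t * x)) * (t * cos x - sin x) / (1 + t\<^sup>2)" for x
  have nz: "1 + t\<^sup>2 \<noteq> 0" by (smt (verit) zero_le_power2)
  have "(\<integral>\<^sup>+x. ennreal ((1 - cos x) * exp (- (t * x))) * indicator {0..} x \<partial>lborel) = ennreal (0 - F 0)"
  proof (rule nn_integral_FTC_atLeast)
    fix x :: real
    show "(F has_real_derivative (1 - cos x) * exp (- (t * x))) (at x)"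
      unfolding F_def using assms nz
      by (auto intro!: derivative_eq_intros) (simp add: divide_simps, algebra)
  next
    have b: "\<bar>t * cos x - sin x\<bar> \<le> t + 1" for x
    proof -
      have "\<bar>t * cos x\<bar> \<le> t" using assms by (simp add: abs_mult)
      then show ?thesis using abs_sin_le_one[of x] by linarith
    qed
    have e: "((\<lambda>x. exp (- (t * x))) \<longlongrightarrow> 0) at_top"
      using assms by real_asymp
    have "((\<lambda>x. exp (- (t * x)) * (t * cos x - sin x)) \<longlongrightarrow> 0) at_top"
    proof (rule Lim_null_comparison)
      show "\<forall>\<^sub>F x in at_top. norm (exp (- (t * x)) * (t * cos x - sin x)) \<le> exp (- (t * x)) * (t + 1)"
        using b by (auto simp: abs_mult)
      show "((\<lambda>x. exp (- (t * x)) * (t + 1)) \<longlongrightarrow> 0) at_top"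
        using tendsto_mult_right[OF e, of "t + 1"] by simp
    qed
    from tendsto_add[OF tendsto_divide[OF tendsto_minus[OF e] tendsto_const[of t]] tendsto_divide[OF this tendsto_const[of "1 + t\<^sup>2"]]]
    show "(F \<longlongrightarrow> 0) at_top" unfolding F_def using assms nz by simp
  qed auto
  also have "0 - F 0 = 1 / (t * (1 + t\<^sup>2))"
    using assms nz by (simp add: F_def divide_simps power2_eq_square)
  finally show ?thesis .
qed

lemma nn_integral_inverse_square_between:
  fixes c :: real
  assumes "c \<ge> 0"
  shows "(\<integral>\<^sup>+w. ennreal (1 / (1 + w)\<^sup>2) * indicator {0..c} w \<partial>lborel) = ennreal (c / (1 + c))"
proof -
  have "(\<integral>\<^sup>+w. ennreal (1 / (1 + w)\<^sup>2) * indicator {0..c} w \<partial>lborel) = ennreal (- 1 / (1 + c) - (- 1 / (1 + 0)))"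
    using assms
    by (intro nn_integral_FTC_Icc) (auto intro!: derivative_eq_intros simp: power2_eq_square)
  also have "- 1 / (1 + c) - (- 1 / (1 + 0)) = c / (1 + c)"
    using assms by (simp add: divide_simps)
  finally show ?thesis .
qed

text \<open>The Beta integral with parameters \<open>a\<close> and \<open>2 - a\<close>, whose
  denominator is \<open>Gamma 2 = 1\<close>. Here \<open>1 / (1 + w)^2\<close> is expanded as the
  integral of \<open>v exp (- (1 + w) v)\<close> and the order of integration is exchanged.\<close>

lemma nn_integral_powr_over_square:
  fixes a :: real
  assumes "0 < a" "a < 2"
  shows "(\<integral>\<^sup>+w. ennreal (w powr (a - 1) / (1 + w)\<^sup>2) * indicator {0<..} w \<partial>lborel) = ennreal (Gamma a * Gamma (2 - a))"
proof -
  have "(\<integral>\<^sup>+w. ennreal (w powr (a - 1) / (1 + w)\<^sup>2) * indicator {0<..} w \<partial>lborel)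
    = (\<integral>\<^sup>+w. (\<integral>\<^sup>+v. ennreal (w powr (a - 1)) * indicator {0<..} w *
        (ennreal (v powr (2 - 1) * exp (- ((1 + w) * v))) * indicator {0<..} v) \<partial>lborel) \<partial>lborel)"
  proof (intro nn_integral_cong)
    fix w :: real
    show "ennreal (w powr (a - 1) / (1 + w)\<^sup>2) * indicator {0<..} w =
      (\<integral>\<^sup>+v. ennreal (w powr (a - 1)) * indicator {0<..} w *
        (ennreal (v powr (2 - 1) * exp (- ((1 + w) * v))) * indicator {0<..} v) \<partial>lborel)"
    proof (cases "w > 0")
      case True
      have "Gamma (2::real) = 1" using Gamma_fact[of 1, where ?'a = real] by (simp add: numeral_2_eq_2)
      then show ?thesis
        using True nn_integral_Gamma[of 2 "1 + w"]
        by (subst nn_integral_cmult) (simp_all add: ennreal_mult[symmetric])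
    qed simp
  qed
  also have "\<dots> = (\<integral>\<^sup>+v. (\<integral>\<^sup>+w. ennreal (w powr (a - 1)) * indicator {0<..} w *
        (ennreal (v powr (2 - 1) * exp (- ((1 + w) * v))) * indicator {0<..} v) \<partial>lborel) \<partial>lborel)"
    by (rule lborel_pair.Fubini') measurable
  also have "\<dots> = (\<integral>\<^sup>+v. ennreal (Gamma a) * (ennreal (v powr ((2 - a) - 1) * exp (- (1 * v))) * indicator {0<..} v) \<partial>lborel)"
  proof (intro nn_integral_cong)
    fix v :: real
    show "(\<integral>\<^sup>+w. ennreal (w powr (a - 1)) * indicator {0<..} w *
        (ennreal (v powr (2 - 1) * exp (- ((1 + w) * v))) * indicator {0<..} v) \<partial>lborel)
      = ennreal (Gamma a) * (ennreal (v powr ((2 - a) - 1) * exp (- (1 * v))) * indicator {0<..} v)"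
    proof (cases "v > 0")
      case True
      have "(\<integral>\<^sup>+w. ennreal (w powr (a - 1)) * indicator {0<..} w *
        (ennreal (v powr (2 - 1) * exp (- ((1 + w) * v))) * indicator {0<..} v) \<partial>lborel)
        = (\<integral>\<^sup>+w. ennreal (v * exp (- v)) * (ennreal (w powr (a - 1) * exp (- (v * w))) * indicator {0<..} w) \<partial>lborel)"
        using True by (intro nn_integral_cong)
          (auto simp: indicator_def ennreal_mult'[symmetric] ennreal_mult''[symmetric] ring_distribs exp_add[symmetric] exp_diff exp_minus divide_inverse mult_ac)
      also have "\<dots> = ennreal (v * exp (- v)) * ennreal (Gamma a / v powr a)"
        using True assms by (subst nn_integral_cmult) (simp_all add: nn_integral_Gamma)
      finally show ?thesis using True assms
        by (simp add: ennreal_mult[symmetric] powr_diff)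
    qed simp
  qed
  also have "\<dots> = ennreal (Gamma a) * ennreal (Gamma (2 - a) / 1 powr (2 - a))"
    using assms by (subst nn_integral_cmult, simp, subst nn_integral_Gamma) auto
  finally show ?thesis
    using assms by (simp add: ennreal_mult[symmetric])
qed

lemma Gamma_reflection_real:
  fixes x :: real
  assumes "0 < x" "x < 1"
  shows "Gamma x * Gamma (1 - x) = pi / sin (pi * x)"
proof -
  have "complex_of_real (Gamma x * Gamma (1 - x)) = complex_of_real (pi / sin (pi * x))"
  proof -
    have "1 - complex_of_real x = complex_of_real (1 - x)"
      "complex_of_real pi * complex_of_real x = complex_of_real (pi * x)" by simp_all
    then show ?thesis
      using Gamma_reflection_complex[of "complex_of_real x"]
      by (simp only: Gamma_complex_of_real sin_of_real of_real_mult[symmetric] of_real_divide[symmetric])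
  qed
  then show ?thesis by (subst (asm) of_real_eq_iff)
qed

text \<open>The substitution \<open>w = t^2\<close> is carried out by Tonelli:
  \<open>t^2 / (1 + t^2)\<close> is the integral of \<open>1 / (1 + w)^2\<close> over
  \<open>[0, t^2]\<close>, so integrating in \<open>t\<close> first leaves the preceding integral
  with parameter \<open>a / 2\<close>. The reflection formula then produces the sine.\<close>

lemma nn_integral_powr_over_one_plus_square:
  fixes a :: real
  assumes "0 < a" "a < 2"
  shows "(\<integral>\<^sup>+t. ennreal (t powr (a - 1) / (1 + t\<^sup>2)) * indicator {0<..} t \<partial>lborel) = ennreal (pi / (2 * sin (pi * a / 2)))"
proof -
  have "(\<integral>\<^sup>+t. ennreal (t powr (a - 1) / (1 + t\<^sup>2)) * indicator {0<..} t \<partial>lborel)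
    = (\<integral>\<^sup>+t. (\<integral>\<^sup>+w. ennreal (1 / (1 + w)\<^sup>2) * indicator {0..t\<^sup>2} w *
         (ennreal (t powr (- 1 - (2 - a))) * indicator {0<..} t) \<partial>lborel) \<partial>lborel)"
  proof (intro nn_integral_cong)
    fix t :: real
    show "ennreal (t powr (a - 1) / (1 + t\<^sup>2)) * indicator {0<..} t =
      (\<integral>\<^sup>+w. ennreal (1 / (1 + w)\<^sup>2) * indicator {0..t\<^sup>2} w *
         (ennreal (t powr (- 1 - (2 - a))) * indicator {0<..} t) \<partial>lborel)"
    proof (cases "t > 0")
      case True
      have "t powr (a - 1) = t powr (- 1 - (2 - a)) * t powr 2"
        by (simp flip: powr_add)
      also have "t powr 2 = t\<^sup>2" using True by simp
      finally show ?thesis using True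
        by (subst nn_integral_multc, simp, subst nn_integral_inverse_square_between)
          (simp_all add: ennreal_mult[symmetric] mult.commute)
    qed simp
  qed
  also have "\<dots> = (\<integral>\<^sup>+w. (\<integral>\<^sup>+t. ennreal (1 / (1 + w)\<^sup>2) * indicator {0..t\<^sup>2} w *
         (ennreal (t powr (- 1 - (2 - a))) * indicator {0<..} t) \<partial>lborel) \<partial>lborel)"
    by (rule lborel_pair.Fubini') (unfold indicator_def atLeastAtMost_iff greaterThan_iff, measurable)
  also have "\<dots> = (\<integral>\<^sup>+w. ennreal (1 / (2 - a)) *
        (ennreal (w powr (a / 2 - 1) / (1 + w)\<^sup>2) * indicator {0<..} w) \<partial>lborel)"
  proof (rule nn_integral_cong_AE)
    have "AE w::real in lborel. w \<noteq> 0" by (rule AE_lborel_singleton)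
    then show "AE w in lborel. (\<integral>\<^sup>+t. ennreal (1 / (1 + w)\<^sup>2) * indicator {0..t\<^sup>2} w *
         (ennreal (t powr (- 1 - (2 - a))) * indicator {0<..} t) \<partial>lborel) = ennreal (1 / (2 - a)) *
        (ennreal (w powr (a / 2 - 1) / (1 + w)\<^sup>2) * indicator {0<..} w)"
    proof eventually_elim
      case (elim w)
      show ?case
      proof (cases "w > 0")
        case False
        then show ?thesis using elim by (auto simp: indicator_def)
      next
        case True
        have "(\<integral>\<^sup>+t. ennreal (1 / (1 + w)\<^sup>2) * indicator {0..t\<^sup>2} w *
         (ennreal (t powr (- 1 - (2 - a))) * indicator {0<..} t) \<partial>lborel) =
          (\<integral>\<^sup>+t. ennreal (1 / (1 + w)\<^sup>2) * (ennreal (t powr (- 1 - (2 - a))) * indicator {sqrt w..} t) \<partial>lborel)"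
        proof (intro nn_integral_cong)
          fix t :: real
          have "sqrt w \<le> t \<longleftrightarrow> w \<le> t\<^sup>2" if "t > 0"
            using that real_sqrt_le_iff[of w "t\<^sup>2"] by simp
          moreover have "t > 0" if "sqrt w \<le> t" using that True real_sqrt_gt_zero[of w] by linarith
          ultimately show "ennreal (1 / (1 + w)\<^sup>2) * indicator {0..t\<^sup>2} w *
             (ennreal (t powr (- 1 - (2 - a))) * indicator {0<..} t)
            = ennreal (1 / (1 + w)\<^sup>2) * (ennreal (t powr (- 1 - (2 - a))) * indicator {sqrt w..} t)"
            using True by (auto simp: indicator_def)
        qed
        also have "\<dots> = ennreal (1 / (1 + w)\<^sup>2) * ennreal (sqrt w powr (- (2 - a)) / (2 - a))"
          using assms True by (subst nn_integral_cmult) (simp, subst nn_integral_powr_tail, auto)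
        also have "sqrt w powr (- (2 - a)) = w powr (a / 2 - 1)"
          using True by (simp add: powr_half_sqrt[symmetric] powr_powr) (simp add: field_simps)
        finally show ?thesis using True assms
          by (simp add: ennreal_mult[symmetric])
      qed
    qed
  qed
  also have "\<dots> = ennreal (1 / (2 - a)) * ennreal (Gamma (a / 2) * Gamma (2 - a / 2))"
    using assms by (subst nn_integral_cmult, simp, subst nn_integral_powr_over_square) auto
  also have "Gamma (2 - a / 2) = (1 - a / 2) * Gamma (1 - a / 2)"
    using Gamma_plus1[of "1 - a / 2"] nonpos_Ints_nonpos[of "1 - a / 2"] assms by fastforce
  also have "Gamma (a / 2) * ((1 - a / 2) * Gamma (1 - a / 2)) = (1 - a / 2) * (pi / sin (pi * (a / 2)))"
  proof -
    have "Gamma (a / 2) * Gamma (1 - a / 2) = pi / sin (pi * (a / 2))"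
      using Gamma_reflection_real[of "a / 2"] assms by simp
    then show ?thesis by (subst mult.left_commute) (rule arg_cong)
  qed
  also have "ennreal (1 / (2 - a)) * ennreal ((1 - a / 2) * (pi / sin (pi * (a / 2))))
    = ennreal (1 / (2 - a) * ((1 - a / 2) * (pi / sin (pi * (a / 2)))))"
    using assms by (intro ennreal_mult'[symmetric]) auto
  also have "1 / (2 - a) * ((1 - a / 2) * (pi / sin (pi * (a / 2)))) = pi / (2 * sin (pi * a / 2))"
  proof -
    have "1 - a / 2 = (2 - a) * (1 / 2)" by (simp add: field_simps)
    then show ?thesis using assms by (simp only:) simp
  qed
  finally show ?thesis .
qed

text \<open>For \<open>u = 1\<close>, expand \<open>x powr (- 1 - a)\<close> as a Gamma integral of
  \<open>t powr a exp (- (x t))\<close>; exchanging the order leaves the Laplace transform of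
  \<open>1 - cos\<close> and then the integral of \<open>t powr (a - 1) / (1 + t^2)\<close>. Other
  nonzero \<open>u\<close> follow by scaling.\<close>

lemma nn_integral_one_minus_cos:
  fixes a u :: real
  assumes "0 < a" "a < 2"
  shows "(\<integral>\<^sup>+x. ennreal ((1 - cos (u * x)) * x powr (- 1 - a)) * indicator {0<..} x \<partial>lborel)
    = ennreal (\<bar>u\<bar> powr a * pi / (2 * Gamma (1 + a) * sin (pi * a / 2)))"
proof -
  have sin: "sin (pi * a / 2) > 0" using assms by (intro sin_gt_zero) (auto simp: field_simps)
  have G: "Gamma (1 + a) > 0" using assms by (intro Gamma_real_pos) auto
  have one: "(\<integral>\<^sup>+x. ennreal ((1 - cos x) * x powr (- 1 - a)) * indicator {0<..} x \<partial>lborel)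
    = ennreal (pi / (2 * Gamma (1 + a) * sin (pi * a / 2)))"
  proof -
    have "(\<integral>\<^sup>+x. ennreal ((1 - cos x) * x powr (- 1 - a)) * indicator {0<..} x \<partial>lborel)
      = (\<integral>\<^sup>+x. (\<integral>\<^sup>+t. ennreal (1 - cos x) * indicator {0<..} x * ennreal (1 / Gamma (1 + a)) *
          (ennreal (t powr ((1 + a) - 1) * exp (- (x * t))) * indicator {0<..} t) \<partial>lborel) \<partial>lborel)"
    proof (intro nn_integral_cong)
      fix x :: real
      show "ennreal ((1 - cos x) * x powr (- 1 - a)) * indicator {0<..} x =
        (\<integral>\<^sup>+t. ennreal (1 - cos x) * indicator {0<..} x * ennreal (1 / Gamma (1 + a)) *
          (ennreal (t powr ((1 + a) - 1) * exp (- (x * t))) * indicator {0<..} t) \<partial>lborel)"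
      proof (cases "x > 0")
        case True
        have "x powr (- 1 - a) = 1 / x powr (1 + a)"
          using powr_minus_divide[of x "1 + a"] by simp
        then show ?thesis using True nn_integral_Gamma[of "1 + a" x] assms G
          by (subst nn_integral_cmult) (simp_all add: ennreal_mult[symmetric] less_imp_neq[OF G, symmetric])
      qed simp
    qed
    also have "\<dots> = (\<integral>\<^sup>+t. (\<integral>\<^sup>+x. ennreal (1 - cos x) * indicator {0<..} x * ennreal (1 / Gamma (1 + a)) *
          (ennreal (t powr ((1 + a) - 1) * exp (- (x * t))) * indicator {0<..} t) \<partial>lborel) \<partial>lborel)"
      by (rule lborel_pair.Fubini') measurable
    also have "\<dots> = (\<integral>\<^sup>+t. ennreal (1 / Gamma (1 + a)) * (ennreal (t powr (a - 1) / (1 + t\<^sup>2)) * indicator {0<..} t) \<partial>lborel)"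
    proof (intro nn_integral_cong)
      fix t :: real
      show "(\<integral>\<^sup>+x. ennreal (1 - cos x) * indicator {0<..} x * ennreal (1 / Gamma (1 + a)) *
          (ennreal (t powr ((1 + a) - 1) * exp (- (x * t))) * indicator {0<..} t) \<partial>lborel)
        = ennreal (1 / Gamma (1 + a)) * (ennreal (t powr (a - 1) / (1 + t\<^sup>2)) * indicator {0<..} t)"
      proof (cases "t > 0")
        case True
        have "(\<integral>\<^sup>+x. ennreal (1 - cos x) * indicator {0<..} x * ennreal (1 / Gamma (1 + a)) *
          (ennreal (t powr ((1 + a) - 1) * exp (- (x * t))) * indicator {0<..} t) \<partial>lborel)
          = (\<integral>\<^sup>+x. ennreal (1 / Gamma (1 + a) * t powr a) * (ennreal ((1 - cos x) * exp (- (t * x))) * indicator {0..} x) \<partial>lborel)"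
        proof (intro nn_integral_cong)
          fix x :: real
          show "ennreal (1 - cos x) * indicator {0<..} x * ennreal (1 / Gamma (1 + a)) *
          (ennreal (t powr ((1 + a) - 1) * exp (- (x * t))) * indicator {0<..} t)
          = ennreal (1 / Gamma (1 + a) * t powr a) * (ennreal ((1 - cos x) * exp (- (t * x))) * indicator {0..} x)"
            \<comment> \<open>The two half-lines differ only at \<open>x = 0\<close>, where
              \<open>1 - cos x\<close> vanishes.\<close>
            using True G by (cases x "0::real" rule: linorder_cases)
              (simp_all add: ennreal_mult[symmetric] mult_ac)
        qed
        also have "\<dots> = ennreal (1 / Gamma (1 + a) * t powr a) * ennreal (1 / (t * (1 + t\<^sup>2)))"
          using True by (subst nn_integral_cmult) (simp_all add: nn_integral_one_minus_cos_exp)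
        finally show ?thesis using True G
          by (simp add: ennreal_mult[symmetric] powr_diff mult_ac)
      qed simp
    qed
    also have "\<dots> = ennreal (1 / Gamma (1 + a)) * ennreal (pi / (2 * sin (pi * a / 2)))"
      using assms by (subst nn_integral_cmult, simp, subst nn_integral_powr_over_one_plus_square) auto
    finally show ?thesis
      using G sin by (simp add: ennreal_mult[symmetric] mult_ac)
  qed
  show ?thesis
  proof (cases "u = 0")
    case False
    define c where "c = \<bar>u\<bar>"
    have c: "c > 0" using False by (simp add: c_def)
    have cos: "cos (u * x) = cos (c * x)" for x
      unfolding c_def by (cases "u \<ge> 0") auto
    have "(\<integral>\<^sup>+x. ennreal ((1 - cos x) * x powr (- 1 - a)) * indicator {0<..} x \<partial>lborel)
      = ennreal \<bar>c\<bar> * (\<integral>\<^sup>+x. ennreal ((1 - cos (0 + c * x)) * (0 + c * x) powr (- 1 - a)) * indicator {0<..} (0 + c * x) \<partial>lborel)"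
      using c by (intro nn_integral_real_affine) auto
    also have "\<dots> = ennreal \<bar>c\<bar> * (\<integral>\<^sup>+x. ennreal (c powr (- 1 - a)) * (ennreal ((1 - cos (u * x)) * x powr (- 1 - a)) * indicator {0<..} x) \<partial>lborel)"
    proof (rule arg_cong[where f="\<lambda>y. ennreal \<bar>c\<bar> * y"], rule nn_integral_cong)
      fix x :: real
      show "ennreal ((1 - cos (0 + c * x)) * (0 + c * x) powr (- 1 - a)) * indicator {0<..} (0 + c * x)
        = ennreal (c powr (- 1 - a)) * (ennreal ((1 - cos (u * x)) * x powr (- 1 - a)) * indicator {0<..} x)"
        using c by (cases "x > 0") (simp_all add: powr_mult zero_less_mult_iff mult_ac ennreal_mult'[symmetric] cos)
    qed
    also have "\<dots> = ennreal (c * c powr (- 1 - a)) * (\<integral>\<^sup>+x. ennreal ((1 - cos (u * x)) * x powr (- 1 - a)) * indicator {0<..} x \<partial>lborel)"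
      using c by (subst nn_integral_cmult) (simp_all add: ennreal_mult mult.assoc)
    also have "c * c powr (- 1 - a) = c powr (- a)"
      using c by (simp add: powr_diff powr_minus field_simps)
    finally have "ennreal (c powr a) * ennreal (pi / (2 * Gamma (1 + a) * sin (pi * a / 2))) =
       ennreal (c powr a) * (ennreal (c powr (- a)) * (\<integral>\<^sup>+x. ennreal ((1 - cos (u * x)) * x powr (- 1 - a)) * indicator {0<..} x \<partial>lborel))"
      by (simp only: one)
    then show ?thesis using c G sin
      by (simp add: mult.assoc[symmetric] ennreal_mult[symmetric] powr_add[symmetric] c_def)
  qed (use assms in simp)
qed

section \<open>Positive stable laws\<close>

lemma integral_PiM_exp_sum:
  fixes \<mu> :: "'a measure" and f :: "'a \<Rightarrow> real"
  assumes "prob_space \<mu>" and f[measurable]: "f \<in> borel_measurable \<mu>" and nonneg: "\<And>x. 0 \<le> f x" and "0 \<le> s"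
  shows "(LINT x|PiM {..<n} (\<lambda>_. \<mu>). exp (- (s * (\<Sum>i<n. f (x i))))) = (LINT x|\<mu>. exp (- (s * f x))) ^ n"
proof -
  interpret \<mu>: prob_space \<mu> by fact
  interpret product_sigma_finite "\<lambda>_::nat. \<mu>" by standard
  have int: "integrable \<mu> (\<lambda>x. exp (- (s * f x)))"
    by (rule \<mu>.integrable_const_bound[where B=1]) (use assms in auto)
  have "(LINT x|PiM {..<n} (\<lambda>_. \<mu>). exp (- (s * (\<Sum>i<n. f (x i))))) =
     (LINT x|PiM {..<n} (\<lambda>_. \<mu>). (\<Prod>i<n. exp (- (s * f (x i)))))"
    by (simp add: exp_sum sum_distrib_left sum_negf[symmetric])
  also have "\<dots> = (\<Prod>i<n. LINT x|\<mu>. exp (- (s * f x)))"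
    by (rule product_integral_prod) (use int in auto)
  finally show ?thesis by simp
qed

text \<open>Both sides of the squeeze come from \<open>1 + x \<le> exp x\<close>, applied at
  \<open>- w\<close> and at \<open>w / (1 - w)\<close>. It serves Laplace transforms of sums of
  \<open>n\<close> independent terms, both for the construction of stable laws and for the sums of
  p-th powers.\<close>

lemma tendsto_one_minus_power_exp:
  fixes w :: "nat \<Rightarrow> real"
  assumes "(\<lambda>n. real n * w n) \<longlonglongrightarrow> c" and "\<And>n. 0 \<le> w n"
  shows "(\<lambda>n. (1 - w n) ^ n) \<longlonglongrightarrow> exp (- c)"
proof -
  have "(\<lambda>n. (real n * w n) * inverse (real n)) \<longlonglongrightarrow> c * 0"
    by (intro tendsto_mult assms lim_inverse_n)
  then have "(\<lambda>n. (real n * w n) * inverse (real n)) \<longlonglongrightarrow> 0" by simp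
  then have w0: "w \<longlonglongrightarrow> 0"
    by (rule Lim_transform_eventually) (auto intro!: eventually_sequentiallyI[of 1])
  show ?thesis
  proof (rule tendsto_sandwich)
    have "\<forall>\<^sub>F n in sequentially. w n < 1" using w0 by (rule order_tendstoD) simp
    then show "\<forall>\<^sub>F n in sequentially. (1 - w n) ^ n \<le> exp (- (real n * w n))"
    proof eventually_elim
      case (elim n)
      have "(1 - w n) ^ n \<le> exp (- w n) ^ n"
        using elim exp_ge_add_one_self[of "- w n"] by (intro power_mono) auto
      then show ?case by (simp add: exp_of_nat_mult[symmetric])
    qed
    from \<open>\<forall>\<^sub>F n in sequentially. w n < 1\<close> show "\<forall>\<^sub>F n in sequentially. exp (- (real n * w n / (1 - w n))) \<le> (1 - w n) ^ n"
    proof eventually_elim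
      case (elim n)
      have "1 / (1 - w n) = 1 + w n / (1 - w n)" using elim by (simp add: divide_simps)
      then have "1 / (1 - w n) \<le> exp (w n / (1 - w n))"
        using exp_ge_add_one_self[of "w n / (1 - w n)"] by simp
      then have "exp (- (w n / (1 - w n))) \<le> 1 - w n"
        using elim by (simp add: exp_minus divide_simps mult.commute)
      then have "exp (- (w n / (1 - w n))) ^ n \<le> (1 - w n) ^ n" by (intro power_mono) auto
      then show ?case by (simp add: exp_of_nat_mult[symmetric])
    qed
    have "(\<lambda>n. exp (- (real n * w n / (1 - w n)))) \<longlonglongrightarrow> exp (- (c / (1 - 0)))"
      by (intro tendsto_intros assms w0) simp
    then show "(\<lambda>n. exp (- (real n * w n / (1 - w n)))) \<longlonglongrightarrow> exp (- c)" by simp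
    show "(\<lambda>n. exp (- (real n * w n))) \<longlonglongrightarrow> exp (- c)"
      by (intro tendsto_intros assms)
  qed
qed

text \<open>Quantitative membership in the domain of attraction of a positive stable law.
  Integrating \<open>1 - exp (- (s x))\<close> against \<open>\<beta> x powr (- 1 - \<beta>)\<close>
  over all positive \<open>x\<close> gives exactly
  \<open>Gamma (1 - \<beta>) s powr \<beta>\<close>; the Pareto law omits only \<open>x < 1\<close>,
  which costs a term linear in \<open>s\<close>, negligible near 0.\<close>

lemma exists_pareto:
  fixes \<beta> :: real
  assumes "0 < \<beta>" "\<beta> < 1"
  obtains P :: "real measure" where "real_distribution P"
    and "\<And>s. s \<ge> 0 \<Longrightarrow> Gamma (1 - \<beta>) * s powr \<beta> - s * (\<beta> * exp 1 * Gamma (1 - \<beta>)) \<le> 1 - (LINT x|P. exp (- (s * max 0 x)))"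
    and "\<And>s. s \<ge> 0 \<Longrightarrow> 1 - (LINT x|P. exp (- (s * max 0 x))) \<le> Gamma (1 - \<beta>) * s powr \<beta>"
proof -
  define P where "P = density lborel (\<lambda>x::real. ennreal (\<beta> * x powr (- 1 - \<beta>)) * indicator {1..} x)"
  have [measurable]: "(\<lambda>x::real. ennreal (\<beta> * x powr (- 1 - \<beta>)) * indicator {1..} x) \<in> borel_measurable lborel"
    by measurable
  have tail: "(\<integral>\<^sup>+x. ennreal (\<beta> * x powr (- 1 - \<beta>)) * indicator {1..} x \<partial>lborel) = 1"
  proof -
    have "(\<integral>\<^sup>+x. ennreal (\<beta> * x powr (- 1 - \<beta>)) * indicator {1..} x \<partial>lborel)
      = (\<integral>\<^sup>+x. ennreal \<beta> * (ennreal (x powr (- 1 - \<beta>)) * indicator {1..} x) \<partial>lborel)"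
      using assms by (intro nn_integral_cong) (simp add: ennreal_mult' mult_ac)
    also have "\<dots> = ennreal \<beta> * ennreal (1 powr (- \<beta>) / \<beta>)"
      using assms by (subst nn_integral_cmult, simp, subst nn_integral_powr_tail) auto
    finally show ?thesis using assms by (simp add: ennreal_mult[symmetric])
  qed
  interpret P: prob_space P
    by standard (use tail in \<open>simp add: P_def emeasure_density\<close>)
  have P: "real_distribution P" by standard (simp_all add: P_def)
  have G: "Gamma (1 - \<beta>) > 0" using assms by (intro Gamma_real_pos) auto
  have bounds: "Gamma (1 - \<beta>) * s powr \<beta> - s * (\<beta> * exp 1 * Gamma (1 - \<beta>)) \<le> 1 - (LINT x|P. exp (- (s * max 0 x)))
     \<and> 1 - (LINT x|P. exp (- (s * max 0 x))) \<le> Gamma (1 - \<beta>) * s powr \<beta>" if "s \<ge> 0" for s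
  proof (cases "s = 0")
    case True then show ?thesis by (simp add: P.prob_space[simplified])
  next
    case False
    with that have s: "s > 0" by simp
    have int: "integrable P (\<lambda>x. exp (- (s * max 0 x)))"
      by (rule P.integrable_const_bound[where B=1]) (use s in \<open>auto simp: P_def\<close>)
    define w where "w = 1 - (LINT x|P. exp (- (s * max 0 x)))"
    have w: "w = (LINT x|P. 1 - exp (- (s * max 0 x)))"
      unfolding w_def using int by (simp add: P.prob_space)
    have w_nonneg: "w \<ge> 0" unfolding w using s by (intro integral_nonneg_AE) auto
    have "ennreal w = (\<integral>\<^sup>+x. ennreal (1 - exp (- (s * max 0 x))) \<partial>P)"
      unfolding w using s int by (intro nn_integral_eq_integral[symmetric]) auto
    also have "\<dots> = (\<integral>\<^sup>+x. (ennreal (\<beta> * x powr (- 1 - \<beta>)) * indicator {1..} x) * ennreal (1 - exp (- (s * max 0 x))) \<partial>lborel)"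
      unfolding P_def by (subst nn_integral_density) auto
    also have "\<dots> = (\<integral>\<^sup>+x. ennreal \<beta> * (ennreal ((1 - exp (- (s * x powr 1))) * x powr (- 1 - \<beta>)) * indicator {1..} x) \<partial>lborel)"
      using assms s by (intro nn_integral_cong) (auto simp: indicator_def ennreal_mult[symmetric] mult_ac)
    finally have w1: "ennreal w = \<dots>" .
    \<comment> \<open>The contribution of \<open>(0, 1)\<close> missing from the Pareto law.\<close>
    define v where "v = (\<integral>\<^sup>+x. ennreal \<beta> * (ennreal ((1 - exp (- (s * x powr 1))) * x powr (- 1 - \<beta>)) * indicator {0<..<1} x) \<partial>lborel)"
    have "ennreal w + v = (\<integral>\<^sup>+x. ennreal \<beta> * (ennreal ((1 - exp (- (s * x powr 1))) * x powr (- 1 - \<beta>)) * indicator {0<..} x) \<partial>lborel)"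
      unfolding w1 v_def
      by (subst nn_integral_add[symmetric]) (auto intro!: nn_integral_cong simp: indicator_def)
    also have "\<dots> = ennreal \<beta> * ennreal (s powr (\<beta> / 1) * Gamma (1 - \<beta> / 1) / \<beta>)"
      using assms s by (subst nn_integral_cmult, simp, subst nn_integral_one_minus_exp_powr) auto
    finally have wv: "ennreal w + v = ennreal (Gamma (1 - \<beta>) * s powr \<beta>)"
      using assms by (simp add: ennreal_mult'[symmetric] mult_ac)
    \<comment> \<open>On \<open>(0, 1)\<close> one has \<open>1 - exp (- (s x)) \<le> s x\<close>
      and \<open>1 \<le> exp 1 exp (- x)\<close>. The second, crude bound turns the integral into a
      Gamma integral and is the origin of the factor \<open>exp 1\<close>.\<close>
    have "v \<le> (\<integral>\<^sup>+x. ennreal (s * \<beta> * exp 1) * (ennreal (x powr ((1 - \<beta>) - 1) * exp (- (1 * x))) * indicator {0<..} x) \<partial>lborel)"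
      unfolding v_def
    proof (intro nn_integral_mono)
      fix x :: real
      show "ennreal \<beta> * (ennreal ((1 - exp (- (s * x powr 1))) * x powr (- 1 - \<beta>)) * indicator {0<..<1} x)
        \<le> ennreal (s * \<beta> * exp 1) * (ennreal (x powr ((1 - \<beta>) - 1) * exp (- (1 * x))) * indicator {0<..} x)"
      proof (cases "0 < x \<and> x < 1")
        case True
        have "1 - exp (- (s * x)) \<le> s * x" using exp_ge_add_one_self[of "- (s * x)"] by simp
        then have "(1 - exp (- (s * x))) * x powr (- 1 - \<beta>) \<le> s * x * x powr (- 1 - \<beta>)"
          by (intro mult_right_mono) auto
        also have "\<dots> = s * x powr (- \<beta>)" using True by (simp add: powr_diff powr_minus field_simps)
        also have "\<dots> \<le> s * x powr (- \<beta>) * (exp 1 * exp (- x))"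
          using True s by (simp add: exp_add[symmetric] mult_le_cancel_left1 not_less)
        finally have "\<beta> * ((1 - exp (- (s * x))) * x powr (- 1 - \<beta>)) \<le> \<beta> * (s * x powr (- \<beta>) * (exp 1 * exp (- x)))"
          using assms by (intro mult_left_mono) auto
        then show ?thesis using True assms s
          by (simp add: ennreal_mult'[symmetric] ennreal_leI mult_ac)
      qed (auto simp: indicator_def)
    qed
    also have "\<dots> = ennreal (s * \<beta> * exp 1) * ennreal (Gamma (1 - \<beta>) / 1 powr (1 - \<beta>))"
      using assms s by (subst nn_integral_cmult, simp, subst nn_integral_Gamma) auto
    finally have v: "v \<le> ennreal (s * (\<beta> * exp 1 * Gamma (1 - \<beta>)))"
      using assms s by (simp add: ennreal_mult'[symmetric] mult_ac)
    then obtain v' where v': "v = ennreal v'" "v' \<ge> 0" "v' \<le> s * (\<beta> * exp 1 * Gamma (1 - \<beta>))"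
      using assms s G by (cases v) (auto simp: top_unique)
    have "w + v' = Gamma (1 - \<beta>) * s powr \<beta>"
      using wv v' w_nonneg G by (simp flip: ennreal_plus)
    then show ?thesis using v' by (simp add: w_def[symmetric])
  qed
  show ?thesis using that[OF P] bounds by blast
qed

text \<open>
  The stable law is a weak limit of normalised sums of independent Pareto variables. Truncating by
  \<open>max 0\<close> avoids tracking that the limit is supported on the nonnegative reals.
\<close>

lemma exists_positive_stable:
  fixes b \<beta> :: real
  assumes "0 < b" "0 < \<beta>" "\<beta> < 1"
  obtains \<mu> :: "real measure" where "real_distribution \<mu>"
    and "\<And>s. s \<ge> 0 \<Longrightarrow> (LINT x|\<mu>. exp (- (s * max 0 x))) = exp (- (b * s powr \<beta>))"
proof -
  obtain P :: "real measure" where P: "real_distribution P"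
    and lower: "\<And>s. s \<ge> 0 \<Longrightarrow> Gamma (1 - \<beta>) * s powr \<beta> - s * (\<beta> * exp 1 * Gamma (1 - \<beta>)) \<le> 1 - (LINT x|P. exp (- (s * max 0 x)))"
    and upper: "\<And>s. s \<ge> 0 \<Longrightarrow> 1 - (LINT x|P. exp (- (s * max 0 x))) \<le> Gamma (1 - \<beta>) * s powr \<beta>"
    using exists_pareto[of \<beta>] assms by metis
  interpret P: real_distribution P by fact
  have G: "Gamma (1 - \<beta>) > 0" using assms by (intro Gamma_real_pos) auto
  \<comment> \<open>Normalised so that \<open>n Gamma (1 - \<beta>) (c n) powr \<beta> = b\<close>
    for positive \<open>n\<close>.\<close>
  define c where "c n = (b / (real n * Gamma (1 - \<beta>))) powr (1 / \<beta>)" for n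
  define Y where "Y n x = (\<Sum>i<n. c n * max 0 (x i))" for n and x :: "nat \<Rightarrow> real"
  define PP where "PP n = PiM {..<n} (\<lambda>_. P)" for n :: nat
  have Y[measurable]: "Y n \<in> borel_measurable (PP n)" for n
    unfolding Y_def PP_def by measurable
  define N where "N n = distr (PP n) borel (Y n)" for n
  have PP: "prob_space (PP n)" for n unfolding PP_def by (intro prob_space_PiM P.prob_space_axioms)
  have N: "real_distribution (N n)" for n
    unfolding N_def by (intro prob_space.real_distribution_distr PP Y)
  have c: "c n \<ge> 0" for n by (simp add: c_def)
  define w where "w n s = 1 - (LINT x|P. exp (- (s * (c n * max 0 x))))" for n s
  have w_upper: "real n * w n s \<le> b * s powr \<beta>" and
    w_lower: "b * s powr \<beta> - real n * c n * s * (\<beta> * exp 1 * Gamma (1 - \<beta>)) \<le> real n * w n s"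
    if "s \<ge> 0" "n > 0" for n s
  proof -
    have e: "real n * (Gamma (1 - \<beta>) * (s * c n) powr \<beta>) = b * s powr \<beta>"
      using that assms G by (simp add: c_def powr_mult powr_powr field_simps less_imp_neq[OF G, symmetric])
    show "real n * w n s \<le> b * s powr \<beta>"
      using upper[of "s * c n"] that c[of n] by (simp add: w_def mult.assoc flip: e)
    have "real n * (Gamma (1 - \<beta>) * (s * c n) powr \<beta> - (s * c n) * (\<beta> * exp 1 * Gamma (1 - \<beta>))) \<le> real n * w n s"
      using lower[of "s * c n"] that c[of n] by (simp add: w_def mult.assoc)
    then show "b * s powr \<beta> - real n * c n * s * (\<beta> * exp 1 * Gamma (1 - \<beta>)) \<le> real n * w n s"
      unfolding e[symmetric] by (simp add: right_diff_distrib mult_ac)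
  qed
  have w_nonneg: "0 \<le> w n s" and w_le_1: "w n s \<le> 1" if "s \<ge> 0" for n s
  proof -
    have "(LINT x|P. exp (- (s * (c n * max 0 x)))) \<le> 1"
      by (intro P.integral_le_const P.integrable_const_bound[where B=1]) (use that c[of n] in auto)
    then show "0 \<le> w n s" by (simp add: w_def)
    show "w n s \<le> 1" unfolding w_def by simp
  qed
  have L: "(LINT x|N n. exp (- (s * max 0 x))) = (1 - w n s) ^ n" if "s \<ge> 0" for s n
  proof -
    have "(LINT x|N n. exp (- (s * max 0 x))) = (LINT x|PP n. exp (- (s * max 0 (Y n x))))"
      unfolding N_def by (rule integral_distr[OF Y]) measurable
    also have "\<dots> = (LINT x|PP n. exp (- (s * Y n x)))"
    proof (rule Bochner_Integration.integral_cong[OF refl])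
      fix x
      have "0 \<le> Y n x" unfolding Y_def using c[of n] by (intro sum_nonneg) auto
      then show "exp (- (s * max 0 (Y n x))) = exp (- (s * Y n x))" by simp
    qed
    also have "\<dots> = (1 - w n s) ^ n"
    proof -
      have "1 - w n s = (LINT x|P. exp (- (s * (c n * max 0 x))))" by (simp add: w_def)
      then show ?thesis unfolding Y_def PP_def
        using integral_PiM_exp_sum[OF P.prob_space_axioms, of "\<lambda>x. c n * max 0 x" s n] c[of n] that
        by simp
    qed
    finally show ?thesis .
  qed
  \<comment> \<open>A Markov bound for \<open>1 - exp (- (y / x))\<close>, which is at least
    \<open>1 - exp (- 1)\<close> beyond \<open>x\<close>, combined with Bernoulli's inequality. It
    is uniform in \<open>n\<close>, which is what tightness needs.\<close>
  have tail: "measure (N n) {x<..} * (1 - exp (- 1)) \<le> b * x powr (- \<beta>)" if "x > 0" "n > 0" for n x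
  proof -
    interpret N: real_distribution "N n" by (rule N)
    have int: "integrable (N n) (\<lambda>y. exp (- (1 / x * max 0 y)))"
      by (rule N.integrable_const_bound[where B=1]) (use that in auto)
    have "(LINT y|N n. (1 - exp (- 1)) * indicator {x<..} y) \<le> (LINT y|N n. 1 - exp (- (1 / x * max 0 y)))"
    proof (intro integral_mono)
      show "integrable (N n) (\<lambda>y. (1 - exp (- 1)) * indicator {x<..} y :: real)"
        by (intro integrable_mult_right integrable_real_indicator) (auto simp: less_top[symmetric])
      show "integrable (N n) (\<lambda>y. 1 - exp (- (1 / x * max 0 y)))"
        using int by simp
      fix y :: real
      show "(1 - exp (- 1)) * indicator {x<..} y \<le> 1 - exp (- (1 / x * max 0 y))"
        using that by (auto simp: indicator_def divide_simps)
    qed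
    also have "\<dots> = 1 - (1 - w n (1 / x)) ^ n"
      using int L[of "1 / x" n] that by (simp add: N.prob_space[simplified])
    also have "\<dots> \<le> real n * w n (1 / x)"
      using Bernoulli_inequality[of "- w n (1 / x)" n] w_le_1[of "1 / x" n] that by simp
    also have "\<dots> \<le> b * (1 / x) powr \<beta>" using that by (intro w_upper) auto
    finally show ?thesis using that by (simp add: powr_divide powr_minus_divide mult.commute)
  qed
  \<comment> \<open>The index is shifted because \<open>tail\<close> is available for positive
    \<open>n\<close> only.\<close>
  have "tight (\<lambda>n. N (Suc n))"
    unfolding tight_def
  proof (intro conjI allI impI N)
    fix \<epsilon> :: real assume \<epsilon>: "\<epsilon> > 0"
    have e: "1 - exp (- 1) > (0::real)" by simp
    have "((\<lambda>x. b * x powr (- \<beta>)) \<longlongrightarrow> 0) at_top" using assms by real_asymp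
    then have "\<forall>\<^sub>F x in at_top. b * x powr (- \<beta>) < \<epsilon> * (1 - exp (- 1))"
      using \<epsilon> e by (intro order_tendstoD) auto
    then have "\<forall>\<^sub>F x in at_top. x > 0 \<and> b * x powr (- \<beta>) < \<epsilon> * (1 - exp (- 1))"
      using eventually_gt_at_top[of "0::real"] by eventually_elim auto
    from eventually_happens'[OF trivial_limit_at_top_linorder this]
    obtain x where x: "x > 0" "b * x powr (- \<beta>) < \<epsilon> * (1 - exp (- 1))" by blast
    have "1 - \<epsilon> < measure (N (Suc n)) {-1<..x}" for n
    proof -
      interpret N: real_distribution "N (Suc n)" by (rule N)
      have Y0: "0 \<le> Y (Suc n) z" for z unfolding Y_def using c[of "Suc n"] by (intro sum_nonneg) auto
      have "\<not> Y (Suc n) z \<le> - 1" for z using Y0[of z] by linarith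
      then have "Y (Suc n) -` {..-1} \<inter> space (PP (Suc n)) = {}" by auto
      then have z: "measure (N (Suc n)) {..-1} = 0"
        unfolding N_def by (subst measure_distr) auto
      have "measure (N (Suc n)) {x<..} * (1 - exp (- 1)) < \<epsilon> * (1 - exp (- 1))"
        using tail[OF x(1), of "Suc n"] x by linarith
      then have "measure (N (Suc n)) {x<..} < \<epsilon>"
        by (rule mult_right_less_imp_less) simp
      moreover have "measure (N (Suc n)) (UNIV - {-1<..x}) \<le> measure (N (Suc n)) ({..-1} \<union> {x<..})"
        by (intro N.finite_measure_mono) auto
      moreover have "\<dots> \<le> measure (N (Suc n)) {..-1} + measure (N (Suc n)) {x<..}"
        by (intro measure_subadditive) auto
      moreover have "measure (N (Suc n)) (UNIV - {-1<..x}) = 1 - measure (N (Suc n)) {-1<..x}"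
        using N.prob_compl[of "{-1<..x}"] by simp
      ultimately show ?thesis using z by linarith
    qed
    then show "\<exists>a b. a < b \<and> (\<forall>n. 1 - \<epsilon> < measure (N (Suc n)) {a<..b})"
      using x(1) by (intro exI[of _ "-1"] exI[of _ x]) auto
  qed
  from tight_imp_convergent_subsubsequence[OF this strict_mono_id]
  obtain r \<mu> where r: "strict_mono (r :: nat \<Rightarrow> nat)" and \<mu>: "real_distribution \<mu>" and
    conv: "weak_conv_m ((\<lambda>n. N (Suc n)) \<circ> id \<circ> r) \<mu>" by blast
  have "(LINT x|\<mu>. exp (- (s * max 0 x))) = exp (- (b * s powr \<beta>))" if s: "s \<ge> 0" for s
  proof -
    have nw: "(\<lambda>n. real n * w n s) \<longlonglongrightarrow> b * s powr \<beta>"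
    proof (rule tendsto_sandwich)
      show "\<forall>\<^sub>F n in sequentially. b * s powr \<beta> - real n * c n * s * (\<beta> * exp 1 * Gamma (1 - \<beta>)) \<le> real n * w n s"
        using w_lower[OF s] by (auto intro!: eventually_sequentiallyI[of 1])
      show "\<forall>\<^sub>F n in sequentially. real n * w n s \<le> b * s powr \<beta>"
        using w_upper[OF s] by (auto intro!: eventually_sequentiallyI[of 1])
      \<comment> \<open>The linear error of the Pareto estimate, multiplied by \<open>n\<close>, is
        of order \<open>n c n\<close>, that is \<open>n powr (1 - 1 / \<beta>)\<close>; it
        disappears because \<open>\<beta> < 1\<close>.\<close>
      have *: "(\<lambda>n. real n powr (1 - 1 / \<beta>)) \<longlonglongrightarrow> 0"
      proof -
        have "1 - 1 / \<beta> < 0" using assms by (simp add: field_simps)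
        then show ?thesis by real_asymp
      qed
      have "real n * c n = (b / Gamma (1 - \<beta>)) powr (1 / \<beta>) * real n powr (1 - 1 / \<beta>)" for n
        using assms G by (cases "n = 0") (auto simp: c_def powr_divide powr_mult powr_diff mult_ac)
      then have "(\<lambda>n. real n * c n) \<longlonglongrightarrow> 0"
        using tendsto_mult_left[OF *, of "(b / Gamma (1 - \<beta>)) powr (1 / \<beta>)"] by simp
      then have "(\<lambda>n. b * s powr \<beta> - real n * c n * s * (\<beta> * exp 1 * Gamma (1 - \<beta>))) \<longlonglongrightarrow> b * s powr \<beta> - 0 * s * (\<beta> * exp 1 * Gamma (1 - \<beta>))"
        by (intro tendsto_intros)
      then show "(\<lambda>n. b * s powr \<beta> - real n * c n * s * (\<beta> * exp 1 * Gamma (1 - \<beta>))) \<longlonglongrightarrow> b * s powr \<beta>" by simp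
    qed simp
    have "(\<lambda>n. (1 - w n s) ^ n) \<longlonglongrightarrow> exp (- (b * s powr \<beta>))"
      by (rule tendsto_one_minus_power_exp[OF nw]) (use w_nonneg s in auto)
    then have "((\<lambda>n. (1 - w n s) ^ n) \<circ> (Suc \<circ> r)) \<longlonglongrightarrow> exp (- (b * s powr \<beta>))"
      by (rule LIMSEQ_subseq_LIMSEQ) (use r in \<open>auto simp: strict_mono_def\<close>)
    moreover have "(\<lambda>n. LINT x|((\<lambda>n. N (Suc n)) \<circ> id \<circ> r) n. exp (- (s * max 0 x))) \<longlonglongrightarrow> (LINT x|\<mu>. exp (- (s * max 0 x)))"
    proof (rule weak_conv_imp_integral_bdd_continuous_conv[OF _ \<mu> conv])
      show "real_distribution (((\<lambda>n. N (Suc n)) \<circ> id \<circ> r) n)" for n using N by simp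
      show "isCont (\<lambda>x. exp (- (s * max 0 x))) x" for x by (intro continuous_intros)
      show "norm (exp (- (s * max 0 x))) \<le> 1" for x using s by simp
    qed
    ultimately show ?thesis
      using L[OF s] by (intro LIMSEQ_unique) (simp_all add: o_def)
  qed
  then show ?thesis using that \<mu> by blast
qed

text \<open>
  Under the law tilted by \<open>exp (- s A)\<close>, the variable \<open>A\<close> concentrates around
  \<open>m = b \<beta> s powr (\<beta> - 1)\<close>; the two subtracted terms are the Chernoff bounds, with parameter \<open>\<eta> s\<close>, for
  leaving \<open>[m (1 - \<delta>), m (1 + \<delta>)]\<close>.
\<close>

lemma (in prob_space) prob_le_ge_tilt:
  fixes A :: "'a \<Rightarrow> real" and b \<beta> \<delta> \<eta> s :: real
  assumes A[measurable]: "A \<in> borel_measurable M" and nonneg: "\<And>\<omega>. \<omega> \<in> space M \<Longrightarrow> 0 \<le> A \<omega>"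
    and L: "\<And>r. r \<ge> 0 \<Longrightarrow> expectation (\<lambda>\<omega>. exp (- (r * A \<omega>))) = exp (- (b * r powr \<beta>))"
    and "0 < s" "0 < \<eta>" "\<eta> < 1"
  shows "exp (- (b * s powr \<beta> * (1 - \<beta> * (1 - \<delta>)))) *
      (1 - exp (- (b * s powr \<beta> * (\<eta> * \<beta> * (1 + \<delta>) + (1 - \<eta>) powr \<beta> - 1)))
         - exp (- (b * s powr \<beta> * ((1 + \<eta>) powr \<beta> - 1 - \<eta> * \<beta> * (1 - \<delta>)))))
    \<le> prob {\<omega> \<in> space M. A \<omega> \<le> b * \<beta> * s powr (\<beta> - 1) * (1 + \<delta>)}"
proof -
  define y where "y = b * s powr \<beta>"
  \<comment> \<open>The derivative of the Laplace exponent \<open>b s powr \<beta>\<close>, hence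
    the mean of the tilted law.\<close>
  define m where "m = b * \<beta> * s powr (\<beta> - 1)"
  define r where "r = \<eta> * s"
  have sm: "s * m = \<beta> * y" using assms by (simp add: m_def y_def powr_diff)
  have rm: "r * m = \<eta> * \<beta> * y" using sm by (simp add: r_def mult.assoc)
  let ?S = "{\<omega> \<in> space M. A \<omega> \<le> m * (1 + \<delta>)}"
  have int: "integrable M (\<lambda>\<omega>. exp (- (q * A \<omega>)))" if "q \<ge> 0" for q
    by (rule integrable_const_bound[where B=1]) (use nonneg that in auto)
  have ind: "integrable M (indicator ?S :: 'a \<Rightarrow> real)"
    by (intro integrable_real_indicator) (auto simp: less_top[symmetric])
  \<comment> \<open>In the window around \<open>m\<close> the first term dominates; above it
    \<open>r (A - m (1 + \<delta>))\<close> is nonnegative and the second does; below it the third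
    does. Taking expectations then needs the Laplace transform only at \<open>s\<close>,
    \<open>s - r\<close> and \<open>s + r\<close>.\<close>
  have pw: "exp (- (s * A \<omega>)) \<le> exp (- (s * m * (1 - \<delta>))) * indicator ?S \<omega>
     + exp (- (r * m * (1 + \<delta>))) * exp (- ((s - r) * A \<omega>))
     + exp (r * m * (1 - \<delta>)) * exp (- ((s + r) * A \<omega>))" if "\<omega> \<in> space M" for \<omega>
  proof -
    have r: "r > 0" using assms by (simp add: r_def)
    consider "A \<omega> > m * (1 + \<delta>)" | "A \<omega> < m * (1 - \<delta>)" | "A \<omega> \<le> m * (1 + \<delta>)" "A \<omega> \<ge> m * (1 - \<delta>)"
      by linarith
    then show ?thesis
    proof cases
      case 1
      have "r * (m * (1 + \<delta>)) \<le> r * A \<omega>" using r 1 by (intro mult_left_mono) auto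
      then have "exp (- (s * A \<omega>)) \<le> exp (- (r * m * (1 + \<delta>))) * exp (- ((s - r) * A \<omega>))"
        by (simp add: exp_add[symmetric] algebra_simps)
      moreover have "0 \<le> exp (- (s * m * (1 - \<delta>))) * indicator ?S \<omega>" by simp
      moreover have "0 \<le> exp (r * m * (1 - \<delta>)) * exp (- ((s + r) * A \<omega>))" by simp
      ultimately show ?thesis by linarith
    next
      case 2
      have "r * A \<omega> \<le> r * (m * (1 - \<delta>))" using r 2 by (intro mult_left_mono) auto
      then have "exp (- (s * A \<omega>)) \<le> exp (r * m * (1 - \<delta>)) * exp (- ((s + r) * A \<omega>))"
        by (simp add: exp_add[symmetric] algebra_simps)
      moreover have "0 \<le> exp (- (s * m * (1 - \<delta>))) * indicator ?S \<omega>" by simp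
      moreover have "0 \<le> exp (- (r * m * (1 + \<delta>))) * exp (- ((s - r) * A \<omega>))" by simp
      ultimately show ?thesis by linarith
    next
      case 3
      have "s * (m * (1 - \<delta>)) \<le> s * A \<omega>" using assms 3 by (intro mult_left_mono) auto
      then have "exp (- (s * A \<omega>)) \<le> exp (- (s * m * (1 - \<delta>))) * indicator ?S \<omega>"
        using 3 that by (simp add: mult.assoc)
      moreover have "0 \<le> exp (r * m * (1 - \<delta>)) * exp (- ((s + r) * A \<omega>))" by simp
      moreover have "0 \<le> exp (- (r * m * (1 + \<delta>))) * exp (- ((s - r) * A \<omega>))" by simp
      ultimately show ?thesis by linarith
    qed
  qed
  have sr: "s - r \<ge> 0" "s + r \<ge> 0" using assms by (auto simp: r_def mult_le_cancel_right1)
  have "exp (- y) = expectation (\<lambda>\<omega>. exp (- (s * A \<omega>)))"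
    using assms by (simp add: y_def)
  also have "\<dots> \<le> expectation (\<lambda>\<omega>. exp (- (s * m * (1 - \<delta>))) * indicator ?S \<omega>
     + exp (- (r * m * (1 + \<delta>))) * exp (- ((s - r) * A \<omega>))
     + exp (r * m * (1 - \<delta>)) * exp (- ((s + r) * A \<omega>)))"
    using pw sr assms by (intro integral_mono Bochner_Integration.integrable_add integrable_mult_right int ind) auto
  also have "\<dots> = exp (- (s * m * (1 - \<delta>))) * prob ?S
     + exp (- (r * m * (1 + \<delta>))) * exp (- (b * (s - r) powr \<beta>))
     + exp (r * m * (1 - \<delta>)) * exp (- (b * (s + r) powr \<beta>))"
    using sr int ind by (simp add: L)
  also have "(s - r) powr \<beta> = s powr \<beta> * (1 - \<eta>) powr \<beta>"
    using assms by (simp add: r_def powr_mult[symmetric] algebra_simps)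
  also have "(s + r) powr \<beta> = s powr \<beta> * (1 + \<eta>) powr \<beta>"
    using assms by (simp add: r_def powr_mult[symmetric] algebra_simps)
  finally have "exp (- y) \<le> exp (- (\<beta> * y * (1 - \<delta>))) * prob ?S
     + exp (- (\<eta> * \<beta> * y * (1 + \<delta>))) * exp (- (y * (1 - \<eta>) powr \<beta>))
     + exp (\<eta> * \<beta> * y * (1 - \<delta>)) * exp (- (y * (1 + \<eta>) powr \<beta>))"
    by (simp add: sm rm y_def mult.assoc)
  then have "exp (\<beta> * y * (1 - \<delta>)) * exp (- y) \<le> exp (\<beta> * y * (1 - \<delta>)) * (exp (- (\<beta> * y * (1 - \<delta>))) * prob ?S
     + exp (- (\<eta> * \<beta> * y * (1 + \<delta>))) * exp (- (y * (1 - \<eta>) powr \<beta>))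
     + exp (\<eta> * \<beta> * y * (1 - \<delta>)) * exp (- (y * (1 + \<eta>) powr \<beta>)))"
    by (intro mult_left_mono) auto
  also have "\<dots> = prob ?S
     + exp (\<beta> * y * (1 - \<delta>)) * exp (- (\<eta> * \<beta> * y * (1 + \<delta>))) * exp (- (y * (1 - \<eta>) powr \<beta>))
     + exp (\<beta> * y * (1 - \<delta>)) * exp (\<eta> * \<beta> * y * (1 - \<delta>)) * exp (- (y * (1 + \<eta>) powr \<beta>))"
  proof -
    have "exp (\<beta> * y * (1 - \<delta>)) * exp (- (\<beta> * y * (1 - \<delta>))) = 1"
      by (simp flip: exp_add)
    then show ?thesis by (simp only: distrib_left mult.assoc[symmetric] mult_1_left)
  qed
  finally have *: "exp (\<beta> * y * (1 - \<delta>)) * exp (- y) - exp (\<beta> * y * (1 - \<delta>)) * exp (- (\<eta> * \<beta> * y * (1 + \<delta>))) * exp (- (y * (1 - \<eta>) powr \<beta>))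
     - exp (\<beta> * y * (1 - \<delta>)) * exp (\<eta> * \<beta> * y * (1 - \<delta>)) * exp (- (y * (1 + \<eta>) powr \<beta>)) \<le> prob ?S"
    by simp
  have "exp (- (y * (1 - \<beta> * (1 - \<delta>)))) *
      (1 - exp (- (y * (\<eta> * \<beta> * (1 + \<delta>) + (1 - \<eta>) powr \<beta> - 1)))
         - exp (- (y * ((1 + \<eta>) powr \<beta> - 1 - \<eta> * \<beta> * (1 - \<delta>))))) =
     exp (\<beta> * y * (1 - \<delta>)) * exp (- y) - exp (\<beta> * y * (1 - \<delta>)) * exp (- (\<eta> * \<beta> * y * (1 + \<delta>))) * exp (- (y * (1 - \<eta>) powr \<beta>))
     - exp (\<beta> * y * (1 - \<delta>)) * exp (\<eta> * \<beta> * y * (1 - \<delta>)) * exp (- (y * (1 + \<eta>) powr \<beta>))"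
    by (simp only: right_diff_distrib mult_1_right exp_add[symmetric]) (simp add: algebra_simps)
  with * show ?thesis by (simp add: y_def m_def)
qed

text \<open>Choose the tilt \<open>s\<close> for which \<open>m (1 + \<delta>) = a\<close>. As
  \<open>\<delta>\<close> tends to 0, the cost becomes the stated constant times
  \<open>a powr (- \<beta> / (1 - \<beta>))\<close>; the strict slack up to \<open>d\<close> pays
  for a positive \<open>\<delta>\<close> and for the Chernoff errors. The spaces are quantified
  inside the eventuality because a single threshold for \<open>a\<close> must serve the product
  spaces of all grid sizes.\<close>

lemma eventually_prob_le_ge_exp:
  fixes b \<beta> d :: real
  assumes "0 < b" "0 < \<beta>" "\<beta> < 1" "(1 - \<beta>) * \<beta> powr (\<beta> / (1 - \<beta>)) * b powr (1 / (1 - \<beta>)) < d"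
  shows "\<forall>\<^sub>F a in at_right 0. \<forall>(M :: 'a measure) A. prob_space M \<longrightarrow> A \<in> borel_measurable M \<longrightarrow>
     (\<forall>\<omega>\<in>space M. 0 \<le> A \<omega>) \<longrightarrow> (\<forall>r\<ge>0. (LINT \<omega>|M. exp (- (r * A \<omega>))) = exp (- (b * r powr \<beta>))) \<longrightarrow>
     exp (- (d * a powr (- \<beta> / (1 - \<beta>)))) \<le> measure M {\<omega> \<in> space M. A \<omega> \<le> a}"
proof -
  \<comment> \<open>The coefficient of \<open>a powr (- \<beta> / (1 - \<beta>))\<close> in the
    exponent of the tilting bound, once \<open>s\<close> has been matched to
    \<open>a\<close>.\<close>
  define D where "D \<delta> = b * (b * \<beta> * (1 + \<delta>)) powr (\<beta> / (1 - \<beta>)) * (1 - \<beta> * (1 - \<delta>))" for \<delta>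
  have "D 0 = (1 - \<beta>) * \<beta> powr (\<beta> / (1 - \<beta>)) * (b * b powr (\<beta> / (1 - \<beta>)))"
    using assms by (simp add: D_def powr_mult)
  also have "b * b powr (\<beta> / (1 - \<beta>)) = b powr (1 + \<beta> / (1 - \<beta>))"
    using assms by (simp add: powr_add)
  also have "1 + \<beta> / (1 - \<beta>) = 1 / (1 - \<beta>)" using assms by (simp add: field_simps)
  finally have D0: "D 0 < d" using assms by simp
  have "isCont D 0" unfolding D_def using assms by (intro continuous_intros) auto
  then have "(D \<longlongrightarrow> D 0) (at_right 0)"
    by (simp add: isCont_def filterlim_at_split)
  then have "\<forall>\<^sub>F \<delta> in at_right 0. D \<delta> < d" using D0 by (rule order_tendstoD)
  moreover have "\<forall>\<^sub>F \<delta>::real in at_right 0. 0 < \<delta> \<and> \<delta> < 1"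
    by (intro eventually_conj eventually_at_right_less eventually_at_rightI[of 0 1]) auto
  ultimately have "\<forall>\<^sub>F \<delta> in at_right 0. D \<delta> < d \<and> 0 < \<delta> \<and> \<delta> < 1"
    by eventually_elim auto
  then obtain \<delta> where \<delta>: "D \<delta> < d" "0 < \<delta>" "\<delta> < 1"
    using eventually_happens trivial_limit_at_right_real by blast
  \<comment> \<open>\<open>g1\<close> and \<open>g2\<close> are the two Chernoff exponents per unit
    of \<open>b s powr \<beta>\<close>. Both vanish at 0 with slope
    \<open>\<beta> \<delta> > 0\<close>, so a small positive \<open>\<eta>\<close> makes both
    positive.\<close>
  define g1 where "g1 \<eta> = \<eta> * \<beta> * (1 + \<delta>) + (1 - \<eta>) powr \<beta> - 1" for \<eta>
  define g2 where "g2 \<eta> = (1 + \<eta>) powr \<beta> - 1 - \<eta> * \<beta> * (1 - \<delta>)" for \<eta>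
  have "(g1 has_real_derivative \<beta> * \<delta>) (at 0)"
    unfolding g1_def by (auto intro!: derivative_eq_intros simp: algebra_simps)
  from DERIV_pos_inc_right[OF this] obtain e1 where e1: "e1 > 0" "\<And>h. 0 < h \<Longrightarrow> h < e1 \<Longrightarrow> g1 0 < g1 (0 + h)"
    using assms \<delta> by auto
  have "(g2 has_real_derivative \<beta> * \<delta>) (at 0)"
    unfolding g2_def by (auto intro!: derivative_eq_intros simp: algebra_simps)
  from DERIV_pos_inc_right[OF this] obtain e2 where e2: "e2 > 0" "\<And>h. 0 < h \<Longrightarrow> h < e2 \<Longrightarrow> g2 0 < g2 (0 + h)"
    using assms \<delta> by auto
  define \<eta> where "\<eta> = min (min e1 e2) 1 / 2"
  have \<eta>: "0 < \<eta>" "\<eta> < 1" "\<eta> < e1" "\<eta> < e2" using e1 e2 by (auto simp: \<eta>_def min_def)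
  have g: "g1 \<eta> > 0" "g2 \<eta> > 0" using e1(2)[of \<eta>] e2(2)[of \<eta>] \<eta> by (auto simp: g1_def g2_def)
  define C where "C = b * (b * \<beta> * (1 + \<delta>)) powr (\<beta> / (1 - \<beta>))"
  have C: "C > 0" using assms \<delta> by (simp add: C_def)
  define \<theta> where "\<theta> = \<beta> / (1 - \<beta>)"
  have \<theta>: "\<theta> > 0" using assms by (simp add: \<theta>_def)
  have x: "filterlim (\<lambda>a::real. a powr (- \<theta>)) at_top (at_right 0)"
    using \<theta> by real_asymp
  \<comment> \<open>Positivity of \<open>Q\<close> says that the bracket of the tilting bound
    exceeds the slack factor \<open>exp (- ((d - D \<delta>) x))\<close>, with
    \<open>x = a powr (- \<theta>)\<close>.\<close>
  define Q where "Q x = 1 - exp (- (C * x * g1 \<eta>)) - exp (- (C * x * g2 \<eta>)) - exp (- ((d - D \<delta>) * x))" for x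
  have "(Q \<longlongrightarrow> 1) at_top"
  proof -
    have "((\<lambda>x. 1 - exp (- (k1 * x)) - exp (- (k2 * x)) - exp (- (k3 * x))) \<longlongrightarrow> 1) at_top"
      if "k1 > 0" "k2 > 0" "k3 > 0" for k1 k2 k3 :: real
      using that by real_asymp
    from this[of "C * g1 \<eta>" "C * g2 \<eta>" "d - D \<delta>"] show ?thesis
      unfolding Q_def using C g \<delta> by (simp add: mult_ac)
  qed
  then have "\<forall>\<^sub>F x in at_top. Q x > 0" by (rule order_tendstoD) simp
  then have "\<forall>\<^sub>F a::real in at_right 0. Q (a powr (- \<theta>)) > 0"
    using x by (rule eventually_compose_filterlim)
  moreover have "\<forall>\<^sub>F a::real in at_right 0. a > 0" by (rule eventually_at_right_less)
  ultimately show ?thesis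
  proof eventually_elim
    case (elim a)
    \<comment> \<open>The solution of
      \<open>b \<beta> s powr (\<beta> - 1) (1 + \<delta>) = a\<close>.\<close>
    define s where "s = (b * \<beta> * (1 + \<delta>) / a) powr (1 / (1 - \<beta>))"
    have s: "s > 0" using elim assms \<delta> by (simp add: s_def)
    have "s powr (\<beta> - 1) = (b * \<beta> * (1 + \<delta>) / a) powr (- 1)"
    proof -
      have "1 / (1 - \<beta>) * (\<beta> - 1) = - 1" using assms by (simp add: divide_simps)
      then show ?thesis by (simp only: s_def powr_powr)
    qed
    then have a: "b * \<beta> * s powr (\<beta> - 1) * (1 + \<delta>) = a"
      using assms \<delta> elim by (simp add: powr_minus divide_simps) (simp add: mult_ac)
    have y: "b * s powr \<beta> = C * a powr (- \<theta>)"
      using assms \<delta> elim by (simp add: s_def powr_powr C_def \<theta>_def powr_divide powr_minus divide_simps)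
    let ?x = "a powr (- \<theta>)"
    have "exp (- (d * ?x)) = exp (- (D \<delta> * ?x)) * exp (- ((d - D \<delta>) * ?x))"
      by (simp add: exp_add[symmetric] algebra_simps)
    also have "\<dots> \<le> exp (- (D \<delta> * ?x)) * (1 - exp (- (C * ?x * g1 \<eta>)) - exp (- (C * ?x * g2 \<eta>)))"
      using elim by (intro mult_left_mono) (auto simp: Q_def)
    also have "D \<delta> * ?x = C * ?x * (1 - \<beta> * (1 - \<delta>))" by (simp add: D_def C_def)
    finally have main: "exp (- (d * ?x)) \<le> exp (- (b * s powr \<beta> * (1 - \<beta> * (1 - \<delta>)))) *
       (1 - exp (- (b * s powr \<beta> * (\<eta> * \<beta> * (1 + \<delta>) + (1 - \<eta>) powr \<beta> - 1)))
         - exp (- (b * s powr \<beta> * ((1 + \<eta>) powr \<beta> - 1 - \<eta> * \<beta> * (1 - \<delta>)))))"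
      by (simp add: y g1_def g2_def)
    show ?case
    proof (intro allI impI)
      fix M :: "'a measure" and A
      assume "prob_space M" and A: "A \<in> borel_measurable M" "\<forall>\<omega>\<in>space M. 0 \<le> A \<omega>"
        "\<forall>r\<ge>0. (LINT \<omega>|M. exp (- (r * A \<omega>))) = exp (- (b * r powr \<beta>))"
      interpret prob_space M by fact
      have "exp (- (b * s powr \<beta> * (1 - \<beta> * (1 - \<delta>)))) *
      (1 - exp (- (b * s powr \<beta> * (\<eta> * \<beta> * (1 + \<delta>) + (1 - \<eta>) powr \<beta> - 1)))
         - exp (- (b * s powr \<beta> * ((1 + \<eta>) powr \<beta> - 1 - \<eta> * \<beta> * (1 - \<delta>)))))
      \<le> prob {\<omega> \<in> space M. A \<omega> \<le> b * \<beta> * s powr (\<beta> - 1) * (1 + \<delta>)}"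
        by (rule prob_le_ge_tilt) (use A s \<eta> in auto)
      with main show "exp (- (d * a powr (- \<beta> / (1 - \<beta>)))) \<le> prob {\<omega> \<in> space M. A \<omega> \<le> a}"
        by (simp add: a \<theta>_def)
    qed
  qed
qed

section \<open>The Levy measure of a symmetric stable law\<close>

text \<open>Since \<open>exp (- x^2 / 2)\<close> is the characteristic function of a standard
  Gaussian, multiplying by it amounts to averaging the characteristic function of \<open>N\<close>
  over Gaussian shifts, by Fubini. The weight \<open>1 - exp (- x^2 / 2)\<close> is of order
  \<open>x^2\<close> at 0, enough to make the stable Levy measure finite.\<close>

lemma char_minus_char_shift:
  fixes N :: "real measure"
  assumes "real_distribution N"
  shows "(CLINT x|N. iexp (u * x) * complex_of_real (1 - exp (- x\<^sup>2 / 2))) =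
    (CLINT v|std_normal_distribution. char N u - char N (u + v))"
proof -
  interpret N: real_distribution N by fact
  interpret S: real_distribution std_normal_distribution by (rule real_dist_normal_dist)
  interpret pair_prob_space N std_normal_distribution ..
  have [measurable_cong]: "sets std_normal_distribution = sets borel" by simp
  have int: "integrable (N \<Otimes>\<^sub>M std_normal_distribution) (\<lambda>(x, v). iexp ((u + v) * x))"
    by (rule integrable_const_bound[where B=1]) (auto simp: split_beta)
  have char: "(CLINT v|std_normal_distribution. iexp (v * x)) = complex_of_real (exp (- x\<^sup>2 / 2))" for x
  proof -
    have "(CLINT v|std_normal_distribution. iexp (v * x)) = char std_normal_distribution x"
      by (simp add: char_def mult.commute)
    then show ?thesis by (simp add: char_std_normal_distribution)
  qed
  have intu: "integrable N (\<lambda>x. iexp (u * x))" for u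
    by (rule N.integrable_const_bound[where B=1]) auto
  have "integrable N (\<lambda>x. iexp (u * x) * complex_of_real (exp (- x\<^sup>2 / 2)))"
    by (rule N.integrable_const_bound[where B=1]) (auto simp: norm_mult)
  then have "(CLINT x|N. iexp (u * x) * complex_of_real (1 - exp (- x\<^sup>2 / 2))) =
    (CLINT x|N. iexp (u * x)) - (CLINT x|N. iexp (u * x) * complex_of_real (exp (- x\<^sup>2 / 2)))"
    using intu[of u] by (simp add: right_diff_distrib)
  also have "(CLINT x|N. iexp (u * x) * complex_of_real (exp (- x\<^sup>2 / 2))) =
    (CLINT x|N. (CLINT v|std_normal_distribution. iexp ((u + v) * x)))"
    unfolding char[symmetric]
    by (intro Bochner_Integration.integral_cong refl)
      (simp add: ring_distribs exp_add integral_mult_right_zero[symmetric] del: integral_mult_right_zero)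
  also have "\<dots> = (CLINT v|std_normal_distribution. (CLINT x|N. iexp ((u + v) * x)))"
    using int by (rule Fubini_integral[symmetric])
  also have "(CLINT x|N. iexp (u * x)) - \<dots> = (CLINT v|std_normal_distribution. char N u - char N (u + v))"
  proof -
    have "integrable std_normal_distribution (\<lambda>v. char N (u + v))"
      by (rule S.integrable_const_bound[where B=1]) (auto simp: N.cmod_char_le_1)
    then show ?thesis by (simp add: S.prob_space[simplified] char_def)
  qed
  finally show ?thesis .
qed

lemma integrable_std_normal_abs_powr:
  fixes a u :: real
  assumes "0 < a" "a < 2"
  shows "integrable std_normal_distribution (\<lambda>v. \<bar>u + v\<bar> powr a)"
proof (rule Bochner_Integration.integrable_bound)
  interpret S: real_distribution std_normal_distribution by (rule real_dist_normal_dist)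
  show "integrable std_normal_distribution (\<lambda>v. 1 + (u\<^sup>2 + 2 * u * v ^ 1 + v ^ 2))"
    by (intro Bochner_Integration.integrable_add integrable_mult_right integrable_std_normal_distribution_moment) auto
  show "AE v in std_normal_distribution. norm (\<bar>u + v\<bar> powr a) \<le> norm (1 + (u\<^sup>2 + 2 * u * v ^ 1 + v ^ 2))"
  proof (rule AE_I2)
    fix v
    have "\<bar>u + v\<bar> powr a \<le> 1 + (u + v)\<^sup>2"
    proof (cases "\<bar>u + v\<bar> \<le> 1")
      case True
      then have "\<bar>u + v\<bar> powr a \<le> 1" using assms powr_le1[of a "\<bar>u + v\<bar>"] by auto
      then show ?thesis using zero_le_power2[of "u + v"] by linarith
    next
      case False
      then have "\<bar>u + v\<bar> powr a \<le> \<bar>u + v\<bar> powr 2" using assms by (intro powr_mono) auto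
      then show ?thesis using False by simp
    qed
    then show "norm (\<bar>u + v\<bar> powr a) \<le> norm (1 + (u\<^sup>2 + 2 * u * v ^ 1 + v ^ 2))"
    proof -
      have "1 + (u\<^sup>2 + 2 * u * v ^ 1 + v ^ 2) = 1 + (u + v)\<^sup>2"
        by (simp add: power2_eq_square algebra_simps)
      then show ?thesis using \<open>\<bar>u + v\<bar> powr a \<le> 1 + (u + v)\<^sup>2\<close> by simp
    qed
  qed
qed simp

section \<open>The stable Levy density and its exponents\<close>

context
  fixes \<alpha> \<kappa> :: real
  assumes \<alpha>: "0 < \<alpha>" "\<alpha> < 2" and \<kappa>: "0 < \<kappa>"
begin

text \<open>Normalised so that integrating \<open>1 - cos (u x)\<close> against the density gives
  exactly \<open>\<kappa> |u|^\<alpha>\<close>: it is \<open>\<kappa>\<close> divided by twice the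
  half-line integral for \<open>u = 1\<close>.\<close>

definition levy_const :: real where
  "levy_const = \<kappa> * Gamma (1 + \<alpha>) * sin (pi * \<alpha> / 2) / pi"

definition levy_density :: "real \<Rightarrow> real" where
  "levy_density x = levy_const * \<bar>x\<bar> powr (- 1 - \<alpha>)"

lemma levy_const_pos: "levy_const > 0"
proof -
  have "sin (pi * \<alpha> / 2) > 0" using \<alpha> by (intro sin_gt_zero) (auto simp: field_simps)
  moreover have "Gamma (1 + \<alpha>) > 0" using \<alpha> by (intro Gamma_real_pos) auto
  ultimately show ?thesis using \<kappa> by (simp add: levy_const_def)
qed

lemma levy_density_measurable[measurable]: "levy_density \<in> borel_measurable borel"
  unfolding levy_density_def by measurable

lemma levy_density_nonneg: "0 \<le> levy_density x"
  using levy_const_pos by (simp add: levy_density_def)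

lemma nn_integral_levy_density:
  fixes f :: "real \<Rightarrow> real"
  assumes [measurable]: "f \<in> borel_measurable borel" and nonneg: "\<And>x. 0 \<le> f x" and even: "\<And>x. f (- x) = f x"
  shows "(\<integral>\<^sup>+x. ennreal (f x * levy_density x) \<partial>lborel)
    = ennreal (2 * levy_const) * (\<integral>\<^sup>+x. ennreal (f x * x powr (- 1 - \<alpha>)) * indicator {0<..} x \<partial>lborel)"
proof -
  define I where "I = (\<integral>\<^sup>+x. ennreal (f x * levy_density x) * indicator {0<..} x \<partial>lborel)"
  have ev: "levy_density (- x) = levy_density x" for x by (simp add: levy_density_def)
  have "AE x::real in lborel. x \<noteq> 0" by (rule AE_lborel_singleton)
  then have "(\<integral>\<^sup>+x. ennreal (f x * levy_density x) \<partial>lborel) =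
     (\<integral>\<^sup>+x. ennreal (f x * levy_density x) * indicator {0<..} x + ennreal (f x * levy_density x) * indicator {..<0} x \<partial>lborel)"
    by (intro nn_integral_cong_AE) (auto simp: indicator_def)
  also have "\<dots> = I + (\<integral>\<^sup>+x. ennreal (f x * levy_density x) * indicator {..<0} x \<partial>lborel)"
    unfolding I_def by (intro nn_integral_add) auto
  also have "(\<integral>\<^sup>+x. ennreal (f x * levy_density x) * indicator {..<0} x \<partial>lborel) =
     ennreal \<bar>- 1\<bar> * (\<integral>\<^sup>+x. ennreal (f (0 + - 1 * x) * levy_density (0 + - 1 * x)) * indicator {..<0} (0 + - 1 * x) \<partial>lborel)"
    by (rule nn_integral_real_affine) auto
  also have "\<dots> = I"
    unfolding I_def by (auto intro!: nn_integral_cong simp: even ev indicator_def)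
  also have "I = (\<integral>\<^sup>+x. ennreal levy_const * (ennreal (f x * x powr (- 1 - \<alpha>)) * indicator {0<..} x) \<partial>lborel)"
    unfolding I_def
    using nonneg levy_const_pos
    by (intro nn_integral_cong) (auto simp: indicator_def levy_density_def ennreal_mult'[symmetric] mult_ac)
  also have "\<dots> = ennreal levy_const * (\<integral>\<^sup>+x. (ennreal (f x * x powr (- 1 - \<alpha>)) * indicator {0<..} x) \<partial>lborel)"
    by (intro nn_integral_cmult) auto
  finally have *: "(\<integral>\<^sup>+x. ennreal (f x * levy_density x) \<partial>lborel) =
     ennreal levy_const * (\<integral>\<^sup>+x. (ennreal (f x * x powr (- 1 - \<alpha>)) * indicator {0<..} x) \<partial>lborel) +
     ennreal levy_const * (\<integral>\<^sup>+x. (ennreal (f x * x powr (- 1 - \<alpha>)) * indicator {0<..} x) \<partial>lborel)" .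
  have "ennreal (2 * levy_const) = ennreal levy_const + ennreal levy_const"
    using levy_const_pos by (subst ennreal_plus[symmetric]) auto
  then show ?thesis unfolding * by (simp only: distrib_right)
qed

lemma nn_integral_cos_levy:
  "(\<integral>\<^sup>+x. ennreal ((1 - cos (u * x)) * levy_density x) \<partial>lborel) = ennreal (\<kappa> * \<bar>u\<bar> powr \<alpha>)"
proof -
  have sin: "sin (pi * \<alpha> / 2) > 0" using \<alpha> by (intro sin_gt_zero) (auto simp: field_simps)
  have G: "Gamma (1 + \<alpha>) > 0" using \<alpha> by (intro Gamma_real_pos) auto
  have "(\<integral>\<^sup>+x. ennreal ((1 - cos (u * x)) * levy_density x) \<partial>lborel) =
    ennreal (2 * levy_const) * ennreal (\<bar>u\<bar> powr \<alpha> * pi / (2 * Gamma (1 + \<alpha>) * sin (pi * \<alpha> / 2)))"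
    unfolding nn_integral_one_minus_cos[OF \<alpha>, symmetric]
    by (rule nn_integral_levy_density) auto
  also have "\<dots> = ennreal (2 * levy_const * (\<bar>u\<bar> powr \<alpha> * pi / (2 * Gamma (1 + \<alpha>) * sin (pi * \<alpha> / 2))))"
    using levy_const_pos by (intro ennreal_mult'[symmetric]) simp
  also have "2 * levy_const * (\<bar>u\<bar> powr \<alpha> * pi / (2 * Gamma (1 + \<alpha>) * sin (pi * \<alpha> / 2))) = \<kappa> * \<bar>u\<bar> powr \<alpha>"
    using sin G by (simp add: levy_const_def)
  finally show ?thesis .
qed

lemma integrable_cos_levy: "integrable lborel (\<lambda>x. (1 - cos (u * x)) * levy_density x)"
  and integral_cos_levy: "(LBINT x. (1 - cos (u * x)) * levy_density x) = \<kappa> * \<bar>u\<bar> powr \<alpha>"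
proof -
  have *: "AE x in lborel. 0 \<le> (1 - cos (u * x)) * levy_density x"
    by (intro AE_I2 mult_nonneg_nonneg levy_density_nonneg) simp
  show "integrable lborel (\<lambda>x. (1 - cos (u * x)) * levy_density x)"
    using * by (intro integrableI_nn_integral_finite[where x="\<kappa> * \<bar>u\<bar> powr \<alpha>"] nn_integral_cos_levy) auto
  show "(LBINT x. (1 - cos (u * x)) * levy_density x) = \<kappa> * \<bar>u\<bar> powr \<alpha>"
    using * \<kappa> by (subst integral_eq_nn_integral) (auto simp: nn_integral_cos_levy)
qed

text \<open>The Laplace exponent of the sum of the p-th powers of the jumps over unit time. The
  \<open>\<alpha>\<close> in \<open>Gamma (1 + \<alpha>) = \<alpha> Gamma \<alpha>\<close> cancels
  the denominator left by the power integral.\<close>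

lemma integral_exp_powr_levy:
  assumes "\<alpha> < p" "0 < s"
  shows "(LBINT x. (1 - exp (- (s * \<bar>x\<bar> powr p))) * levy_density x) =
      2 * \<kappa> * Gamma \<alpha> * sin (pi * \<alpha> / 2) / pi * Gamma (1 - \<alpha> / p) * s powr (\<alpha> / p)" (is "_ = ?R")
proof -
  have sin: "sin (pi * \<alpha> / 2) > 0" using \<alpha> by (intro sin_gt_zero) (auto simp: field_simps)
  have G: "Gamma \<alpha> > 0" "Gamma (1 - \<alpha> / p) > 0" using \<alpha> assms by (auto intro!: Gamma_real_pos)
  have G1: "Gamma (1 + \<alpha>) = \<alpha> * Gamma \<alpha>"
    using Gamma_plus1[of \<alpha>] nonpos_Ints_nonpos[of \<alpha>] \<alpha> by (force simp: add.commute)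
  have "(\<integral>\<^sup>+x. ennreal ((1 - exp (- (s * \<bar>x\<bar> powr p))) * levy_density x) \<partial>lborel) =
     ennreal (2 * levy_const) * (\<integral>\<^sup>+x. ennreal ((1 - exp (- (s * \<bar>x\<bar> powr p))) * x powr (- 1 - \<alpha>)) * indicator {0<..} x \<partial>lborel)"
    using assms by (intro nn_integral_levy_density) auto
  also have "(\<integral>\<^sup>+x. ennreal ((1 - exp (- (s * \<bar>x\<bar> powr p))) * x powr (- 1 - \<alpha>)) * indicator {0<..} x \<partial>lborel)
    = (\<integral>\<^sup>+x. ennreal ((1 - exp (- (s * x powr p))) * x powr (- 1 - \<alpha>)) * indicator {0<..} x \<partial>lborel)"
    by (intro nn_integral_cong) (auto simp: indicator_def)
  also have "\<dots> = ennreal (s powr (\<alpha> / p) * Gamma (1 - \<alpha> / p) / \<alpha>)"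
    using \<alpha> assms by (intro nn_integral_one_minus_exp_powr)
  also have "ennreal (2 * levy_const) * \<dots> = ennreal (2 * levy_const * (s powr (\<alpha> / p) * Gamma (1 - \<alpha> / p) / \<alpha>))"
    using levy_const_pos by (intro ennreal_mult'[symmetric]) simp
  also have "2 * levy_const * (s powr (\<alpha> / p) * Gamma (1 - \<alpha> / p) / \<alpha>) = ?R"
    using \<alpha> by (simp add: levy_const_def G1)
  finally have nn: "(\<integral>\<^sup>+x. ennreal ((1 - exp (- (s * \<bar>x\<bar> powr p))) * levy_density x) \<partial>lborel) = ennreal ?R" .
  have *: "AE x in lborel. 0 \<le> (1 - exp (- (s * \<bar>x\<bar> powr p))) * levy_density x"
    using assms by (intro AE_I2 mult_nonneg_nonneg levy_density_nonneg) simp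
  show "(LBINT x. (1 - exp (- (s * \<bar>x\<bar> powr p))) * levy_density x) = ?R"
    using * \<kappa> sin G by (subst integral_eq_nn_integral) (auto simp: nn)
qed

end

lemma integral_iexp_even:
  fixes k :: "real \<Rightarrow> real"
  assumes int: "integrable lborel k" and even: "\<And>x. k (- x) = k x"
  shows "(CLBINT x. k x *\<^sub>R iexp (u * x)) = complex_of_real (LBINT x. cos (u * x) * k x)"
proof -
  have [measurable]: "k \<in> borel_measurable borel" using borel_measurable_integrable[OF int] by simp
  have ic: "integrable lborel (\<lambda>x. cos (u * x) * k x)"
    using int by (rule Bochner_Integration.integrable_bound) (auto simp: abs_mult intro!: mult_left_le_one_le)
  have isn: "integrable lborel (\<lambda>x. sin (u * x) * k x)"
    using int by (rule Bochner_Integration.integrable_bound) (auto simp: abs_mult intro!: mult_left_le_one_le)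
  have "(LBINT x. sin (u * x) * k x) = \<bar>- 1\<bar> *\<^sub>R (LBINT x. sin (u * (0 + - 1 * x)) * k (0 + - 1 * x))"
    by (rule lborel_integral_real_affine) simp
  then have s0: "(LBINT x. sin (u * x) * k x) = 0"
    by (simp add: even)
  have "(CLBINT x. k x *\<^sub>R iexp (u * x)) = (CLBINT x. complex_of_real (cos (u * x) * k x) + \<i> * complex_of_real (sin (u * x) * k x))"
    by (intro Bochner_Integration.integral_cong refl)
      (simp add: Re_exp Im_exp complex_eq_iff)
  also have "\<dots> = complex_of_real (LBINT x. cos (u * x) * k x) + \<i> * complex_of_real (LBINT x. sin (u * x) * k x)"
    using ic isn by (subst Bochner_Integration.integral_add) (simp_all del: of_real_mult)
  finally show ?thesis by (simp add: s0)
qed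

text \<open>The counterpart of \<open>char_minus_char_shift\<close> for the infinite Levy measure.
  Averaging the nonnegative \<open>1 - cos ((u + v) x)\<close> over a Gaussian \<open>v\<close>
  gives \<open>1 - cos (u x) exp (- x^2 / 2)\<close>, and subtracting \<open>1 - cos (u x)\<close>
  leaves the weighted cosine. Product integrability reduces to a finite Gaussian mean of
  \<open>|u + v|^\<alpha>\<close>, where \<open>\<alpha> < 2\<close> enters.\<close>

lemma integral_levy_gauss:
  fixes \<alpha> \<kappa> u :: real
  assumes \<alpha>: "0 < \<alpha>" "\<alpha> < 2" and \<kappa>: "0 < \<kappa>"
  defines "\<nu> \<equiv> levy_density \<alpha> \<kappa>"
  shows "integrable lborel (\<lambda>x. (1 - exp (- x\<^sup>2 / 2)) * \<nu> x)"
    and "(LBINT x. cos (u * x) * ((1 - exp (- x\<^sup>2 / 2)) * \<nu> x)) =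
      (LINT v|std_normal_distribution. \<kappa> * \<bar>u + v\<bar> powr \<alpha> - \<kappa> * \<bar>u\<bar> powr \<alpha>)"
proof -
  interpret S: real_distribution std_normal_distribution by (rule real_dist_normal_dist)
  interpret pair_sigma_finite lborel std_normal_distribution ..
  have [measurable_cong]: "sets std_normal_distribution = sets borel" by simp
  have [measurable]: "\<nu> \<in> borel_measurable borel"
    unfolding \<nu>_def by (rule levy_density_measurable[OF \<alpha> \<kappa>])
  have \<nu>_nonneg: "0 \<le> \<nu> x" for x unfolding \<nu>_def by (rule levy_density_nonneg[OF \<alpha> \<kappa>])
  have ic: "integrable lborel (\<lambda>x. (1 - cos (u * x)) * \<nu> x)" for u
    unfolding \<nu>_def by (rule integrable_cos_levy[OF \<alpha> \<kappa>])
  have vc: "(LBINT x. (1 - cos (u * x)) * \<nu> x) = \<kappa> * \<bar>u\<bar> powr \<alpha>" for u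
    unfolding \<nu>_def by (rule integral_cos_levy[OF \<alpha> \<kappa>])
  have nnc: "(\<integral>\<^sup>+x. ennreal ((1 - cos (u * x)) * \<nu> x) \<partial>lborel) = ennreal (\<kappa> * \<bar>u\<bar> powr \<alpha>)" for u
    unfolding \<nu>_def by (rule nn_integral_cos_levy[OF \<alpha> \<kappa>])
  have ip: "integrable std_normal_distribution (\<lambda>v. \<kappa> * \<bar>u + v\<bar> powr \<alpha>)" for u
    using integrable_std_normal_abs_powr[OF \<alpha>] by simp
  have int2: "integrable (lborel \<Otimes>\<^sub>M std_normal_distribution) (\<lambda>(x, v). (1 - cos ((u + v) * x)) * \<nu> x)" for u
  proof (rule integrableI_bounded)
    have "(\<integral>\<^sup>+z. ennreal (norm (case z of (x, v) \<Rightarrow> (1 - cos ((u + v) * x)) * \<nu> x)) \<partial>(lborel \<Otimes>\<^sub>M std_normal_distribution))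
      = (\<integral>\<^sup>+v. (\<integral>\<^sup>+x. ennreal ((1 - cos ((u + v) * x)) * \<nu> x) \<partial>lborel) \<partial>std_normal_distribution)"
      by (subst nn_integral_snd[symmetric]) (auto simp: abs_mult \<nu>_nonneg)
    also have "\<dots> = (\<integral>\<^sup>+v. ennreal (\<kappa> * \<bar>u + v\<bar> powr \<alpha>) \<partial>std_normal_distribution)"
      by (simp add: nnc)
    also have "\<dots> = ennreal (LINT v|std_normal_distribution. \<kappa> * \<bar>u + v\<bar> powr \<alpha>)"
      using \<kappa> by (intro nn_integral_eq_integral ip) auto
    also have "\<dots> < \<infinity>" by simp
    finally show "(\<integral>\<^sup>+z. ennreal (norm (case z of (x, v) \<Rightarrow> (1 - cos ((u + v) * x)) * \<nu> x)) \<partial>(lborel \<Otimes>\<^sub>M std_normal_distribution)) < \<infinity>" .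
  qed measurable
  have ccos: "integrable std_normal_distribution (\<lambda>v. cos ((u + v) * x))" for x u
    by (rule S.integrable_const_bound[where B=1]) auto
  have gauss: "(LINT v|std_normal_distribution. cos ((u + v) * x)) = cos (u * x) * exp (- x\<^sup>2 / 2)" for x u
  proof -
    have "(CLINT v|std_normal_distribution. iexp ((u + v) * x)) = (CLINT v|std_normal_distribution. iexp (u * x) * iexp (x * v))"
      by (intro Bochner_Integration.integral_cong refl) (simp add: exp_add[symmetric] algebra_simps)
    also have "\<dots> = iexp (u * x) * char std_normal_distribution x"
      unfolding char_def by (rule integral_mult_right_zero)
    also have "\<dots> = iexp (u * x) * complex_of_real (exp (- x\<^sup>2 / 2))"
      by (simp add: char_std_normal_distribution)
    finally have "Re (CLINT v|std_normal_distribution. iexp ((u + v) * x)) = Re (iexp (u * x) * complex_of_real (exp (- x\<^sup>2 / 2)))"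
      by (rule arg_cong)
    moreover have "integrable std_normal_distribution (\<lambda>v. iexp ((u + v) * x))"
      by (rule S.integrable_const_bound[where B=1]) auto
    then have "Re (CLINT v|std_normal_distribution. iexp ((u + v) * x)) = (LINT v|std_normal_distribution. Re (iexp ((u + v) * x)))"
      by (rule integral_Re[symmetric])
    ultimately show ?thesis by (simp add: Re_exp)
  qed
  have F: "integrable lborel (\<lambda>x. LINT v|std_normal_distribution. (1 - cos ((u + v) * x)) * \<nu> x)" for u
    using integrable_fst'[OF int2[of u]] by (simp only: prod.case)
  have E: "(LINT v|std_normal_distribution. (1 - cos ((u + v) * x)) * \<nu> x) = (1 - cos (u * x) * exp (- x\<^sup>2 / 2)) * \<nu> x" for x u
    using ccos[of u x] by (simp add: gauss S.prob_space[simplified])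
  from F[of 0] show "integrable lborel (\<lambda>x. (1 - exp (- x\<^sup>2 / 2)) * \<nu> x)"
    unfolding E by simp
  have "(LBINT x. cos (u * x) * ((1 - exp (- x\<^sup>2 / 2)) * \<nu> x)) =
     (LBINT x. (1 - cos (u * x) * exp (- x\<^sup>2 / 2)) * \<nu> x - (1 - cos (u * x)) * \<nu> x)"
    by (intro Bochner_Integration.integral_cong refl) (simp add: algebra_simps)
  also have "\<dots> = (LBINT x. (1 - cos (u * x) * exp (- x\<^sup>2 / 2)) * \<nu> x) - \<kappa> * \<bar>u\<bar> powr \<alpha>"
    using F[of u] ic[of u] unfolding E by (simp add: vc)
  also have "(LBINT x. (1 - cos (u * x) * exp (- x\<^sup>2 / 2)) * \<nu> x) =
    (LINT v|std_normal_distribution. (LBINT x. (1 - cos ((u + v) * x)) * \<nu> x))"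
    unfolding E[symmetric] using Fubini_integral[OF int2[of u]] by simp
  also have "\<dots> = (LINT v|std_normal_distribution. \<kappa> * \<bar>u + v\<bar> powr \<alpha>)"
    by (simp add: vc)
  also have "\<dots> - \<kappa> * \<bar>u\<bar> powr \<alpha> = (LINT v|std_normal_distribution. \<kappa> * \<bar>u + v\<bar> powr \<alpha> - \<kappa> * \<bar>u\<bar> powr \<alpha>)"
    using ip[of u] by (simp add: S.prob_space[simplified])
  finally show "(LBINT x. cos (u * x) * ((1 - exp (- x\<^sup>2 / 2)) * \<nu> x)) =
      (LINT v|std_normal_distribution. \<kappa> * \<bar>u + v\<bar> powr \<alpha> - \<kappa> * \<bar>u\<bar> powr \<alpha>)" .
qed

text \<open>The numerator is at most \<open>s |x|^p\<close>, and
  \<open>y exp (- y) \<le> 1 - exp (- y)\<close> with \<open>y = x^2 / 2 \<le> 1 / 2\<close> bounds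
  the denominator below by a multiple of \<open>x^2\<close>. At \<open>x = 0\<close> both sides are
  0.\<close>

lemma stable_test_function_bound:
  fixes p s x :: real
  assumes "2 < p" "0 < s" "\<bar>x\<bar> < 1"
  shows "(1 - exp (- (s * \<bar>x\<bar> powr p))) / (1 - exp (- x\<^sup>2 / 2)) \<le> 2 * s * exp (1 / 2) * \<bar>x\<bar> powr (p - 2)"
proof (cases "x = 0")
  case False
  have x2: "x\<^sup>2 / 2 > 0" using False by simp
  have "x\<^sup>2 \<le> 1" using assms by (simp add: abs_square_le_1)
  then have "x\<^sup>2 / 2 * exp (- (1 / 2)) \<le> x\<^sup>2 / 2 * exp (- (x\<^sup>2 / 2))"
    by (intro mult_left_mono) auto
  also have "\<dots> \<le> 1 - exp (- (x\<^sup>2 / 2))"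
  proof -
    have "(1 + x\<^sup>2 / 2) * exp (- (x\<^sup>2 / 2)) \<le> exp (x\<^sup>2 / 2) * exp (- (x\<^sup>2 / 2))"
      by (intro mult_right_mono exp_ge_add_one_self) simp
    then show ?thesis by (simp add: exp_add[symmetric] distrib_right)
  qed
  finally have d: "x\<^sup>2 / 2 * exp (- (1 / 2)) \<le> 1 - exp (- x\<^sup>2 / 2)" by simp
  have n: "1 - exp (- (s * \<bar>x\<bar> powr p)) \<le> s * \<bar>x\<bar> powr p"
    using exp_ge_add_one_self[of "- (s * \<bar>x\<bar> powr p)"] by simp
  have "(1 - exp (- (s * \<bar>x\<bar> powr p))) / (1 - exp (- x\<^sup>2 / 2)) \<le> (s * \<bar>x\<bar> powr p) / (x\<^sup>2 / 2 * exp (- (1 / 2)))"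
    using n d x2 assms by (intro frac_le) auto
  also have "\<dots> = 2 * s * exp (1 / 2) * (\<bar>x\<bar> powr p / \<bar>x\<bar> powr 2)"
    using False by (simp add: exp_minus divide_simps)
  also have "\<bar>x\<bar> powr p / \<bar>x\<bar> powr 2 = \<bar>x\<bar> powr (p - 2)"
    by (simp add: powr_diff)
  finally show ?thesis .
qed simp

text \<open>For \<open>|x| \<ge> 1\<close> the denominator is at least
  \<open>1 - exp (- 1 / 2)\<close>; inside the unit interval the preceding bound applies, and at 0
  it forces the limit 0 because \<open>p > 2\<close>.\<close>

lemma stable_test_function:
  fixes p s :: real
  assumes "2 < p" "0 < s"
  defines "k \<equiv> \<lambda>x::real. (1 - exp (- (s * \<bar>x\<bar> powr p))) / (1 - exp (- x\<^sup>2 / 2))"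
  shows "isCont k x" and "norm (k x) \<le> max (2 * s * exp (1 / 2)) (1 / (1 - exp (- 1 / 2)))"
proof -
  have nonneg: "0 \<le> k x" for x
    unfolding k_def using assms by (intro divide_nonneg_nonneg) auto
  show "isCont k x"
  proof (cases "x = 0")
    case False
    then show ?thesis unfolding k_def
      by (intro continuous_intros) auto
  next
    case True
    have "(k \<longlongrightarrow> 0) (at 0)"
    proof (rule tendsto_sandwich)
      show "\<forall>\<^sub>F x in at 0. 0 \<le> k x" using nonneg by simp
      have "\<forall>\<^sub>F x::real in at 0. \<bar>x\<bar> < 1"
        by (rule eventually_at_in_open'[of "{-1<..<1}" 0, THEN eventually_mono]) auto
      then show "\<forall>\<^sub>F x in at 0. k x \<le> 2 * s * exp (1 / 2) * \<bar>x\<bar> powr (p - 2)"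
        by eventually_elim (use assms stable_test_function_bound in \<open>auto simp: k_def\<close>)
      have "((\<lambda>x::real. \<bar>x\<bar> powr (p - 2)) \<longlongrightarrow> \<bar>0\<bar> powr (p - 2)) (at 0)"
        using assms by (intro tendsto_powr2 tendsto_intros) auto
      then have "((\<lambda>x::real. \<bar>x\<bar> powr (p - 2)) \<longlongrightarrow> 0) (at 0)" by simp
      from tendsto_mult_right_zero[OF this, of "2 * s * exp (1 / 2)"]
      show "((\<lambda>x. 2 * s * exp (1 / 2) * \<bar>x\<bar> powr (p - 2)) \<longlongrightarrow> 0) (at 0)" .
    qed simp
    then show ?thesis using True by (simp add: isCont_def k_def)
  qed
  show "norm (k x) \<le> max (2 * s * exp (1 / 2)) (1 / (1 - exp (- 1 / 2)))"
  proof (cases "\<bar>x\<bar> < 1")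
    case True
    have "k x \<le> 2 * s * exp (1 / 2) * \<bar>x\<bar> powr (p - 2)"
      using assms True stable_test_function_bound by (auto simp: k_def)
    also have "\<dots> \<le> 2 * s * exp (1 / 2) * 1"
      using True assms by (intro mult_left_mono powr_le1) auto
    finally show ?thesis using nonneg[of x] by simp
  next
    case False
    then have "1 \<le> x\<^sup>2" using abs_le_square_iff[of 1 x] by simp
    then have "1 - exp (- 1 / 2) \<le> 1 - exp (- x\<^sup>2 / 2)" by simp
    then have "k x \<le> 1 / (1 - exp (- 1 / 2))"
      unfolding k_def using assms by (intro frac_le) auto
    then show ?thesis using nonneg[of x] by simp
  qed
qed

lemma AE_std_normal_nonzero: "AE v in std_normal_distribution. v \<noteq> (0::real)"
  by (subst AE_density) (auto intro: eventually_mono[OF AE_lborel_singleton[of 0]])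

text \<open>
  The measures \<open>(1 - exp (- x\<^sup>2 / 2)) N\<^sub>n(dx) / h\<^sub>n\<close> are finite, and a Gaussian average expresses their
  characteristic functions through that of \<open>N\<^sub>n\<close>; so Levy's continuity theorem applies after
  normalisation. For \<open>p > 2\<close> the quotient \<open>(1 - exp (- s \<bar>x\<bar> powr p)) / (1 - exp (- x\<^sup>2 / 2))\<close> is a bounded
  continuous test function (its value at \<open>0\<close> is \<open>0 / 0 = 0\<close>, which is the right one).
\<close>

lemma stable_small_time_limit:
  fixes N :: "nat \<Rightarrow> real measure" and h :: "nat \<Rightarrow> real" and \<alpha> \<kappa> p s :: real
  assumes \<alpha>: "0 < \<alpha>" "\<alpha> < 2" and \<kappa>: "0 < \<kappa>" and p: "2 < p" and s: "0 < s"
    and N: "\<And>n. real_distribution (N n)"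
    and char: "\<And>n u. char (N n) u = complex_of_real (exp (- (\<kappa> * h n * \<bar>u\<bar> powr \<alpha>)))"
    and h: "\<And>n. 0 < h n" "h \<longlonglongrightarrow> 0"
  shows "(\<lambda>n. (1 - (LINT x|N n. exp (- (s * \<bar>x\<bar> powr p)))) / h n) \<longlonglongrightarrow>
    2 * \<kappa> * Gamma \<alpha> * sin (pi * \<alpha> / 2) / pi * Gamma (1 - \<alpha> / p) * s powr (\<alpha> / p)"
proof -
  interpret S: real_distribution std_normal_distribution by (rule real_dist_normal_dist)
  interpret N: real_distribution "N n" for n by (rule N)
  define \<nu> where "\<nu> = levy_density \<alpha> \<kappa>"
  have [measurable]: "\<nu> \<in> borel_measurable borel"
    unfolding \<nu>_def by (rule levy_density_measurable[OF \<alpha> \<kappa>])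
  have \<nu>_nonneg: "0 \<le> \<nu> x" for x unfolding \<nu>_def by (rule levy_density_nonneg[OF \<alpha> \<kappa>])
  define g where "g x = 1 - exp (- x\<^sup>2 / 2)" for x :: real
  have [measurable]: "g \<in> borel_measurable borel" unfolding g_def by measurable
  have g: "0 \<le> g x" "g x \<le> 1" for x by (auto simp: g_def)
  define G where "G n u = (LINT v|std_normal_distribution. exp (- (\<kappa> * h n * \<bar>u\<bar> powr \<alpha>)) - exp (- (\<kappa> * h n * \<bar>u + v\<bar> powr \<alpha>)))" for n u
  define \<Gamma> where "\<Gamma> u = (LINT v|std_normal_distribution. \<kappa> * \<bar>u + v\<bar> powr \<alpha> - \<kappa> * \<bar>u\<bar> powr \<alpha>)" for u
  have ig: "integrable (N n) g" for n
    by (rule N.integrable_const_bound[where B=1]) (use g in auto)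
  have charG: "(CLINT x|N n. iexp (u * x) * complex_of_real (g x)) = complex_of_real (G n u)" for n u
    using char_minus_char_shift[OF N[of n], of u]
    by (simp add: char G_def g_def flip: of_real_diff)
  define m where "m n = (LINT x|N n. g x)" for n
  have mG: "m n = G n 0" for n
  proof -
    have "complex_of_real (m n) = (CLINT x|N n. iexp (0 * x) * complex_of_real (g x))"
      by (simp add: m_def)
    then show ?thesis unfolding charG by (simp only: of_real_eq_iff)
  qed
  have ie: "integrable std_normal_distribution (\<lambda>v. exp (- (\<kappa> * h n * \<bar>u + v\<bar> powr \<alpha>)))" for n u
    by (rule S.integrable_const_bound[where B=1]) (use \<kappa> h in \<open>auto simp: less_imp_le\<close>)
  \<comment> \<open>\<open>m n\<close> is the mass by which the weighted measure is normalised. In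
    its Gaussian form \<open>G n 0\<close> the integrand is positive off
    \<open>v = 0\<close>.\<close>
  have m_pos: "0 < m n" for n
  proof -
    have "(LINT v|std_normal_distribution. 0) < G n 0"
      unfolding G_def
    proof (rule S.integral_less_AE_space)
      show "AE v in std_normal_distribution. 0 < exp (- (\<kappa> * h n * \<bar>0\<bar> powr \<alpha>)) - exp (- (\<kappa> * h n * \<bar>0 + v\<bar> powr \<alpha>))"
        using AE_std_normal_nonzero by eventually_elim (use \<kappa> h in auto)
    qed (use ie[of n 0] in \<open>auto simp: S.emeasure_space_1[simplified]\<close>)
    then show ?thesis by (simp add: mG)
  qed
  have i\<Gamma>: "integrable std_normal_distribution (\<lambda>v. \<kappa> * \<bar>u + v\<bar> powr \<alpha>)" for u
    using integrable_std_normal_abs_powr[OF \<alpha>] by simp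
  have \<Gamma>_pos: "0 < \<Gamma> 0"
  proof -
    have "(LINT v|std_normal_distribution. 0) < \<Gamma> 0"
      unfolding \<Gamma>_def
    proof (rule S.integral_less_AE_space)
      show "AE v in std_normal_distribution. 0 < \<kappa> * \<bar>0 + v\<bar> powr \<alpha> - \<kappa> * \<bar>0\<bar> powr \<alpha>"
        using AE_std_normal_nonzero by eventually_elim (use \<kappa> in auto)
    qed (use i\<Gamma>[of 0] in \<open>auto simp: S.emeasure_space_1[simplified]\<close>)
    then show ?thesis by simp
  qed
  \<comment> \<open>Dominated convergence: \<open>(1 - exp (- (\<kappa> h a))) / h\<close> tends to
    \<open>\<kappa> a\<close> and is at most \<open>\<kappa> a\<close> for \<open>a \<ge> 0\<close>,
    which is integrable for \<open>a = |u + v|^\<alpha>\<close>.\<close>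
  have lim: "(\<lambda>n. G n u / h n) \<longlonglongrightarrow> \<Gamma> u" for u
  proof -
    define J where "J n a = (1 - exp (- (\<kappa> * h n * a))) / h n" for n a
    have J_lim: "(\<lambda>n. J n a) \<longlonglongrightarrow> \<kappa> * a" for a
    proof -
      have "((\<lambda>t. (1 - exp (- (\<kappa> * t * a))) / t) \<longlongrightarrow> \<kappa> * a) (at_right 0)"
        by real_asymp
      moreover have "filterlim h (at_right 0) sequentially"
      proof -
        have "h n \<in> {0<..} \<and> h n \<noteq> 0" for n using h(1)[of n] by simp
        then show ?thesis using h(2) by (simp add: filterlim_at)
      qed
      ultimately show ?thesis unfolding J_def by (rule filterlim_compose)
    qed
    have J_bound: "\<bar>J n a\<bar> \<le> \<kappa> * a" if "a \<ge> 0" for n a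
    proof -
      have "1 - exp (- (\<kappa> * h n * a)) \<le> \<kappa> * h n * a"
        using exp_ge_add_one_self[of "- (\<kappa> * h n * a)"] by simp
      moreover have "0 \<le> 1 - exp (- (\<kappa> * h n * a))" using that \<kappa> h(1)[of n] by simp
      ultimately show ?thesis using h(1)[of n] by (simp add: J_def divide_simps mult_ac)
    qed
    have "G n u / h n = (LINT v|std_normal_distribution. J n (\<bar>u + v\<bar> powr \<alpha>) - J n (\<bar>u\<bar> powr \<alpha>))" for n
      unfolding G_def J_def by (subst Bochner_Integration.integral_divide_zero[symmetric])
        (intro Bochner_Integration.integral_cong refl, simp add: diff_divide_distrib[symmetric])
    moreover have "(\<lambda>n. LINT v|std_normal_distribution. J n (\<bar>u + v\<bar> powr \<alpha>) - J n (\<bar>u\<bar> powr \<alpha>)) \<longlonglongrightarrow> \<Gamma> u"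
      unfolding \<Gamma>_def
    proof (rule integral_dominated_convergence[where w="\<lambda>v. \<kappa> * \<bar>u + v\<bar> powr \<alpha> + \<kappa> * \<bar>u\<bar> powr \<alpha>"])
      show "integrable std_normal_distribution (\<lambda>v. \<kappa> * \<bar>u + v\<bar> powr \<alpha> + \<kappa> * \<bar>u\<bar> powr \<alpha>)"
        using i\<Gamma>[of u] by simp
      show "AE v in std_normal_distribution. (\<lambda>n. J n (\<bar>u + v\<bar> powr \<alpha>) - J n (\<bar>u\<bar> powr \<alpha>)) \<longlonglongrightarrow> \<kappa> * \<bar>u + v\<bar> powr \<alpha> - \<kappa> * \<bar>u\<bar> powr \<alpha>"
        by (intro AE_I2 tendsto_diff J_lim)
      show "AE v in std_normal_distribution. norm (J n (\<bar>u + v\<bar> powr \<alpha>) - J n (\<bar>u\<bar> powr \<alpha>)) \<le> \<kappa> * \<bar>u + v\<bar> powr \<alpha> + \<kappa> * \<bar>u\<bar> powr \<alpha>" for n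
      proof (rule AE_I2)
        fix v
        show "norm (J n (\<bar>u + v\<bar> powr \<alpha>) - J n (\<bar>u\<bar> powr \<alpha>)) \<le> \<kappa> * \<bar>u + v\<bar> powr \<alpha> + \<kappa> * \<bar>u\<bar> powr \<alpha>"
          unfolding real_norm_def
          by (rule order_trans[OF abs_triangle_ineq4 add_mono[OF J_bound J_bound]]) auto
      qed
    qed (auto simp: J_def)
    ultimately show ?thesis by simp
  qed
  define R where "R n = density (N n) (\<lambda>x. ennreal (g x / m n))" for n
  have R: "real_distribution (R n)" for n
  proof -
    have "(\<integral>\<^sup>+x. ennreal (g x / m n) \<partial>N n) = ennreal (LINT x|N n. g x / m n)"
      using ig[of n] g m_pos[of n] by (intro nn_integral_eq_integral) (auto simp: less_imp_le)
    also have "\<dots> = 1" using m_pos[of n] by (simp add: m_def)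
    finally have "prob_space (R n)"
      by (intro prob_spaceI) (simp add: R_def emeasure_density)
    then show ?thesis
      unfolding real_distribution_def real_distribution_axioms_def by (simp add: R_def)
  qed
  have gauss: "integrable lborel (\<lambda>x. g x * \<nu> x)"
    "(LBINT x. cos (u * x) * (g x * \<nu> x)) = \<Gamma> u" for u
    using integral_levy_gauss[OF \<alpha> \<kappa>] unfolding g_def \<nu>_def \<Gamma>_def by auto
  define R' where "R' = density lborel (\<lambda>x. ennreal (g x * \<nu> x / \<Gamma> 0))"
  have R': "real_distribution R'"
  proof -
    have "(\<integral>\<^sup>+x. ennreal (g x * \<nu> x / \<Gamma> 0) \<partial>lborel) = ennreal (LBINT x. g x * \<nu> x / \<Gamma> 0)"
      using gauss(1) g \<Gamma>_pos \<nu>_nonneg by (intro nn_integral_eq_integral) (auto simp: less_imp_le)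
    also have "(LBINT x. g x * \<nu> x / \<Gamma> 0) = (LBINT x. cos (0 * x) * (g x * \<nu> x)) / \<Gamma> 0" by simp
    also have "\<dots> = 1" using \<Gamma>_pos unfolding gauss(2) by simp
    finally have "prob_space R'"
      by (intro prob_spaceI) (simp add: R'_def emeasure_density)
    then show ?thesis
      unfolding real_distribution_def real_distribution_axioms_def by (simp add: R'_def)
  qed
  have char_R: "char (R n) u = complex_of_real (G n u / m n)" for n u
  proof -
    have "char (R n) u = (CLINT x|N n. (g x / m n) *\<^sub>R iexp (u * x))"
      unfolding char_def R_def using g m_pos[of n] by (intro integral_density) (auto simp: less_imp_le)
    also have "\<dots> = (CLINT x|N n. complex_of_real (1 / m n) * (iexp (u * x) * complex_of_real (g x)))"
      by (intro Bochner_Integration.integral_cong refl) (simp add: scaleR_conv_of_real mult_ac)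
    also have "\<dots> = complex_of_real (1 / m n) * complex_of_real (G n u)"
      unfolding charG[symmetric] by (rule integral_mult_right_zero)
    finally show ?thesis by simp
  qed
  have char_R': "char R' u = complex_of_real (\<Gamma> u / \<Gamma> 0)" for u
  proof -
    have "char R' u = (CLBINT x. (g x * \<nu> x / \<Gamma> 0) *\<^sub>R iexp (u * x))"
      unfolding char_def R'_def using g \<Gamma>_pos \<nu>_nonneg by (intro integral_density) (auto simp: less_imp_le)
    also have "\<dots> = complex_of_real (LBINT x. cos (u * x) * (g x * \<nu> x / \<Gamma> 0))"
      using gauss(1) by (intro integral_iexp_even) (auto simp: g_def \<nu>_def levy_density_def[OF \<alpha> \<kappa>])
    also have "(LBINT x. cos (u * x) * (g x * \<nu> x / \<Gamma> 0)) = (LBINT x. cos (u * x) * (g x * \<nu> x)) / \<Gamma> 0"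
      by (subst Bochner_Integration.integral_divide_zero[symmetric]) simp
    finally show ?thesis unfolding gauss(2) .
  qed
  have "weak_conv_m R R'"
  proof (rule levy_continuity[OF R R'])
    fix u
    \<comment> \<open>The factor \<open>h n\<close> cancels in the normalised characteristic
      functions, so the limit is a ratio of two limits of the same kind.\<close>
    have "(\<lambda>n. (G n u / h n) / (G n 0 / h n)) \<longlonglongrightarrow> \<Gamma> u / \<Gamma> 0"
      using \<Gamma>_pos by (intro tendsto_divide lim) simp
    moreover have "(G n u / h n) / (G n 0 / h n) = G n u / m n" for n
      using h(1)[of n] by (simp add: mG)
    ultimately show "(\<lambda>n. char (R n) u) \<longlonglongrightarrow> char R' u"
      unfolding char_R char_R' by (intro tendsto_of_real) simp
  qed
  define k where "k x = (1 - exp (- (s * \<bar>x\<bar> powr p))) / (1 - exp (- x\<^sup>2 / 2))" for x :: real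
  have k_meas[measurable]: "k \<in> borel_measurable borel" unfolding k_def by measurable
  have gk: "g x * k x = 1 - exp (- (s * \<bar>x\<bar> powr p))" for x
    by (cases "x = 0") (auto simp: g_def k_def)
  have "(\<lambda>n. LINT x|R n. k x) \<longlonglongrightarrow> (LINT x|R'. k x)"
    using weak_conv_imp_integral_bdd_continuous_conv[OF R R' \<open>weak_conv_m R R'\<close>, of k "max (2 * s * exp (1 / 2)) (1 / (1 - exp (- 1 / 2)))"]
      stable_test_function[OF p s] unfolding k_def by simp
  \<comment> \<open>Multiplying by the masses \<open>G n 0 / h n\<close> and their limit
    \<open>\<Gamma> 0\<close> undoes the normalisation.\<close>
  then have "(\<lambda>n. (G n 0 / h n) * (LINT x|R n. k x)) \<longlonglongrightarrow> \<Gamma> 0 * (LINT x|R'. k x)"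
    by (intro tendsto_mult lim)
  moreover have "(G n 0 / h n) * (LINT x|R n. k x) = (1 - (LINT x|N n. exp (- (s * \<bar>x\<bar> powr p)))) / h n" for n
  proof -
    have int: "integrable (N n) (\<lambda>x. exp (- (s * \<bar>x\<bar> powr p)))"
      by (rule N.integrable_const_bound[where B=1]) (use s in auto)
    have "(LINT x|R n. k x) = (LINT x|N n. (g x / m n) *\<^sub>R k x)"
      unfolding R_def using g m_pos[of n] by (intro integral_density) (auto simp: less_imp_le)
    also have "\<dots> = (LINT x|N n. 1 - exp (- (s * \<bar>x\<bar> powr p))) / m n"
      by (subst Bochner_Integration.integral_divide_zero[symmetric]) (simp add: gk[symmetric])
    also have "(LINT x|N n. 1 - exp (- (s * \<bar>x\<bar> powr p))) = 1 - (LINT x|N n. exp (- (s * \<bar>x\<bar> powr p)))"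
      using int by (simp add: N.prob_space[simplified])
    finally show ?thesis using m_pos[of n] by (simp add: mG)
  qed
  moreover have "\<Gamma> 0 * (LINT x|R'. k x) = (LBINT x. (1 - exp (- (s * \<bar>x\<bar> powr p))) * \<nu> x)"
  proof -
    have "(LINT x|R'. k x) = (LBINT x. (g x * \<nu> x / \<Gamma> 0) *\<^sub>R k x)"
      unfolding R'_def using g \<Gamma>_pos \<nu>_nonneg by (intro integral_density) (auto simp: less_imp_le)
    also have "\<dots> = (LBINT x. (1 - exp (- (s * \<bar>x\<bar> powr p))) * \<nu> x) / \<Gamma> 0"
      by (subst Bochner_Integration.integral_divide_zero[symmetric]) (simp add: gk[symmetric] mult_ac)
    finally show ?thesis using \<Gamma>_pos by simp
  qed
  moreover have "(LBINT x. (1 - exp (- (s * \<bar>x\<bar> powr p))) * \<nu> x) =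
    2 * \<kappa> * Gamma \<alpha> * sin (pi * \<alpha> / 2) / pi * Gamma (1 - \<alpha> / p) * s powr (\<alpha> / p)"
    unfolding \<nu>_def using integral_exp_powr_levy[OF \<alpha> \<kappa> _ s] \<alpha> p by simp
  ultimately show ?thesis by (simp only:)
qed

section \<open>The lower bound\<close>

lemma variation_sum_leD:
  assumes "strong_variation p f \<le> ennreal \<epsilon>" "0 \<le> \<epsilon>" "0 < p"
    and t: "strict_mono_on {..k::nat} t" "t ` {..k} \<subseteq> {0..1}"
  shows "(\<Sum>j=1..k. \<bar>f (t j) - f (t (j - 1))\<bar> powr p) \<le> \<epsilon> powr p"
proof -
  have fin: "variation_sum p f \<noteq> \<top>"
    using assms(1) by (auto simp: strong_variation_def top_unique)
  define V where "V = enn2real (variation_sum p f)"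
  have V: "variation_sum p f = ennreal V" "0 \<le> V"
    using fin by (simp_all add: V_def less_top)
  have "ennreal (V powr (1 / p)) \<le> ennreal \<epsilon>"
    using assms(1) fin by (simp add: strong_variation_def V_def)
  then have "V powr (1 / p) \<le> \<epsilon>" using assms by (simp add: ennreal_le_iff)
  then have "(V powr (1 / p)) powr p \<le> \<epsilon> powr p" using assms by (intro powr_mono2) auto
  then have "V \<le> \<epsilon> powr p" using assms V by (simp add: powr_powr)
  moreover have "ennreal (\<Sum>j=1..k. \<bar>f (t j) - f (t (j - 1))\<bar> powr p) \<le> variation_sum p f"
    unfolding variation_sum_def by (rule SUP_upper2[of "(k, t)"]) (use t in simp_all)
  then have "(\<Sum>j=1..k. \<bar>f (t j) - f (t (j - 1))\<bar> powr p) \<le> V"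
    using V by (simp add: ennreal_le_iff)
  ultimately show ?thesis by simp
qed

lemma strong_variation_leI:
  assumes "0 \<le> \<epsilon>" "0 < p"
    and sums: "\<And>k t. strict_mono_on {..k::nat} t \<Longrightarrow> t ` {..k} \<subseteq> {0..1} \<Longrightarrow>
      (\<Sum>j=1..k. \<bar>f (t j) - f (t (j - 1))\<bar> powr p) \<le> \<epsilon> powr p"
  shows "strong_variation p f \<le> ennreal \<epsilon>"
proof -
  have le: "variation_sum p f \<le> ennreal (\<epsilon> powr p)"
    unfolding variation_sum_def by (intro SUP_least) (auto intro!: ennreal_leI sums simp del: One_nat_def)
  then have fin: "variation_sum p f \<noteq> \<top>" by (auto simp: top_unique)
  have "enn2real (variation_sum p f) \<le> \<epsilon> powr p"
    using enn2real_mono[OF le] by simp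
  then have "enn2real (variation_sum p f) powr (1 / p) \<le> (\<epsilon> powr p) powr (1 / p)"
    using assms by (intro powr_mono2) auto
  also have "\<dots> = \<epsilon>" using assms by (simp add: powr_powr)
  finally show ?thesis using fin by (simp add: strong_variation_def ennreal_leI)
qed

context levy_process
begin

definition law :: "real \<Rightarrow> real measure" where
  "law h = distr M borel (X h)"

lemma real_distribution_law: "0 \<le> h \<Longrightarrow> real_distribution (law h)"
  unfolding law_def by (intro real_distribution_distr random_variable)

definition increment :: "nat \<Rightarrow> nat \<Rightarrow> 'a \<Rightarrow> real" where
  "increment n i \<omega> = X (real (Suc i) / real n) \<omega> - X (real i / real n) \<omega>"

lemma increment_measurable[measurable]: "increment n i \<in> borel_measurable M"
  unfolding increment_def by (intro borel_measurable_diff random_variable) auto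

lemma distr_increments:
  assumes "0 < n"
  shows "distr M (PiM {..<n} (\<lambda>_. borel)) (\<lambda>\<omega>. \<lambda>i\<in>{..<n}. increment n i \<omega>) = PiM {..<n} (\<lambda>_. law (1 / real n))"
proof -
  have "indep_vars (\<lambda>_. borel) (increment n) {..<n}"
    using independent_increments[unfolded independent_increments_def, rule_format, of "\<lambda>i. real i / real n" n]
    by (simp add: increment_def[abs_def] divide_right_mono)
  then have "distr M (PiM {..<n} (\<lambda>_. borel)) (\<lambda>\<omega>. \<lambda>i\<in>{..<n}. increment n i \<omega>) =
     PiM {..<n} (\<lambda>i. distr M borel (increment n i))"
    using assms by (subst (asm) indep_vars_iff_distr_eq_PiM) auto
  also have "\<dots> = PiM {..<n} (\<lambda>_. law (1 / real n))"
  proof (intro PiM_cong refl)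
    fix i
    have "real (Suc i) / real n = real i / real n + 1 / real n" by (simp add: add_divide_distrib)
    then show "distr M borel (increment n i) = law (1 / real n)"
      unfolding increment_def[abs_def] law_def
      using stationary_increments[of "real i / real n" "1 / real n"] by simp
  qed
  finally show ?thesis .
qed

lemma integral_increments:
  fixes f :: "real \<Rightarrow> real"
  assumes "0 < n" and [measurable]: "f \<in> borel_measurable borel" and "\<And>x. 0 \<le> f x" "0 \<le> s"
  shows "expectation (\<lambda>\<omega>. exp (- (s * (\<Sum>i<n. f (increment n i \<omega>))))) = (LINT x|law (1 / real n). exp (- (s * f x))) ^ n"
proof -
  interpret L: real_distribution "law (1 / real n)" by (rule real_distribution_law) simp
  have [measurable_cong]: "sets (law (1 / real n)) = sets borel" by simp
  have "expectation (\<lambda>\<omega>. exp (- (s * (\<Sum>i<n. f (increment n i \<omega>))))) =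
     (LINT x|distr M (PiM {..<n} (\<lambda>_. borel)) (\<lambda>\<omega>. \<lambda>i\<in>{..<n}. increment n i \<omega>). exp (- (s * (\<Sum>i<n. f (x i)))))"
    by (subst integral_distr) auto
  also have "\<dots> = (LINT x|law (1 / real n). exp (- (s * f x))) ^ n"
    unfolding distr_increments[OF assms(1)]
    by (rule integral_PiM_exp_sum[OF L.prob_space_axioms _ assms(3,4)]) simp
  finally show ?thesis .
qed

text \<open>Chernoff's inequality for the sum over the grid \<open>i / n\<close>, which is one of
  the sums in the supremum; the power comes from independence and stationarity of the
  increments.\<close>

lemma prob_strong_variation_le_power:
  assumes "0 < n" "0 \<le> \<epsilon>" "0 < p" "0 < s"
  shows "measure M {\<omega> \<in> space M. strong_variation p (\<lambda>t. X t \<omega>) \<le> ennreal \<epsilon>} \<le>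
    exp (s * \<epsilon> powr p) * (LINT x|law (1 / real n). exp (- (s * \<bar>x\<bar> powr p))) ^ n"
proof -
  define Y where "Y \<omega> = (\<Sum>i<n. \<bar>increment n i \<omega>\<bar> powr p)" for \<omega>
  have [measurable]: "Y \<in> borel_measurable M" unfolding Y_def by measurable
  have Y_nonneg: "0 \<le> Y \<omega>" for \<omega> unfolding Y_def by (intro sum_nonneg) auto
  have Y_le: "Y \<omega> \<le> \<epsilon> powr p" if "strong_variation p (\<lambda>t. X t \<omega>) \<le> ennreal \<epsilon>" for \<omega>
  proof -
    have "(\<Sum>j=1..n. \<bar>X (real j / real n) \<omega> - X (real (j - 1) / real n) \<omega>\<bar> powr p) \<le> \<epsilon> powr p"
      using that assms by (intro variation_sum_leD[where f="\<lambda>t. X t \<omega>"]) (auto simp: strict_mono_on_def divide_strict_right_mono)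
    also have "(\<Sum>j=1..n. \<bar>X (real j / real n) \<omega> - X (real (j - 1) / real n) \<omega>\<bar> powr p) = Y \<omega>"
      unfolding Y_def increment_def
      by (intro sum.reindex_bij_witness[of _ Suc "\<lambda>j. j - 1"]) auto
    finally show ?thesis .
  qed
  \<comment> \<open>Monotonicity needs only the larger event to be measurable; a nonmeasurable
    smaller set has \<open>measure\<close> 0.\<close>
  have "measure M {\<omega> \<in> space M. strong_variation p (\<lambda>t. X t \<omega>) \<le> ennreal \<epsilon>} \<le> prob {\<omega> \<in> space M. Y \<omega> \<le> \<epsilon> powr p}"
    by (intro finite_measure_mono) (auto intro: Y_le)
  also have "\<dots> = expectation (indicator {\<omega> \<in> space M. Y \<omega> \<le> \<epsilon> powr p})" by simp
  also have "\<dots> \<le> expectation (\<lambda>\<omega>. exp (s * \<epsilon> powr p) * exp (- (s * Y \<omega>)))"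
  proof (rule integral_mono)
    show "integrable M (indicator {\<omega> \<in> space M. Y \<omega> \<le> \<epsilon> powr p} :: _ \<Rightarrow> real)"
      by (intro integrable_real_indicator) (auto simp: less_top[symmetric])
    show "integrable M (\<lambda>\<omega>. exp (s * \<epsilon> powr p) * exp (- (s * Y \<omega>)))"
      by (intro integrable_mult_right integrable_const_bound[where B=1]) (use Y_nonneg assms in auto)
    fix \<omega> assume "\<omega> \<in> space M"
    show "indicator {\<omega> \<in> space M. Y \<omega> \<le> \<epsilon> powr p} \<omega> \<le> exp (s * \<epsilon> powr p) * exp (- (s * Y \<omega>))"
      using assms by (auto simp: indicator_def exp_add[symmetric] right_diff_distrib[symmetric])
  qed
  also have "\<dots> = exp (s * \<epsilon> powr p) * (LINT x|law (1 / real n). exp (- (s * \<bar>x\<bar> powr p))) ^ n"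
    unfolding Y_def using integral_increments[OF assms(1), of "\<lambda>x. \<bar>x\<bar> powr p" s] assms by simp
  finally show ?thesis .
qed

text \<open>The left side of the preceding bound does not depend on \<open>n\<close>, so
  \<open>n\<close> may tend to infinity: the small-time limit with \<open>h = 1 / n\<close> shows
  that the n-th power converges to the exponential of minus the jump exponent.\<close>

lemma prob_strong_variation_le_exp:
  fixes \<alpha> \<kappa> p s \<epsilon> :: real
  assumes \<alpha>: "0 < \<alpha>" "\<alpha> < 2" and p: "2 < p" and \<kappa>: "0 < \<kappa>"
    and char: "\<And>t u. t \<ge> 0 \<Longrightarrow> (CLINT \<omega>|M. iexp (u * X t \<omega>)) = complex_of_real (exp (- (\<kappa> * t * \<bar>u\<bar> powr \<alpha>)))"
    and s: "0 < s" and \<epsilon>: "0 \<le> \<epsilon>"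
  shows "measure M {\<omega> \<in> space M. strong_variation p (\<lambda>t. X t \<omega>) \<le> ennreal \<epsilon>} \<le>
    exp (s * \<epsilon> powr p - 2 * \<kappa> * Gamma \<alpha> * sin (pi * \<alpha> / 2) / pi * Gamma (1 - \<alpha> / p) * s powr (\<alpha> / p))"
proof -
  define B where "B = 2 * \<kappa> * Gamma \<alpha> * sin (pi * \<alpha> / 2) / pi * Gamma (1 - \<alpha> / p) * s powr (\<alpha> / p)"
  define w where "w n = 1 - (LINT x|law (1 / real n). exp (- (s * \<bar>x\<bar> powr p)))" for n
  have w: "0 \<le> w n" for n
  proof -
    interpret L: real_distribution "law (1 / real n)" by (rule real_distribution_law) simp
    have "(LINT x|law (1 / real n). exp (- (s * \<bar>x\<bar> powr p))) \<le> 1"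
      by (intro L.integral_le_const L.integrable_const_bound[where B=1]) (use s in auto)
    then show ?thesis by (simp add: w_def)
  qed
  \<comment> \<open>\<open>Suc n\<close> because the small-time limit wants a positive time step at
    every index.\<close>
  have "(\<lambda>n. (1 - (LINT x|law (1 / real (Suc n)). exp (- (s * \<bar>x\<bar> powr p)))) / (1 / real (Suc n))) \<longlonglongrightarrow> B"
    unfolding B_def
  proof (rule stable_small_time_limit[OF \<alpha> \<kappa> p s])
    show "real_distribution (law (1 / real (Suc n)))" for n by (rule real_distribution_law) simp
    show "Characteristic_Functions.char (law (1 / real (Suc n))) u = complex_of_real (exp (- (\<kappa> * (1 / real (Suc n)) * \<bar>u\<bar> powr \<alpha>)))" for n u
      using random_variable[of "1 / real (Suc n)"] char[of "1 / real (Suc n)" u]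
      unfolding char_def law_def by (subst integral_distr) auto
    show "(\<lambda>n. 1 / real (Suc n)) \<longlonglongrightarrow> 0" by (rule lim_1_over_n[THEN LIMSEQ_Suc])
  qed simp
  then have "(\<lambda>n. real (Suc n) * w (Suc n)) \<longlonglongrightarrow> B"
    by (simp add: w_def mult.commute)
  then have "(\<lambda>n. real n * w n) \<longlonglongrightarrow> B" by (rule LIMSEQ_imp_Suc)
  then have "(\<lambda>n. (1 - w n) ^ n) \<longlonglongrightarrow> exp (- B)"
    using w by (rule tendsto_one_minus_power_exp)
  then have "(\<lambda>n. exp (s * \<epsilon> powr p) * (1 - w n) ^ n) \<longlonglongrightarrow> exp (s * \<epsilon> powr p) * exp (- B)"
    by (intro tendsto_intros)
  then have "measure M {\<omega> \<in> space M. strong_variation p (\<lambda>t. X t \<omega>) \<le> ennreal \<epsilon>} \<le> exp (s * \<epsilon> powr p) * exp (- B)"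
  proof (rule LIMSEQ_le_const)
    show "\<exists>N. \<forall>n\<ge>N. measure M {\<omega> \<in> space M. strong_variation p (\<lambda>t. X t \<omega>) \<le> ennreal \<epsilon>} \<le> exp (s * \<epsilon> powr p) * (1 - w n) ^ n"
      using prob_strong_variation_le_power[of _ \<epsilon> p s] s p \<epsilon> by (intro exI[of _ 1]) (auto simp: w_def)
  qed
  then show ?thesis by (simp add: B_def exp_add[symmetric])
qed

text \<open>The exponent of the preceding lemma at its minimising \<open>s\<close>. With
  \<open>c\<close> as in the proof, the exponent is
  \<open>s \<epsilon>^p - (p / \<alpha>) c s^(\<alpha> / p)\<close>; at the minimum its two terms
  are \<open>y\<close> and \<open>(p / \<alpha>) y\<close>, which explains the factor
  \<open>(p - \<alpha>) / \<alpha>\<close>.\<close>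

lemma prob_strong_variation_upper:
  fixes \<alpha> \<kappa> p \<epsilon> :: real
  assumes \<alpha>: "0 < \<alpha>" "\<alpha> < 2" and p: "2 < p" and \<kappa>: "0 < \<kappa>"
    and char: "\<And>t u. t \<ge> 0 \<Longrightarrow> (CLINT \<omega>|M. iexp (u * X t \<omega>)) = complex_of_real (exp (- (\<kappa> * t * \<bar>u\<bar> powr \<alpha>)))"
    and \<epsilon>: "0 < \<epsilon>"
  shows "measure M {\<omega> \<in> space M. strong_variation p (\<lambda>t. X t \<omega>) \<le> ennreal \<epsilon>} \<le>
    exp (- ((p - \<alpha>) / \<alpha> *
           (2 * \<alpha> * Gamma \<alpha> * sin (pi * \<alpha> / 2) / (p * pi) * Gamma (1 - \<alpha> / p)) powr (p / (p - \<alpha>)) *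
           \<kappa> powr (p / (p - \<alpha>)) * \<epsilon> powr (- (p * \<alpha> / (p - \<alpha>)))))"
proof -
  define A where "A = 2 * \<alpha> * Gamma \<alpha> * sin (pi * \<alpha> / 2) / (p * pi) * Gamma (1 - \<alpha> / p)"
  define c where "c = A * \<kappa>"
  define e where "e = p / (p - \<alpha>)"
  \<comment> \<open>The stationary point:
    \<open>\<epsilon>^p = c s^(\<alpha> / p - 1)\<close>.\<close>
  define s where "s = c powr e * \<epsilon> powr (- (p * e))"
  have "sin (pi * \<alpha> / 2) > 0" using \<alpha> by (intro sin_gt_zero) (auto simp: field_simps)
  moreover have "Gamma \<alpha> > 0" "Gamma (1 - \<alpha> / p) > 0" using \<alpha> p by (auto intro!: Gamma_real_pos)
  ultimately have A: "A > 0" using \<alpha> p by (simp add: A_def)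
  then have c: "c > 0" using \<kappa> by (simp add: c_def)
  have s: "s > 0" using c \<epsilon> by (simp add: s_def)
  have e1: "p + - (p * e) = - (p * \<alpha> / (p - \<alpha>))" and e2: "- (p * e) * (\<alpha> / p) = - (p * \<alpha> / (p - \<alpha>))"
    and e3: "1 + e * (\<alpha> / p) = e"
    using \<alpha> p by (simp_all add: e_def divide_simps) (simp_all add: algebra_simps)
  define y where "y = c powr e * \<epsilon> powr (- (p * \<alpha> / (p - \<alpha>)))"
  have s1: "s * \<epsilon> powr p = y"
    unfolding y_def s_def e1[symmetric] powr_add by simp
  have s2: "2 * \<kappa> * Gamma \<alpha> * sin (pi * \<alpha> / 2) / pi * Gamma (1 - \<alpha> / p) * s powr (\<alpha> / p)
     = p / \<alpha> * y"
  proof -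
    have "s powr (\<alpha> / p) = c powr (e * (\<alpha> / p)) * \<epsilon> powr (- (p * e) * (\<alpha> / p))"
      unfolding s_def using c \<epsilon> by (simp add: powr_mult powr_powr)
    then have "c * s powr (\<alpha> / p) = c powr (1 + e * (\<alpha> / p)) * \<epsilon> powr (- (p * \<alpha> / (p - \<alpha>)))"
      unfolding e2 using c by (simp add: powr_add)
    then have "c * s powr (\<alpha> / p) = c powr e * \<epsilon> powr (- (p * \<alpha> / (p - \<alpha>)))"
      unfolding e3 .
    moreover have "2 * \<kappa> * Gamma \<alpha> * sin (pi * \<alpha> / 2) / pi * Gamma (1 - \<alpha> / p) = p / \<alpha> * c"
      using \<alpha> p by (simp add: c_def A_def)
    ultimately show ?thesis by (simp add: y_def)
  qed
  have eq: "s * \<epsilon> powr p - 2 * \<kappa> * Gamma \<alpha> * sin (pi * \<alpha> / 2) / pi * Gamma (1 - \<alpha> / p) * s powr (\<alpha> / p)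
    = - ((p - \<alpha>) / \<alpha> * y)"
    unfolding s1 s2 using \<alpha> by (simp add: field_simps)
  have "(p - \<alpha>) / \<alpha> * A powr e * \<kappa> powr e * \<epsilon> powr (- (p * \<alpha> / (p - \<alpha>))) = (p - \<alpha>) / \<alpha> * y"
    using A \<kappa> by (simp add: c_def powr_mult y_def mult.assoc)
  moreover have "measure M {\<omega> \<in> space M. strong_variation p (\<lambda>t. X t \<omega>) \<le> ennreal \<epsilon>} \<le> exp (- ((p - \<alpha>) / \<alpha> * y))"
    using prob_strong_variation_le_exp[OF \<alpha> p \<kappa> char s, of \<epsilon>] \<epsilon> unfolding eq by simp
  ultimately show ?thesis
    unfolding A_def[symmetric] e_def[symmetric] by (simp only:)
qed

end

section \<open>Gaussian mixtures and subordination\<close>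

lemma distr_PiM_maps:
  assumes "finite I" "\<And>i. i \<in> I \<Longrightarrow> prob_space (M i)" "\<And>i. i \<in> I \<Longrightarrow> f i \<in> measurable (M i) (M' i)"
  shows "distr (PiM I M) (PiM I M') (\<lambda>x. \<lambda>i\<in>I. f i (x i)) = PiM I (\<lambda>i. distr (M i) (M' i) (f i))"
proof -
  \<comment> \<open>The product locale asks for a probability measure at every index, while the
    hypotheses cover \<open>I\<close> only; outside \<open>I\<close> the families are padded with
    point masses.\<close>
  define N where "N i = (if i \<in> I then distr (M i) (M' i) (f i) else return (count_space UNIV) undefined)" for i
  have N: "prob_space (N i)" for i
    using assms by (auto simp: N_def intro!: prob_space.prob_space_distr prob_space_return)
  interpret N: product_prob_space N I
    unfolding product_prob_space_def product_sigma_finite_def product_prob_space_axioms_def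
    using N by (auto intro: prob_space_imp_sigma_finite)
  define N' where "N' i = (if i \<in> I then M i else return (count_space UNIV) undefined)" for i
  have N': "prob_space (N' i)" for i
    using assms by (auto simp: N'_def intro!: prob_space_return)
  interpret N': product_prob_space N' I
    unfolding product_prob_space_def product_sigma_finite_def product_prob_space_axioms_def
    using N' by (auto intro: prob_space_imp_sigma_finite)
  have PN: "PiM I (\<lambda>i. distr (M i) (M' i) (f i)) = PiM I N" and PM: "PiM I M = PiM I N'"
    by (auto intro!: PiM_cong simp: N_def N'_def)
  have [measurable]: "(\<lambda>x. \<lambda>i\<in>I. f i (x i)) \<in> measurable (PiM I M) (PiM I M')"
    using assms(3) by (intro measurable_restrict measurable_compose[OF measurable_component_singleton]) auto
  show ?thesis
    unfolding PN
  proof (rule N.PiM_eqI)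
    show "sets (distr (PiM I M) (PiM I M') (\<lambda>x. \<lambda>i\<in>I. f i (x i))) = sets (PiM I N)"
      by (simp add: N_def cong: sets_PiM_cong)
    fix A assume "\<And>i. i \<in> I \<Longrightarrow> A i \<in> sets (N i)"
    then have A: "A i \<in> sets (M' i)" if "i \<in> I" for i using that by (simp add: N_def)
    have "emeasure (distr (PiM I M) (PiM I M') (\<lambda>x. \<lambda>i\<in>I. f i (x i))) (Pi\<^sub>E I A) =
       emeasure (PiM I M) ((\<lambda>x. \<lambda>i\<in>I. f i (x i)) -` Pi\<^sub>E I A \<inter> space (PiM I M))"
      using A assms(1) by (intro emeasure_distr sets_PiM_I_finite) auto
    also have "(\<lambda>x. \<lambda>i\<in>I. f i (x i)) -` Pi\<^sub>E I A \<inter> space (PiM I M) = Pi\<^sub>E I (\<lambda>i. f i -` A i \<inter> space (M i))"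
      by (auto simp: space_PiM PiE_iff)
    also have "emeasure (PiM I M) \<dots> = (\<Prod>i\<in>I. emeasure (N' i) (f i -` A i \<inter> space (M i)))"
      unfolding PM using A assms by (intro N'.emeasure_PiM) (auto simp: N'_def intro!: measurable_sets)
    also have "\<dots> = (\<Prod>i\<in>I. emeasure (N i) (A i))"
      using A assms by (intro prod.cong refl) (simp add: N_def N'_def emeasure_distr)
    finally show "emeasure (distr (PiM I M) (PiM I M') (\<lambda>x. \<lambda>i\<in>I. f i (x i))) (Pi\<^sub>E I A) =
       (\<Prod>i\<in>I. emeasure (N i) (A i))" .
  qed (use assms in auto)
qed

text \<open>The law of a standard Brownian motion at an independent random time with law
  \<open>\<mu>\<close>, hence of one grid increment of the subordinated process. Negative times are
  truncated, matching the truncated Laplace transforms that describe the stable laws.\<close>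

definition scale_mixture :: "real measure \<Rightarrow> real measure" where
  "scale_mixture \<mu> = distr (\<mu> \<Otimes>\<^sub>M std_normal_distribution) borel (\<lambda>(a, g). sqrt (max 0 a) * g)"

lemma scale_mixture:
  assumes "real_distribution \<mu>"
  shows "real_distribution (scale_mixture \<mu>)"
    and "char (scale_mixture \<mu>) u = complex_of_real (LINT a|\<mu>. exp (- (u\<^sup>2 / 2 * max 0 a)))"
proof -
  interpret \<mu>: real_distribution \<mu> by fact
  interpret S: real_distribution std_normal_distribution by (rule real_dist_normal_dist)
  interpret P: pair_prob_space \<mu> std_normal_distribution ..
  have [measurable_cong]: "sets std_normal_distribution = sets borel" "sets \<mu> = sets borel" by simp_all
  show "real_distribution (scale_mixture \<mu>)"
    unfolding scale_mixture_def by (intro P.P.real_distribution_distr) measurable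
  have int: "integrable (\<mu> \<Otimes>\<^sub>M std_normal_distribution) (\<lambda>(a, g). iexp (u * (sqrt (max 0 a) * g)))"
    by (rule P.P.integrable_const_bound[where B=1]) (auto simp: split_beta)
  have "char (scale_mixture \<mu>) u = (CLINT z|\<mu> \<Otimes>\<^sub>M std_normal_distribution. (case z of (a, g) \<Rightarrow> iexp (u * (sqrt (max 0 a) * g))))"
    unfolding char_def scale_mixture_def by (subst integral_distr) (auto simp: case_prod_unfold)
  also have "\<dots> = (CLINT a|\<mu>. (CLINT g|std_normal_distribution. iexp (u * (sqrt (max 0 a) * g))))"
    using P.integral_fst'[OF int] by simp
  also have "\<dots> = (CLINT a|\<mu>. complex_of_real (exp (- (u\<^sup>2 / 2 * max 0 a))))"
  proof (intro Bochner_Integration.integral_cong refl)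
    fix a
    have "(CLINT g|std_normal_distribution. iexp (u * (sqrt (max 0 a) * g))) = char std_normal_distribution (u * sqrt (max 0 a))"
      by (simp add: char_def mult.assoc)
    also have "\<dots> = complex_of_real (exp (- (u * sqrt (max 0 a))\<^sup>2 / 2))"
      by (simp only: char_std_normal_distribution)
    also have "- (u * sqrt (max 0 a))\<^sup>2 / 2 = - (u\<^sup>2 / 2 * max 0 a)"
      by (simp add: power_mult_distrib)
    finally show "(CLINT g|std_normal_distribution. iexp (u * (sqrt (max 0 a) * g))) = complex_of_real (exp (- (u\<^sup>2 / 2 * max 0 a)))" .
  qed
  finally show "char (scale_mixture \<mu>) u = complex_of_real (LINT a|\<mu>. exp (- (u\<^sup>2 / 2 * max 0 a)))"
    by (simp only: integral_complex_of_real)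
qed

text \<open>Separates all the random times from all the Gaussian noise, so that one can later freeze
  the times and work with a Gaussian vector. On boxes, the integral over the times factors
  coordinate by coordinate.\<close>

lemma PiM_scale_mixture:
  assumes "real_distribution \<mu>" and I: "finite I"
  shows "PiM I (\<lambda>_. scale_mixture \<mu>) =
    distr (PiM I (\<lambda>_. \<mu>) \<Otimes>\<^sub>M PiM I (\<lambda>_. std_normal_distribution)) (PiM I (\<lambda>_. borel))
      (\<lambda>(a, g). \<lambda>i\<in>I. sqrt (max 0 (a i)) * g i)" (is "_ = distr (?PM \<Otimes>\<^sub>M ?PG) _ ?F")
proof -
  interpret \<mu>: real_distribution \<mu> by fact
  interpret S: real_distribution std_normal_distribution by (rule real_dist_normal_dist)
  interpret X: real_distribution "scale_mixture \<mu>" by (rule scale_mixture) fact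
  interpret PX: product_sigma_finite "\<lambda>_. scale_mixture \<mu>" ..
  interpret P\<mu>: product_sigma_finite "\<lambda>_. \<mu>" ..
  interpret PS: product_sigma_finite "\<lambda>_. std_normal_distribution" ..
  interpret PG: prob_space ?PG by (intro prob_space_PiM S.prob_space_axioms)
  have [measurable_cong]: "sets std_normal_distribution = sets borel" "sets \<mu> = sets borel" by simp_all
  let ?f = "\<lambda>(a, g). sqrt (max 0 a) * g :: real"
  have f[measurable]: "?f \<in> borel_measurable (\<mu> \<Otimes>\<^sub>M std_normal_distribution)" by measurable
  have F[measurable]: "?F \<in> measurable (?PM \<Otimes>\<^sub>M ?PG) (PiM I (\<lambda>_. borel))"
    unfolding split_beta by measurable
  show ?thesis
  proof (rule PX.PiM_eqI[symmetric])
    show "sets (distr (?PM \<Otimes>\<^sub>M ?PG) (PiM I (\<lambda>_. borel)) ?F) = sets (PiM I (\<lambda>_. scale_mixture \<mu>))"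
      by (simp cong: sets_PiM_cong)
    fix A assume "\<And>i. i \<in> I \<Longrightarrow> A i \<in> sets (scale_mixture \<mu>)"
    then have A[measurable]: "i \<in> I \<Longrightarrow> A i \<in> sets borel" for i by simp
    define Q where "Q i = ?f -` A i \<inter> space (\<mu> \<Otimes>\<^sub>M std_normal_distribution)" for i
    have Q: "Q i \<in> sets (\<mu> \<Otimes>\<^sub>M std_normal_distribution)" if "i \<in> I" for i
      unfolding Q_def using f A[OF that] by (rule measurable_sets)
    have PA: "Pi\<^sub>E I A \<in> sets (PiM I (\<lambda>_. borel))" using A I by (intro sets_PiM_I_finite) auto
    have "emeasure (distr (?PM \<Otimes>\<^sub>M ?PG) (PiM I (\<lambda>_. borel)) ?F) (Pi\<^sub>E I A) =
      emeasure (?PM \<Otimes>\<^sub>M ?PG) (?F -` Pi\<^sub>E I A \<inter> space (?PM \<Otimes>\<^sub>M ?PG))"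
      by (rule emeasure_distr[OF F PA])
    also have "\<dots> = (\<integral>\<^sup>+a. emeasure ?PG (Pair a -` (?F -` Pi\<^sub>E I A \<inter> space (?PM \<Otimes>\<^sub>M ?PG))) \<partial>?PM)"
      using measurable_sets[OF F PA] by (rule PG.emeasure_pair_measure_alt)
    also have "\<dots> = (\<integral>\<^sup>+a. (\<Prod>i\<in>I. emeasure std_normal_distribution (Pair (a i) -` Q i)) \<partial>?PM)"
    proof (intro nn_integral_cong)
      fix a assume a: "a \<in> space ?PM"
      have "Pair a -` (?F -` Pi\<^sub>E I A \<inter> space (?PM \<Otimes>\<^sub>M ?PG)) = Pi\<^sub>E I (\<lambda>i. Pair (a i) -` Q i)"
        using a by (auto simp: space_PiM PiE_iff space_pair_measure Q_def)
      then show "emeasure ?PG (Pair a -` (?F -` Pi\<^sub>E I A \<inter> space (?PM \<Otimes>\<^sub>M ?PG))) =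
         (\<Prod>i\<in>I. emeasure std_normal_distribution (Pair (a i) -` Q i))"
        using I Q by (simp add: PS.emeasure_PiM sets_Pair1)
    qed
    also have "\<dots> = (\<Prod>i\<in>I. \<integral>\<^sup>+a. emeasure std_normal_distribution (Pair a -` Q i) \<partial>\<mu>)"
      using I Q by (intro P\<mu>.product_nn_integral_prod S.measurable_emeasure_Pair)
    also have "\<dots> = (\<Prod>i\<in>I. emeasure (scale_mixture \<mu>) (A i))"
    proof (intro prod.cong refl)
      fix i assume i: "i \<in> I"
      have "emeasure (scale_mixture \<mu>) (A i) = emeasure (\<mu> \<Otimes>\<^sub>M std_normal_distribution) (Q i)"
        unfolding scale_mixture_def Q_def using f A[OF i] by (rule emeasure_distr)
      then show "(\<integral>\<^sup>+a. emeasure std_normal_distribution (Pair a -` Q i) \<partial>\<mu>) = emeasure (scale_mixture \<mu>) (A i)"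
        using S.emeasure_pair_measure_alt[OF Q[OF i]] by simp
    qed
    finally show "emeasure (distr (?PM \<Otimes>\<^sub>M ?PG) (PiM I (\<lambda>_. borel)) ?F) (Pi\<^sub>E I A) =
      (\<Prod>i\<in>I. emeasure (scale_mixture \<mu>) (A i))" .
  qed (rule I)
qed

lemma distr_std_normal_scale:
  assumes "0 < \<sigma>"
  shows "distr std_normal_distribution borel (\<lambda>x. \<sigma> * x) = density lborel (normal_density 0 \<sigma>)"
proof -
  interpret S: real_distribution std_normal_distribution by (rule real_dist_normal_dist)
  have "distributed std_normal_distribution lborel (\<lambda>x. x) (normal_density 0 1)"
    unfolding distributed_def by (auto simp: distr_id2)
  from S.normal_density_affine[OF this, of \<sigma> 0] assms
  have "distributed std_normal_distribution lborel (\<lambda>x. x * \<sigma>) (normal_density 0 \<sigma>)"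
    by (simp add: mult.commute[of _ \<sigma>])
  then have "distr std_normal_distribution lborel (\<lambda>x. x * \<sigma>) = density lborel (normal_density 0 \<sigma>)"
    by (rule distributed_distr_eq_density)
  moreover have "distr std_normal_distribution lborel (\<lambda>x. x * \<sigma>) = distr std_normal_distribution borel (\<lambda>x. \<sigma> * x)"
    by (intro distr_cong) (auto simp: mult.commute)
  ultimately show ?thesis by simp
qed

lemma (in standard_brownian_motion) distr_increments:
  fixes s :: "nat \<Rightarrow> real"
  assumes "0 < n" "0 \<le> s 0" "\<And>i. i < n \<Longrightarrow> s i \<le> s (Suc i)"
  shows "distr M (PiM {..<n} (\<lambda>_. borel)) (\<lambda>\<omega>. \<lambda>i\<in>{..<n}. W (s (Suc i)) \<omega> - W (s i) \<omega>) =
    distr (PiM {..<n} (\<lambda>_. std_normal_distribution)) (PiM {..<n} (\<lambda>_. borel)) (\<lambda>g. \<lambda>i\<in>{..<n}. sqrt (s (Suc i) - s i) * g i)"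
proof -
  interpret S: real_distribution std_normal_distribution by (rule real_dist_normal_dist)
  have s: "0 \<le> s i" if "i \<le> n" for i
    using that by (induction i) (use assms in \<open>auto intro: order_trans\<close>)
  have rv: "(\<lambda>\<omega>. W (s (Suc i)) \<omega> - W (s i) \<omega>) \<in> borel_measurable M" if "i < n" for i
    using that by (intro borel_measurable_diff random_variable s) auto
  have "indep_vars (\<lambda>_. borel) (\<lambda>i \<omega>. W (s (Suc i)) \<omega> - W (s i) \<omega>) {..<n}"
    using independent_increments[unfolded independent_increments_def] assms by blast
  then have "distr M (PiM {..<n} (\<lambda>_. borel)) (\<lambda>\<omega>. \<lambda>i\<in>{..<n}. W (s (Suc i)) \<omega> - W (s i) \<omega>) =
     PiM {..<n} (\<lambda>i. distr M borel (\<lambda>\<omega>. W (s (Suc i)) \<omega> - W (s i) \<omega>))"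
    using assms rv by (subst (asm) indep_vars_iff_distr_eq_PiM') auto
  also have "\<dots> = PiM {..<n} (\<lambda>i. distr std_normal_distribution borel (\<lambda>x. sqrt (s (Suc i) - s i) * x))"
  proof (intro PiM_cong refl)
    fix i assume "i \<in> {..<n}"
    then have i: "i < n" by simp
    show "distr M borel (\<lambda>\<omega>. W (s (Suc i)) \<omega> - W (s i) \<omega>) = distr std_normal_distribution borel (\<lambda>x. sqrt (s (Suc i) - s i) * x)"
    \<comment> \<open>Times may coincide, because truncated time increments can be 0, but
      \<open>gaussian_increments\<close> covers only \<open>s < t\<close>. In the degenerate case
      both laws are point masses at 0.\<close>
    proof (cases "s i = s (Suc i)")
      case True
      have "distr M borel (\<lambda>\<omega>. 0 :: real) = return borel 0" by (rule distr_const) simp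
      moreover have "distr std_normal_distribution borel (\<lambda>\<omega>. 0 :: real) = return borel 0" by (rule S.distr_const) simp
      ultimately show ?thesis using True by simp
    next
      case False
      with assms(3)[OF i] have lt: "s i < s (Suc i)" by simp
      have "distr M lborel (\<lambda>\<omega>. W (s (Suc i)) \<omega> - W (s i) \<omega>) = density lborel (normal_density 0 (sqrt (s (Suc i) - s i)))"
        using gaussian_increments[OF s lt] i by (intro distributed_distr_eq_density) auto
      moreover have "distr M lborel (\<lambda>\<omega>. W (s (Suc i)) \<omega> - W (s i) \<omega>) = distr M borel (\<lambda>\<omega>. W (s (Suc i)) \<omega> - W (s i) \<omega>)"
        by (intro distr_cong) auto
      ultimately show ?thesis using lt by (simp add: distr_std_normal_scale)
    qed
  qed
  also have "\<dots> = distr (PiM {..<n} (\<lambda>_. std_normal_distribution)) (PiM {..<n} (\<lambda>_. borel)) (\<lambda>g. \<lambda>i\<in>{..<n}. sqrt (s (Suc i) - s i) * g i)"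
    by (rule distr_PiM_maps[symmetric]) (auto intro: S.prob_space_axioms)
  finally show ?thesis .
qed

text \<open>
  Grid sequences are only weakly increasing, because rounding up to a dyadic grid may merge times;
  \<^const>\<open>PiE\<close> makes them finitely many for each length.
\<close>

definition grid_event :: "real \<Rightarrow> real \<Rightarrow> nat \<Rightarrow> (nat \<Rightarrow> real) set" where
  "grid_event p \<epsilon> n = {x \<in> space (PiM {..<n} (\<lambda>_. borel :: real measure)). \<forall>k::nat. \<forall>\<tau> \<in> PiE {..k} (\<lambda>_. {..n}). mono_on {..k} \<tau> \<longrightarrow>
     (\<Sum>j=1..k. \<bar>(\<Sum>i<\<tau> j. x i) - (\<Sum>i<\<tau> (j - 1). x i)\<bar> powr p) \<le> \<epsilon> powr p}"

lemma sets_grid_event: "grid_event p \<epsilon> n \<in> sets (PiM {..<n} (\<lambda>_. borel))"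
  unfolding grid_event_def
proof (intro sets.sets_Collect_countable_All sets.sets_Collect_finite_All)
  fix k :: nat and \<tau> :: "nat \<Rightarrow> nat" assume \<tau>: "\<tau> \<in> PiE {..k} (\<lambda>_. {..n})"
  have m: "(\<lambda>x. \<Sum>i<\<tau> j. x i) \<in> borel_measurable (PiM {..<n} (\<lambda>_. borel :: real measure))" if "j \<le> k" for j
  proof (intro borel_measurable_sum measurable_component_singleton)
    fix i assume "i \<in> {..<\<tau> j}"
    then show "i \<in> {..<n}" using PiE_mem[OF \<tau>, of j] that by simp
  qed
  have "{x \<in> space (PiM {..<n} (\<lambda>_. borel)). (\<Sum>j=1..k. \<bar>(\<Sum>i<\<tau> j. x i) - (\<Sum>i<\<tau> (j - 1). x i)\<bar> powr p) \<le> \<epsilon> powr p}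
    \<in> sets (PiM {..<n} (\<lambda>_. borel))"
    by (intro borel_measurable_le borel_measurable_sum powr_real_measurable borel_measurable_abs
        borel_measurable_diff borel_measurable_const m) auto
  then have "{x \<in> space (PiM {..<n} (\<lambda>_. borel)). mono_on {..k} \<tau> \<longrightarrow> (\<Sum>j=1..k. \<bar>(\<Sum>i<\<tau> j. x i) - (\<Sum>i<\<tau> (j - 1). x i)\<bar> powr p) \<le> \<epsilon> powr p}
    \<in> sets (PiM {..<n} (\<lambda>_. borel))"
    by (cases "mono_on {..k} \<tau>") (simp_all only: simp_thms Collect_mem_eq sets.top)
  then show "{x \<in> space (PiM {..<n} (\<lambda>_. borel)). mono_on {..k} \<tau> \<longrightarrow> (\<Sum>j=1..k. \<bar>(\<Sum>i<\<tau> j. x i) - (\<Sum>i<\<tau> (j - 1). x i)\<bar> powr p) \<le> \<epsilon> powr p}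
    \<in> sets (PiM {..<n} (\<lambda>_. borel))" .
qed (rule finite_PiE, simp_all)

lemma holder_seminorm_leD:
  assumes "holder_seminorm (1 / p) f \<le> ennreal e" "0 \<le> e" "0 < p" "0 \<le> s" "s \<le> t" "t \<le> 1"
  shows "\<bar>f t - f s\<bar> powr p \<le> e powr p * (t - s)"
proof (cases "s = t")
  case False
  with assms have st: "s < t" by simp
  have "ennreal (\<bar>f t - f s\<bar> / \<bar>t - s\<bar> powr (1 / p)) \<le> holder_seminorm (1 / p) f"
    unfolding holder_seminorm_def using assms st by (intro SUP_upper2[of "(s, t)"]) auto
  then have "ennreal (\<bar>f t - f s\<bar> / \<bar>t - s\<bar> powr (1 / p)) \<le> ennreal e"
    using assms(1) by (rule order_trans)
  then have "\<bar>f t - f s\<bar> / \<bar>t - s\<bar> powr (1 / p) \<le> e"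
    using assms(2) by (simp only: ennreal_le_iff)
  then have "\<bar>f t - f s\<bar> \<le> e * (t - s) powr (1 / p)"
    using st by (simp add: pos_divide_le_eq)
  then have "\<bar>f t - f s\<bar> powr p \<le> (e * (t - s) powr (1 / p)) powr p"
    using assms by (intro powr_mono2) auto
  also have "\<dots> = e powr p * (t - s)"
    using assms st by (simp add: powr_mult powr_powr)
  finally show ?thesis .
qed (use assms in simp)

text \<open>With the times frozen, the clock divided by \<open>A\<close> stays in
  \<open>[0, 1]\<close>, and by Brownian scaling the Gaussian vector has the law of
  \<open>sqrt A\<close> times increments of \<open>W\<close> along it. On the Hoelder ball the p-th
  power of an increment over \<open>[s, t]\<close> is at most \<open>e^p (t - s)\<close>; summed
  along any grid sequence this telescopes to at most \<open>e^p\<close>.\<close>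

lemma (in standard_brownian_motion) emeasure_gaussian_grid_event_ge:
  fixes a :: "nat \<Rightarrow> real"
  assumes n: "0 < n" and A: "0 < A" "(\<Sum>i<n. max 0 (a i)) \<le> A" and p: "0 < p" and e: "0 \<le> e"
  shows "ennreal (measure M {\<omega> \<in> space M. holder_seminorm (1 / p) (\<lambda>t. W t \<omega>) \<le> ennreal e}) \<le>
    emeasure (PiM {..<n} (\<lambda>_. std_normal_distribution))
      {g \<in> space (PiM {..<n} (\<lambda>_. std_normal_distribution)). (\<lambda>i\<in>{..<n}. sqrt (max 0 (a i)) * g i) \<in> grid_event p (sqrt A * e) n}"
    (is "ennreal (measure M ?H) \<le> emeasure ?PG ?S")
proof -
  let ?B = "PiM {..<n} (\<lambda>_. borel :: real measure)"
  let ?E = "grid_event p (sqrt A * e) n"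
  have [measurable_cong]: "sets std_normal_distribution = sets borel" by simp
  have [measurable]: "?E \<in> sets ?B" by (rule sets_grid_event)
  define s where "s j = (\<Sum>i<j. max 0 (a i) / A)" for j
  have s_Suc: "s (Suc i) - s i = max 0 (a i) / A" for i by (simp add: s_def)
  have s_mono: "s i \<le> s j" if "i \<le> j" for i j
    unfolding s_def using that A by (intro sum_mono2) auto
  have s0: "0 \<le> s i" for i unfolding s_def using A by (intro sum_nonneg) auto
  have s1: "s i \<le> 1" if "i \<le> n" for i
  proof -
    have "s n = (\<Sum>i<n. max 0 (a i)) / A" by (simp add: s_def sum_divide_distrib)
    also have "\<dots> \<le> 1" using A by simp
    finally show ?thesis using s_mono[OF that] by linarith
  qed
  have rv: "W (s i) \<in> borel_measurable M" for i by (intro random_variable s0)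
  have [measurable]: "(\<lambda>\<omega>. \<lambda>i\<in>{..<n}. W (s (Suc i)) \<omega> - W (s i) \<omega>) \<in> measurable M ?B"
    using rv by (intro measurable_restrict borel_measurable_diff) auto
  have [measurable]: "(\<lambda>g. \<lambda>i\<in>{..<n}. sqrt (s (Suc i) - s i) * g i) \<in> measurable ?PG ?B"
    by measurable
  have [measurable]: "(\<lambda>y. \<lambda>i\<in>{..<n}. sqrt A * y i) \<in> measurable ?B ?B"
    by measurable
  \<comment> \<open>The event for the increments of \<open>W\<close> themselves, before the factor
    \<open>sqrt A\<close> is applied.\<close>
  define E' where "E' = {y \<in> space ?B. (\<lambda>i\<in>{..<n}. sqrt A * y i) \<in> ?E}"
  have E'[measurable]: "E' \<in> sets ?B" unfolding E'_def by measurable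
  have spB: "space ?B = PiE {..<n} (\<lambda>_. UNIV)" by (simp add: space_PiM)
  have "emeasure M {\<omega> \<in> space M. (\<lambda>i\<in>{..<n}. W (s (Suc i)) \<omega> - W (s i) \<omega>) \<in> E'} =
    emeasure (distr M ?B (\<lambda>\<omega>. \<lambda>i\<in>{..<n}. W (s (Suc i)) \<omega> - W (s i) \<omega>)) E'"
    by (subst emeasure_distr) (auto intro!: arg_cong[where f="emeasure M"])
  also have "\<dots> = emeasure (distr ?PG ?B (\<lambda>g. \<lambda>i\<in>{..<n}. sqrt (s (Suc i) - s i) * g i)) E'"
    by (subst distr_increments) (use n s0 s_mono in auto)
  also have "\<dots> = emeasure ?PG ?S"
  proof (subst emeasure_distr)
    have "(\<lambda>g. \<lambda>i\<in>{..<n}. sqrt (s (Suc i) - s i) * g i) -` E' \<inter> space ?PG = ?S"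
    proof -
      have "(\<lambda>i\<in>{..<n}. sqrt A * (\<lambda>i\<in>{..<n}. sqrt (s (Suc i) - s i) * g i) i) = (\<lambda>i\<in>{..<n}. sqrt (max 0 (a i)) * g i)" for g
        using A by (intro restrict_ext) (simp add: s_Suc real_sqrt_divide)
      then show ?thesis by (auto simp: E'_def spB)
    qed
    then show "emeasure ?PG ((\<lambda>g. \<lambda>i\<in>{..<n}. sqrt (s (Suc i) - s i) * g i) -` E' \<inter> space ?PG) = emeasure ?PG ?S"
      by simp
  qed auto
  finally have eq: "emeasure M {\<omega> \<in> space M. (\<lambda>i\<in>{..<n}. W (s (Suc i)) \<omega> - W (s i) \<omega>) \<in> E'} = emeasure ?PG ?S" .
  have "?H \<subseteq> {\<omega> \<in> space M. (\<lambda>i\<in>{..<n}. W (s (Suc i)) \<omega> - W (s i) \<omega>) \<in> E'}"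
  proof
    fix \<omega> assume \<omega>: "\<omega> \<in> ?H"
    define x where "x = (\<lambda>i\<in>{..<n}. sqrt A * (\<lambda>i\<in>{..<n}. W (s (Suc i)) \<omega> - W (s i) \<omega>) i)"
    have S: "(\<Sum>i<l. x i) = sqrt A * (W (s l) \<omega> - W (s 0) \<omega>)" if "l \<le> n" for l
    proof -
      have "(\<Sum>i<l. x i) = (\<Sum>i<l. sqrt A * (W (s (Suc i)) \<omega> - W (s i) \<omega>))"
        using that by (intro sum.cong) (auto simp: x_def)
      also have "\<dots> = sqrt A * (\<Sum>i<l. W (s (Suc i)) \<omega> - W (s i) \<omega>)" by (simp add: sum_distrib_left)
      also have "(\<Sum>i<l. W (s (Suc i)) \<omega> - W (s i) \<omega>) = W (s l) \<omega> - W (s 0) \<omega>"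
        by (rule sum_lessThan_telescope[of "\<lambda>i. W (s i) \<omega>"])
      finally show ?thesis .
    qed
    have "x \<in> ?E"
      unfolding grid_event_def
    proof (intro CollectI conjI allI ballI impI)
      show "x \<in> space ?B" by (simp add: spB x_def)
      fix k :: nat and \<tau> :: "nat \<Rightarrow> nat" assume \<tau>: "\<tau> \<in> PiE {..k} (\<lambda>_. {..n})" "mono_on {..k} \<tau>"
      have \<tau>n: "\<tau> j \<le> n" if "j \<le> k" for j using PiE_mem[OF \<tau>(1), of j] that by simp
      have \<tau>m: "\<tau> (j - 1) \<le> \<tau> j" if "j \<in> {1..k}" for j
        using \<tau>(2) that by (auto simp: mono_on_def)
      have "(\<Sum>j=1..k. \<bar>(\<Sum>i<\<tau> j. x i) - (\<Sum>i<\<tau> (j - 1). x i)\<bar> powr p) \<le>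
        (\<Sum>j=1..k. (sqrt A * e) powr p * (s (\<tau> j) - s (\<tau> (j - 1))))"
      proof (rule sum_mono)
        fix j assume j: "j \<in> {1..k}"
        have "(\<Sum>i<\<tau> j. x i) - (\<Sum>i<\<tau> (j - 1). x i) = sqrt A * (W (s (\<tau> j)) \<omega> - W (s (\<tau> (j - 1))) \<omega>)"
        proof -
          have "\<tau> j \<le> n" "\<tau> (j - 1) \<le> n" using j by (auto intro!: \<tau>n)
          then show ?thesis by (simp only: S right_diff_distrib)

        qed
        then have "\<bar>(\<Sum>i<\<tau> j. x i) - (\<Sum>i<\<tau> (j - 1). x i)\<bar> powr p =
           sqrt A powr p * \<bar>W (s (\<tau> j)) \<omega> - W (s (\<tau> (j - 1))) \<omega>\<bar> powr p"
          using A by (simp add: abs_mult powr_mult)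
        also have "\<dots> \<le> sqrt A powr p * (e powr p * (s (\<tau> j) - s (\<tau> (j - 1))))"
          using \<omega> e p j by (intro mult_left_mono holder_seminorm_leD[where f="\<lambda>t. W t \<omega>"] s0 s1 s_mono \<tau>m \<tau>n) auto
        also have "\<dots> = (sqrt A * e) powr p * (s (\<tau> j) - s (\<tau> (j - 1)))"
          using A e by (simp add: powr_mult)
        finally show "\<bar>(\<Sum>i<\<tau> j. x i) - (\<Sum>i<\<tau> (j - 1). x i)\<bar> powr p \<le> (sqrt A * e) powr p * (s (\<tau> j) - s (\<tau> (j - 1)))" .
      qed
      also have "\<dots> = (sqrt A * e) powr p * (\<Sum>j=1..k. s (\<tau> j) - s (\<tau> (j - 1)))"
        by (simp only: sum_distrib_left)
      also have "(\<Sum>j=1..k. s (\<tau> j) - s (\<tau> (j - 1))) = s (\<tau> k) - s (\<tau> 0)"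
      proof -
        have "(\<Sum>j=1..k. s (\<tau> j) - s (\<tau> (j - 1))) = (\<Sum>j<k. s (\<tau> (Suc j)) - s (\<tau> j))"
          by (intro sum.reindex_bij_witness[of _ Suc "\<lambda>j. j - 1"]) auto
        then show ?thesis using sum_lessThan_telescope[of "\<lambda>j. s (\<tau> j)" k] by simp
      qed
      also have "(sqrt A * e) powr p * (s (\<tau> k) - s (\<tau> 0)) \<le> (sqrt A * e) powr p * 1"
        using s1[OF \<tau>n[of k]] s0[of "\<tau> 0"] by (intro mult_left_mono) auto
      finally show "(\<Sum>j=1..k. \<bar>(\<Sum>i<\<tau> j. x i) - (\<Sum>i<\<tau> (j - 1). x i)\<bar> powr p) \<le> (sqrt A * e) powr p" by simp
    qed
    then show "\<omega> \<in> {\<omega> \<in> space M. (\<lambda>i\<in>{..<n}. W (s (Suc i)) \<omega> - W (s i) \<omega>) \<in> E'}"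
      using \<omega> by (simp add: E'_def x_def spB)
  qed
  then have "measure M ?H \<le> measure M {\<omega> \<in> space M. (\<lambda>i\<in>{..<n}. W (s (Suc i)) \<omega> - W (s i) \<omega>) \<in> E'}"
    by (rule finite_measure_mono) measurable
  then show ?thesis unfolding eq[symmetric] by (simp add: emeasure_eq_measure ennreal_leI)
qed

text \<open>Condition on the times: whenever they sum to at most \<open>A\<close>, the Gaussian
  probability is at least the Hoelder small ball probability, a bound free of the times. Integrating
  over that event gives the product.\<close>

lemma (in standard_brownian_motion) measure_scale_mixture_grid_event_ge:
  fixes \<mu> :: "real measure"
  assumes \<mu>: "real_distribution \<mu>" and n: "0 < n" and A: "0 < A" and p: "0 < p" and e: "0 \<le> e"
  shows "measure (PiM {..<n} (\<lambda>_. \<mu>)) {a \<in> space (PiM {..<n} (\<lambda>_. \<mu>)). (\<Sum>i<n. max 0 (a i)) \<le> A} *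
      measure M {\<omega> \<in> space M. holder_seminorm (1 / p) (\<lambda>t. W t \<omega>) \<le> ennreal e}
    \<le> measure (PiM {..<n} (\<lambda>_. scale_mixture \<mu>)) (grid_event p (sqrt A * e) n)"
    (is "measure ?PM ?S * ?q \<le> measure ?PX ?E")
proof -
  interpret \<mu>: real_distribution \<mu> by fact
  interpret S: real_distribution std_normal_distribution by (rule real_dist_normal_dist)
  interpret X: real_distribution "scale_mixture \<mu>" by (rule scale_mixture) fact
  have [measurable_cong]: "sets std_normal_distribution = sets borel" "sets \<mu> = sets borel" by simp_all
  let ?PG = "PiM {..<n} (\<lambda>_. std_normal_distribution)"
  let ?B = "PiM {..<n} (\<lambda>_. borel :: real measure)"
  interpret PM: prob_space ?PM by (intro prob_space_PiM \<mu>.prob_space_axioms)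
  interpret PG: prob_space ?PG by (intro prob_space_PiM S.prob_space_axioms)
  interpret PX: prob_space ?PX by (intro prob_space_PiM X.prob_space_axioms)
  let ?F = "\<lambda>(a, g). \<lambda>i\<in>{..<n}. sqrt (max 0 (a i)) * g i :: real"
  have F[measurable]: "?F \<in> measurable (?PM \<Otimes>\<^sub>M ?PG) ?B"
    unfolding split_beta by measurable
  have E: "?E \<in> sets ?B" by (rule sets_grid_event)
  have [measurable]: "?S \<in> sets ?PM" by measurable
  have "emeasure ?PX ?E = emeasure (?PM \<Otimes>\<^sub>M ?PG) (?F -` ?E \<inter> space (?PM \<Otimes>\<^sub>M ?PG))"
    by (subst PiM_scale_mixture[OF \<mu> finite_lessThan]) (rule emeasure_distr[OF F E])
  also have "\<dots> = (\<integral>\<^sup>+a. emeasure ?PG (Pair a -` (?F -` ?E \<inter> space (?PM \<Otimes>\<^sub>M ?PG))) \<partial>?PM)"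
    using measurable_sets[OF F E] by (rule PG.emeasure_pair_measure_alt)
  also have "\<dots> \<ge> (\<integral>\<^sup>+a. ennreal ?q * indicator ?S a \<partial>?PM)"
  proof (intro nn_integral_mono)
    fix a assume a: "a \<in> space ?PM"
    show "ennreal ?q * indicator ?S a \<le> emeasure ?PG (Pair a -` (?F -` ?E \<inter> space (?PM \<Otimes>\<^sub>M ?PG)))"
    proof (cases "a \<in> ?S")
      case True
      have "Pair a -` (?F -` ?E \<inter> space (?PM \<Otimes>\<^sub>M ?PG)) = {g \<in> space ?PG. (\<lambda>i\<in>{..<n}. sqrt (max 0 (a i)) * g i) \<in> ?E}"
        using a by (auto simp: space_pair_measure)
      then show ?thesis
        using True emeasure_gaussian_grid_event_ge[OF n A _ p e, of a] by simp
    qed simp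
  qed
  also have "(\<integral>\<^sup>+a. ennreal ?q * indicator ?S a \<partial>?PM) = ennreal ?q * emeasure ?PM ?S"
    by (rule nn_integral_cmult_indicator) measurable
  finally have "ennreal ?q * emeasure ?PM ?S \<le> emeasure ?PX ?E" .
  then show ?thesis
    by (simp add: PM.emeasure_eq_measure PX.emeasure_eq_measure ennreal_mult[symmetric] mult.commute)
qed

section \<open>From dyadic grids to whole paths\<close>

lemma cadlag_tendsto:
  assumes "cadlag f" "0 \<le> t" "\<And>m. t \<le> s m" "s \<longlonglongrightarrow> t"
  shows "(\<lambda>m::nat. f (s m)) \<longlonglongrightarrow> f t"
proof (rule metric_LIMSEQ_I)
  fix e :: real assume e: "0 < e"
  have "(f \<longlongrightarrow> f t) (at_right t)" using assms by (simp add: cadlag_def)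
  then have "\<forall>\<^sub>F x in at_right t. dist (f x) (f t) < e" using e by (rule tendstoD)
  then obtain b where b: "b > t" "\<And>y. t < y \<Longrightarrow> y < b \<Longrightarrow> dist (f y) (f t) < e"
    by (auto simp: eventually_at_right[OF less_add_one])
  have "\<forall>\<^sub>F m in sequentially. s m < b" using assms(4) b(1) by (rule order_tendstoD)
  then obtain M where M: "\<And>m. m \<ge> M \<Longrightarrow> s m < b" by (auto simp: eventually_sequentially)
  show "\<exists>no. \<forall>n\<ge>no. dist (f (s n)) (f t) < e"
  proof (intro exI[of _ M] allI impI)
    fix m assume "M \<le> m"
    then show "dist (f (s m)) (f t) < e"
      using assms(3)[of m] b(2)[of "s m"] M[of m] e by (cases "s m = t") auto
  qed
qed

text \<open>Each time is rounded up to the dyadic grid: upward because only right continuity is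
  available, and never beyond 1, as 1 is a grid point. For a fixed sequence of times the finitely
  many terms converge, so the bound passes to the limit.\<close>

lemma strong_variation_le_dyadic:
  fixes f :: "real \<Rightarrow> real"
  assumes f: "cadlag f" and \<epsilon>: "0 \<le> \<epsilon>" and p: "0 < p"
    and dyadic: "\<And>m k \<tau>. \<tau> \<in> PiE {..k::nat} (\<lambda>_. {..2 ^ m}) \<Longrightarrow> mono_on {..k} \<tau> \<Longrightarrow>
      (\<Sum>j=1..k. \<bar>f (real (\<tau> j) / 2 ^ m) - f (real (\<tau> (j - 1)) / 2 ^ m)\<bar> powr p) \<le> \<epsilon> powr p"
  shows "strong_variation p f \<le> ennreal \<epsilon>"
proof (rule strong_variation_leI[OF \<epsilon> p])
  fix k :: nat and t assume t: "strict_mono_on {..k} t" "t ` {..k} \<subseteq> {0..1::real}"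
  have t01: "0 \<le> t j" "t j \<le> 1" if "j \<le> k" for j using t(2) that by auto
  define \<tau> where "\<tau> m = (\<lambda>j\<in>{..k}. nat \<lceil>2 ^ m * t j\<rceil>)" for m :: nat
  define s where "s m j = real_of_int \<lceil>2 ^ m * t j\<rceil> / 2 ^ m" for m j
  have \<tau>s: "real (\<tau> m j) / 2 ^ m = s m j" if "j \<le> k" for m j
    using that t01[OF that] by (simp add: \<tau>_def s_def)
  have s_ge: "t j \<le> s m j" for m j
    using le_of_int_ceiling[of "2 ^ m * t j"] by (simp add: s_def pos_le_divide_eq mult.commute)
  have s_lim: "(\<lambda>m. s m j) \<longlonglongrightarrow> t j" for j
  proof (rule tendsto_sandwich[OF _ _ tendsto_const])
    show "\<forall>\<^sub>F m in sequentially. t j \<le> s m j" using s_ge by simp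
    show "\<forall>\<^sub>F m in sequentially. s m j \<le> t j + (1 / 2) ^ m"
    proof (intro always_eventually allI)
      fix m
      have "real_of_int \<lceil>2 ^ m * t j\<rceil> \<le> 2 ^ m * t j + 1" by linarith
      then show "s m j \<le> t j + (1 / 2) ^ m" by (simp add: s_def field_simps power_one_over)
    qed
    have "(\<lambda>m. t j + (1 / 2) ^ m) \<longlonglongrightarrow> t j + 0" by (intro tendsto_intros) simp
    then show "(\<lambda>m. t j + (1 / 2) ^ m) \<longlonglongrightarrow> t j" by simp
  qed
  have \<tau>: "\<tau> m \<in> PiE {..k} (\<lambda>_. {..2 ^ m})" for m
  proof -
    have "nat \<lceil>2 ^ m * t j\<rceil> \<le> 2 ^ m" if "j \<le> k" for j
    proof -
      have "2 ^ m * t j \<le> 2 ^ m * 1" using t01[OF that] by (intro mult_left_mono) auto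
      then have "\<lceil>2 ^ m * t j\<rceil> \<le> 2 ^ m" by (simp add: ceiling_le_iff)
      then show ?thesis by (simp add: nat_le_iff)
    qed
    then show ?thesis by (simp add: \<tau>_def)
  qed
  have \<tau>m: "mono_on {..k} (\<tau> m)" for m
  proof (rule mono_onI)
    fix i j assume ij: "i \<in> {..k}" "j \<in> {..k}" "i \<le> j"
    have "t i \<le> t j" using strict_mono_on_leD[OF t(1) ij] .
    then have "nat \<lceil>2 ^ m * t i\<rceil> \<le> nat \<lceil>2 ^ m * t j\<rceil>" by (intro nat_mono ceiling_mono mult_left_mono) auto
    then show "\<tau> m i \<le> \<tau> m j" using ij by (simp add: \<tau>_def)
  qed
  have "(\<lambda>m. \<Sum>j=1..k. \<bar>f (s m j) - f (s m (j - 1))\<bar> powr p) \<longlonglongrightarrow> (\<Sum>j=1..k. \<bar>f (t j) - f (t (j - 1))\<bar> powr p)"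
    using p by (intro tendsto_sum tendsto_powr2 tendsto_intros cadlag_tendsto[OF f] s_lim s_ge t01) auto
  then show "(\<Sum>j=1..k. \<bar>f (t j) - f (t (j - 1))\<bar> powr p) \<le> \<epsilon> powr p"
  proof (rule LIMSEQ_le_const2)
    show "\<exists>N. \<forall>m\<ge>N. (\<Sum>j=1..k. \<bar>f (s m j) - f (s m (j - 1))\<bar> powr p) \<le> \<epsilon> powr p"
    proof (intro exI allI impI)
      fix m
      have "(\<Sum>j=1..k. \<bar>f (s m j) - f (s m (j - 1))\<bar> powr p) =
        (\<Sum>j=1..k. \<bar>f (real (\<tau> m j) / 2 ^ m) - f (real (\<tau> m (j - 1)) / 2 ^ m)\<bar> powr p)"
        by (intro sum.cong refl) (auto simp: \<tau>s simp del: One_nat_def)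
      also have "\<dots> \<le> \<epsilon> powr p" by (rule dyadic[OF \<tau> \<tau>m])
      finally show "(\<Sum>j=1..k. \<bar>f (s m j) - f (s m (j - 1))\<bar> powr p) \<le> \<epsilon> powr p" .
    qed
  qed
qed

context levy_process
begin

text \<open>The dyadic grid events decrease, so continuity from above carries \<open>L\<close> to
  their intersection, on which the p-variation is at most \<open>\<epsilon>\<close>. The target must
  be measurable, since otherwise its \<open>measure\<close> would be 0.\<close>

lemma prob_strong_variation_ge:
  assumes \<epsilon>: "0 \<le> \<epsilon>" and p: "0 < p"
    and sets: "{\<omega> \<in> space M. strong_variation p (\<lambda>t. X t \<omega>) \<le> ennreal \<epsilon>} \<in> sets M"
    and grid: "\<And>n. 0 < n \<Longrightarrow> L \<le> measure (PiM {..<n} (\<lambda>_. law (1 / real n))) (grid_event p \<epsilon> n)"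
  shows "L \<le> measure M {\<omega> \<in> space M. strong_variation p (\<lambda>t. X t \<omega>) \<le> ennreal \<epsilon>}"
proof -
  define I where "I n \<omega> = (\<lambda>i\<in>{..<n}. increment n i \<omega>)" for n \<omega>
  have [measurable]: "I n \<in> measurable M (PiM {..<n} (\<lambda>_. borel))" for n
    unfolding I_def by measurable
  have [measurable]: "grid_event p \<epsilon> n \<in> sets (PiM {..<n} (\<lambda>_. borel))" for n
    by (rule sets_grid_event)
  define F where "F m = {\<omega> \<in> space M. I (2 ^ m) \<omega> \<in> grid_event p \<epsilon> (2 ^ m)}" for m
  have F_sets[measurable]: "F m \<in> sets M" for m unfolding F_def by measurable
  have L: "L \<le> measure M (F m)" for m
  proof -
    have d: "PiM {..<2 ^ m} (\<lambda>_. law (1 / real (2 ^ m))) = distr M (PiM {..<2 ^ m} (\<lambda>_. borel)) (I (2 ^ m))"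
      unfolding I_def[abs_def] by (rule distr_increments[symmetric]) simp
    have "measure (PiM {..<2 ^ m} (\<lambda>_. law (1 / real (2 ^ m)))) (grid_event p \<epsilon> (2 ^ m)) = measure M (F m)"
      unfolding d F_def
      by (subst measure_distr) (auto intro!: arg_cong[where f="measure M"])
    then show ?thesis using grid[of "2 ^ m"] by simp
  qed
  have F_iff: "\<omega> \<in> F m \<longleftrightarrow> \<omega> \<in> space M \<and> (\<forall>k::nat. \<forall>\<tau> \<in> PiE {..k} (\<lambda>_. {..2 ^ m}). mono_on {..k} \<tau> \<longrightarrow>
      (\<Sum>j=1..k. \<bar>X (real (\<tau> j) / 2 ^ m) \<omega> - X (real (\<tau> (j - 1)) / 2 ^ m) \<omega>\<bar> powr p) \<le> \<epsilon> powr p)" for \<omega> m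
  proof -
    have S: "(\<Sum>i<l. I (2 ^ m) \<omega> i) = X (real l / 2 ^ m) \<omega> - X 0 \<omega>" if "l \<le> 2 ^ m" for l
    proof -
      have "(\<Sum>i<l. I (2 ^ m) \<omega> i) = (\<Sum>i<l. X (real (Suc i) / 2 ^ m) \<omega> - X (real i / 2 ^ m) \<omega>)"
        using that by (intro sum.cong) (auto simp: I_def increment_def)
      also have "\<dots> = X (real l / 2 ^ m) \<omega> - X (real 0 / 2 ^ m) \<omega>"
        by (rule sum_lessThan_telescope[of "\<lambda>i. X (real i / 2 ^ m) \<omega>"])
      finally show ?thesis by simp
    qed
    have "(\<Sum>j=1..k. \<bar>(\<Sum>i<\<tau> j. I (2 ^ m) \<omega> i) - (\<Sum>i<\<tau> (j - 1). I (2 ^ m) \<omega> i)\<bar> powr p) =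
      (\<Sum>j=1..k. \<bar>X (real (\<tau> j) / 2 ^ m) \<omega> - X (real (\<tau> (j - 1)) / 2 ^ m) \<omega>\<bar> powr p)"
      if \<tau>: "\<tau> \<in> PiE {..k::nat} (\<lambda>_. {..2 ^ m})" for k \<tau>
    proof (intro sum.cong refl)
      fix j assume "j \<in> {1..k}"
      then have "\<tau> j \<le> 2 ^ m" "\<tau> (j - 1) \<le> 2 ^ m" using PiE_mem[OF \<tau>, of j] PiE_mem[OF \<tau>, of "j - 1"] by auto
      then show "\<bar>(\<Sum>i<\<tau> j. I (2 ^ m) \<omega> i) - (\<Sum>i<\<tau> (j - 1). I (2 ^ m) \<omega> i)\<bar> powr p =
        \<bar>X (real (\<tau> j) / 2 ^ m) \<omega> - X (real (\<tau> (j - 1)) / 2 ^ m) \<omega>\<bar> powr p" by (simp add: S)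
    qed
    moreover have "I (2 ^ m) \<omega> \<in> space (PiM {..<2 ^ m} (\<lambda>_. borel))" by (simp add: I_def space_PiM)
    ultimately show ?thesis unfolding F_def grid_event_def by simp
  qed
  \<comment> \<open>A sequence on the coarse grid is one on the next grid after doubling its
    indices.\<close>
  have "decseq F"
  proof (rule decseq_SucI, rule subsetI)
    fix m \<omega> assume \<omega>: "\<omega> \<in> F (Suc m)"
    show "\<omega> \<in> F m"
      unfolding F_iff
    proof (intro conjI allI ballI impI)
      show "\<omega> \<in> space M" using \<omega> by (simp add: F_iff)
      fix k :: nat and \<tau> :: "nat \<Rightarrow> nat" assume \<tau>: "\<tau> \<in> PiE {..k} (\<lambda>_. {..2 ^ m})" "mono_on {..k} \<tau>"
      define \<sigma> where "\<sigma> = (\<lambda>j\<in>{..k}. 2 * \<tau> j)"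
      have "\<sigma> \<in> PiE {..k} (\<lambda>_. {..2 ^ Suc m})" using PiE_mem[OF \<tau>(1)] by (auto simp: \<sigma>_def)
      moreover have "mono_on {..k} \<sigma>" using \<tau>(2) by (auto simp: \<sigma>_def mono_on_def)
      ultimately have "(\<Sum>j=1..k. \<bar>X (real (\<sigma> j) / 2 ^ Suc m) \<omega> - X (real (\<sigma> (j - 1)) / 2 ^ Suc m) \<omega>\<bar> powr p) \<le> \<epsilon> powr p"
        by (rule \<omega>[unfolded F_iff, THEN conjunct2, rule_format])
      also have "(\<Sum>j=1..k. \<bar>X (real (\<sigma> j) / 2 ^ Suc m) \<omega> - X (real (\<sigma> (j - 1)) / 2 ^ Suc m) \<omega>\<bar> powr p) =
        (\<Sum>j=1..k. \<bar>X (real (\<tau> j) / 2 ^ m) \<omega> - X (real (\<tau> (j - 1)) / 2 ^ m) \<omega>\<bar> powr p)"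
      proof (intro sum.cong refl)
        have *: "real (\<sigma> j) / 2 ^ Suc m = real (\<tau> j) / 2 ^ m" if "j \<le> k" for j
          using that by (simp add: \<sigma>_def)
        fix j assume "j \<in> {1..k}"
        then have "j \<le> k" "j - 1 \<le> k" by auto
        then show "\<bar>X (real (\<sigma> j) / 2 ^ Suc m) \<omega> - X (real (\<sigma> (j - 1)) / 2 ^ Suc m) \<omega>\<bar> powr p =
          \<bar>X (real (\<tau> j) / 2 ^ m) \<omega> - X (real (\<tau> (j - 1)) / 2 ^ m) \<omega>\<bar> powr p"
          by (simp only: *)
      qed
      finally show "(\<Sum>j=1..k. \<bar>X (real (\<tau> j) / 2 ^ m) \<omega> - X (real (\<tau> (j - 1)) / 2 ^ m) \<omega>\<bar> powr p) \<le> \<epsilon> powr p" .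
    qed
  qed
  have "range F \<subseteq> sets M" using F_sets by auto
  then have "(\<lambda>m. measure M (F m)) \<longlonglongrightarrow> measure M (\<Inter>m. F m)"
    using \<open>decseq F\<close> by (rule finite_Lim_measure_decseq)
  then have "L \<le> measure M (\<Inter>m. F m)" by (rule LIMSEQ_le_const) (use L in blast)
  also have "\<dots> \<le> measure M {\<omega> \<in> space M. strong_variation p (\<lambda>t. X t \<omega>) \<le> ennreal \<epsilon>}"
  proof (rule finite_measure_mono[OF _ sets], rule subsetI)
    fix \<omega> assume "\<omega> \<in> (\<Inter>m. F m)"
    then have \<omega>: "\<omega> \<in> F m" for m by blast
    then have "\<omega> \<in> space M" by (simp add: F_iff)
    moreover have "strong_variation p (\<lambda>t. X t \<omega>) \<le> ennreal \<epsilon>"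
    proof (rule strong_variation_le_dyadic[OF cadlag_paths[OF \<open>\<omega> \<in> space M\<close>] \<epsilon> p])
      fix m k :: nat and \<tau> :: "nat \<Rightarrow> nat" assume "\<tau> \<in> PiE {..k} (\<lambda>_. {..2 ^ m})" "mono_on {..k} \<tau>"
      then show "(\<Sum>j=1..k. \<bar>X (real (\<tau> j) / 2 ^ m) \<omega> - X (real (\<tau> (j - 1)) / 2 ^ m) \<omega>\<bar> powr p) \<le> \<epsilon> powr p"
        by (rule \<omega>[of m, unfolded F_iff, THEN conjunct2, rule_format])
    qed
    ultimately show "\<omega> \<in> {\<omega> \<in> space M. strong_variation p (\<lambda>t. X t \<omega>) \<le> ennreal \<epsilon>}" by simp
  qed
  finally show ?thesis .
qed

end

section \<open>The two bounds\<close>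

text \<open>The factor \<open>2 powr (\<alpha> / 2)\<close> cancels the one half in
  \<open>s = u^2 / 2\<close>, at which the characteristic function of the mixture evaluates the
  Laplace transform of \<open>\<mu>\<close>.\<close>

lemma scale_mixture_stable_char:
  fixes \<alpha> b u :: real
  assumes \<mu>: "real_distribution \<mu>" and "0 < \<alpha>"
    and L: "\<And>s. s \<ge> 0 \<Longrightarrow> (LINT x|\<mu>. exp (- (s * max 0 x))) = exp (- (b * 2 powr (\<alpha> / 2) * s powr (\<alpha> / 2)))"
  shows "char (scale_mixture \<mu>) u = complex_of_real (exp (- (b * \<bar>u\<bar> powr \<alpha>)))"
proof -
  have "2 powr (\<alpha> / 2) * (u\<^sup>2 / 2) powr (\<alpha> / 2) = (u\<^sup>2) powr (\<alpha> / 2)"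
    by (simp add: powr_mult[symmetric])
  also have "\<dots> = \<bar>u\<bar> powr \<alpha>"
  proof (cases "u = 0")
    case False
    then have "u\<^sup>2 = \<bar>u\<bar> powr 2" by simp
    then show ?thesis by (simp only: powr_powr) simp
  qed (use assms in simp)
  finally show ?thesis
    using L[of "u\<^sup>2 / 2"] scale_mixture(2)[OF \<mu>, of u] by (simp add: mult.assoc)
qed

text \<open>For each \<open>n\<close>, a stable law of parameter \<open>\<kappa> / n\<close> makes
  \<open>scale_mixture \<mu>\<close> the law of \<open>Z\<close> at time \<open>1 / n\<close>, by
  uniqueness of characteristic functions. The sum of \<open>n\<close> independent times has a
  Laplace transform that does not depend on \<open>n\<close>, so the premise on \<open>L\<close>,
  stated for all spaces, bounds every grid at once.\<close>

lemma strong_variation_holder_lower_bound: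
  fixes \<alpha> p \<kappa> A e L :: real
  assumes \<alpha>: "0 < \<alpha>" "\<alpha> < 2" and p: "0 < p" and \<kappa>: "0 < \<kappa>" and A: "0 < A" and e: "0 \<le> e"
    and Z: "levy_process M Z"
    and char: "\<And>t u. t \<ge> 0 \<Longrightarrow>
           (CLINT \<omega>|M. iexp (u * Z t \<omega>)) = complex_of_real (exp (- (\<kappa> * t * \<bar>u\<bar> powr \<alpha>)))"
    and W: "standard_brownian_motion N W"
    and sets: "{\<omega> \<in> space M. strong_variation p (\<lambda>t. Z t \<omega>) \<le> ennreal (sqrt A * e)} \<in> sets M"
    and L: "\<forall>(P :: (nat \<Rightarrow> real) measure) Y. prob_space P \<longrightarrow> Y \<in> borel_measurable P \<longrightarrow>
     (\<forall>\<omega>\<in>space P. 0 \<le> Y \<omega>) \<longrightarrow>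
     (\<forall>r\<ge>0. (LINT \<omega>|P. exp (- (r * Y \<omega>))) = exp (- (\<kappa> * 2 powr (\<alpha> / 2) * r powr (\<alpha> / 2)))) \<longrightarrow>
     L \<le> measure P {\<omega> \<in> space P. Y \<omega> \<le> A}"
  shows "L * measure N {\<omega> \<in> space N. holder_seminorm (1 / p) (\<lambda>t. W t \<omega>) \<le> ennreal e}
    \<le> measure M {\<omega> \<in> space M. strong_variation p (\<lambda>t. Z t \<omega>) \<le> ennreal (sqrt A * e)}"
proof -
  interpret Z: levy_process M Z by fact
  interpret W: standard_brownian_motion N W by fact
  show ?thesis
  proof (rule Z.prob_strong_variation_ge[OF _ p sets])
    show "0 \<le> sqrt A * e" using A e by simp
    fix n :: nat assume n: "0 < n"
    obtain \<mu> :: "real measure" where \<mu>: "real_distribution \<mu>"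
      and lap: "\<And>s. s \<ge> 0 \<Longrightarrow> (LINT x|\<mu>. exp (- (s * max 0 x))) = exp (- (\<kappa> / real n * 2 powr (\<alpha> / 2) * s powr (\<alpha> / 2)))"
      using exists_positive_stable[of "\<kappa> / real n * 2 powr (\<alpha> / 2)" "\<alpha> / 2"] \<alpha> \<kappa> n by auto
    interpret \<mu>: real_distribution \<mu> by fact
    let ?PM = "PiM {..<n} (\<lambda>_. \<mu>)"
    have [measurable_cong]: "sets \<mu> = sets borel" by simp
    have law: "Z.law (1 / real n) = scale_mixture \<mu>"
    proof (rule Levy_uniqueness)
      show "real_distribution (Z.law (1 / real n))" by (rule Z.real_distribution_law) simp
      show "real_distribution (scale_mixture \<mu>)" by (rule scale_mixture) fact
      show "Characteristic_Functions.char (Z.law (1 / real n)) = Characteristic_Functions.char (scale_mixture \<mu>)"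
      proof
        fix u
        have "Characteristic_Functions.char (Z.law (1 / real n)) u = complex_of_real (exp (- (\<kappa> * (1 / real n) * \<bar>u\<bar> powr \<alpha>)))"
          using Z.random_variable[of "1 / real n"] char[of "1 / real n" u]
          unfolding char_def Z.law_def by (subst integral_distr) auto
        also have "\<dots> = Characteristic_Functions.char (scale_mixture \<mu>) u"
          using scale_mixture_stable_char[OF \<mu> \<alpha>(1) lap, of u] by simp
        finally show "Characteristic_Functions.char (Z.law (1 / real n)) u = Characteristic_Functions.char (scale_mixture \<mu>) u" .
      qed
    qed
    have "L \<le> measure ?PM {a \<in> space ?PM. (\<Sum>i<n. max 0 (a i)) \<le> A}"
    proof (rule L[rule_format])
      show "prob_space ?PM" by (intro prob_space_PiM \<mu>.prob_space_axioms)
      show "(\<lambda>a. \<Sum>i<n. max 0 (a i)) \<in> borel_measurable ?PM" by measurable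
      show "0 \<le> (\<Sum>i<n. max 0 (a i))" for a :: "nat \<Rightarrow> real" by (intro sum_nonneg) auto
      fix r :: real assume r: "0 \<le> r"
      have "(LINT a|?PM. exp (- (r * (\<Sum>i<n. max 0 (a i))))) = (LINT x|\<mu>. exp (- (r * max 0 x))) ^ n"
        using r by (intro integral_PiM_exp_sum \<mu>.prob_space_axioms) auto
      also have "\<dots> = exp (- (\<kappa> * 2 powr (\<alpha> / 2) * r powr (\<alpha> / 2)))"
        using n by (simp add: lap[OF r] exp_of_nat_mult[symmetric])
      finally show "(LINT a|?PM. exp (- (r * (\<Sum>i<n. max 0 (a i))))) = exp (- (\<kappa> * 2 powr (\<alpha> / 2) * r powr (\<alpha> / 2)))" .
    qed
    then have "L * measure N {\<omega> \<in> space N. holder_seminorm (1 / p) (\<lambda>t. W t \<omega>) \<le> ennreal e} \<le>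
      measure ?PM {a \<in> space ?PM. (\<Sum>i<n. max 0 (a i)) \<le> A} * measure N {\<omega> \<in> space N. holder_seminorm (1 / p) (\<lambda>t. W t \<omega>) \<le> ennreal e}"
      by (rule mult_right_mono) simp
    also have "\<dots> \<le> measure (PiM {..<n} (\<lambda>_. Z.law (1 / real n))) (grid_event p (sqrt A * e) n)"
      unfolding law by (rule W.measure_scale_mixture_grid_event_ge[OF \<mu> n A p e])
    finally show "L * measure N {\<omega> \<in> space N. holder_seminorm (1 / p) (\<lambda>t. W t \<omega>) \<le> ennreal e} \<le>
      measure (PiM {..<n} (\<lambda>_. Z.law (1 / real n))) (grid_event p (sqrt A * e) n)" .
  qed
qed

text \<open>Since \<open>ln 0 = 0\<close>, a nonzero limit forces the probabilities to be positive; as \<^const>\<open>measure\<close>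
  vanishes on nonmeasurable sets, the events are then measurable as well.\<close>

lemma eventually_pos_of_log_limit:
  fixes f :: "real \<Rightarrow> real"
  assumes lim: "((\<lambda>\<epsilon>. \<epsilon> powr r * ln (f \<epsilon>)) \<longlongrightarrow> - K) (at_right 0)" and "0 < K" and "\<And>\<epsilon>. 0 \<le> f \<epsilon>"
  shows "\<forall>\<^sub>F \<epsilon> in at_right 0. 0 < f \<epsilon>"
proof -
  have "\<forall>\<^sub>F \<epsilon> in at_right 0. \<epsilon> powr r * ln (f \<epsilon>) < 0"
    using lim by (rule order_tendstoD) (use assms in simp)
  then show ?thesis
  proof eventually_elim
    case (elim \<epsilon>)
    then have "f \<epsilon> \<noteq> 0" by auto
    then show ?case using assms(3)[of \<epsilon>] by simp
  qed
qed

theorem theorem4: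
  fixes \<alpha> p \<kappa> K c :: real
    and M :: "'a measure" and Z :: "real \<Rightarrow> 'a \<Rightarrow> real"
    and N :: "'b measure" and W :: "real \<Rightarrow> 'b \<Rightarrow> real"
  assumes "0 < \<alpha>" and "\<alpha> < 2" and "2 < p" and "0 < \<kappa>"
    and "levy_process M Z"
    and "\<And>t u. t \<ge> 0 \<Longrightarrow>
           (CLINT \<omega>|M. iexp (u * Z t \<omega>)) = complex_of_real (exp (- (\<kappa> * t * \<bar>u\<bar> powr \<alpha>)))"
    and "0 < K"
    and "((\<lambda>\<epsilon>. \<epsilon> powr (p * \<alpha> / (p - \<alpha>)) *
             ln (measure M {\<omega> \<in> space M. strong_variation p (\<lambda>t. Z t \<omega>) \<le> ennreal \<epsilon>}))
           \<longlongrightarrow> - K) (at_right 0)"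
    and "standard_brownian_motion N W"
    and "0 < c"
    and "((\<lambda>\<epsilon>. \<epsilon> powr (2 * p / (p - 2)) *
             ln (measure N {\<omega> \<in> space N. holder_seminorm (1 / p) (\<lambda>t. W t \<omega>) \<le> ennreal \<epsilon>}))
           \<longlongrightarrow> - c) (at_right 0)"
  shows "(p - \<alpha>) / \<alpha> *
           (2 * \<alpha> * Gamma \<alpha> * sin (pi * \<alpha> / 2) / (p * pi) * Gamma (1 - \<alpha> / p)) powr (p / (p - \<alpha>)) *
           \<kappa> powr (p / (p - \<alpha>)) \<le> K \<and>
         K \<le> c + (2 - \<alpha>) / 2 * \<alpha> powr (\<alpha> / (2 - \<alpha>)) * \<kappa> powr (2 / (2 - \<alpha>))"
proof
  interpret Z: levy_process M Z by fact
  interpret W: standard_brownian_motion N W by fact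
  define r where "r = p * \<alpha> / (p - \<alpha>)"
  define f where "f \<epsilon> = measure M {\<omega> \<in> space M. strong_variation p (\<lambda>t. Z t \<omega>) \<le> ennreal \<epsilon>}" for \<epsilon>
  define w where "w \<epsilon> = measure N {\<omega> \<in> space N. holder_seminorm (1 / p) (\<lambda>t. W t \<omega>) \<le> ennreal \<epsilon>}" for \<epsilon>
  have f_lim: "((\<lambda>\<epsilon>. \<epsilon> powr r * ln (f \<epsilon>)) \<longlongrightarrow> - K) (at_right 0)"
    using assms(8) by (simp add: f_def r_def)
  have w_lim: "((\<lambda>\<epsilon>. \<epsilon> powr (2 * p / (p - 2)) * ln (w \<epsilon>)) \<longlongrightarrow> - c) (at_right 0)"
    using assms(11) by (simp add: w_def)
  have f_pos: "\<forall>\<^sub>F \<epsilon> in at_right 0. 0 < f \<epsilon>"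
    by (rule eventually_pos_of_log_limit[OF f_lim \<open>0 < K\<close>]) (simp add: f_def)
  have w_pos: "\<forall>\<^sub>F \<epsilon> in at_right 0. 0 < w \<epsilon>"
    by (rule eventually_pos_of_log_limit[OF w_lim \<open>0 < c\<close>]) (simp add: w_def)
  have pos: "\<forall>\<^sub>F \<epsilon>::real in at_right 0. 0 < \<epsilon>" by (rule eventually_at_right_less)
  define D where "D = (p - \<alpha>) / \<alpha> *
           (2 * \<alpha> * Gamma \<alpha> * sin (pi * \<alpha> / 2) / (p * pi) * Gamma (1 - \<alpha> / p)) powr (p / (p - \<alpha>)) *
           \<kappa> powr (p / (p - \<alpha>))"
  have "- K \<le> - D"
  proof (rule tendsto_upperbound[OF f_lim])
    show "\<forall>\<^sub>F \<epsilon> in at_right 0. \<epsilon> powr r * ln (f \<epsilon>) \<le> - D"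
      using f_pos pos
    proof eventually_elim
      case (elim \<epsilon>)
      have "f \<epsilon> \<le> exp (- (D * \<epsilon> powr (- r)))"
        using Z.prob_strong_variation_upper[OF assms(1-4,6) \<open>0 < \<epsilon>\<close>] by (simp add: f_def D_def r_def)
      then have "ln (f \<epsilon>) \<le> ln (exp (- (D * \<epsilon> powr (- r))))"
        using elim by (intro ln_mono) auto
      then have "ln (f \<epsilon>) \<le> - (D * \<epsilon> powr (- r))" by (simp only: ln_exp)
      then have "\<epsilon> powr r * ln (f \<epsilon>) \<le> \<epsilon> powr r * - (D * \<epsilon> powr (- r))"
        by (rule mult_left_mono) simp
      also have "\<dots> = - D" using elim by (simp add: powr_minus field_simps)
      finally show ?case .
    qed
  qed simp
  then show "(p - \<alpha>) / \<alpha> *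
           (2 * \<alpha> * Gamma \<alpha> * sin (pi * \<alpha> / 2) / (p * pi) * Gamma (1 - \<alpha> / p)) powr (p / (p - \<alpha>)) *
           \<kappa> powr (p / (p - \<alpha>)) \<le> K" by (simp add: D_def)
  define d where "d = (2 - \<alpha>) / 2 * \<alpha> powr (\<alpha> / (2 - \<alpha>)) * \<kappa> powr (2 / (2 - \<alpha>))"
  define b where "b = \<kappa> * 2 powr (\<alpha> / 2)"
  define \<beta> where "\<beta> = \<alpha> / 2"
  have \<beta>: "0 < \<beta>" "\<beta> < 1" and b: "0 < b" using assms by (simp_all add: \<beta>_def b_def)
  have e1: "\<beta> / (1 - \<beta>) = \<alpha> / (2 - \<alpha>)" and e2: "1 / (1 - \<beta>) = 2 / (2 - \<alpha>)" and e3: "\<alpha> / 2 * (2 / (2 - \<alpha>)) = \<alpha> / (2 - \<alpha>)"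
    using assms by (simp_all add: \<beta>_def divide_simps)
  \<comment> \<open>The power of 2 in \<open>b\<close> contributes
    \<open>2 powr (\<alpha> / (2 - \<alpha>))\<close>, which turns
    \<open>(\<alpha> / 2) powr (\<alpha> / (2 - \<alpha>))\<close> into the power of
    \<open>\<alpha>\<close> in the claim.\<close>
  have d_eq: "(1 - \<beta>) * \<beta> powr (\<beta> / (1 - \<beta>)) * b powr (1 / (1 - \<beta>)) = d"
  proof -
    have "b powr (2 / (2 - \<alpha>)) = \<kappa> powr (2 / (2 - \<alpha>)) * 2 powr (\<alpha> / (2 - \<alpha>))"
      using assms by (simp only: b_def powr_mult powr_powr e3)
    moreover have "\<beta> powr (\<alpha> / (2 - \<alpha>)) * 2 powr (\<alpha> / (2 - \<alpha>)) = \<alpha> powr (\<alpha> / (2 - \<alpha>))"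
      using assms by (simp add: \<beta>_def powr_mult[symmetric])
    moreover have "1 - \<beta> = (2 - \<alpha>) / 2" by (simp add: \<beta>_def field_simps)
    ultimately show ?thesis unfolding e1 e2 d_def by (simp only: mult_ac)
  qed
  \<comment> \<open>With \<open>a = \<epsilon> powr \<gamma>\<close>, the Hoelder radius
    \<open>\<epsilon> / sqrt a\<close> is \<open>\<epsilon> powr \<delta>\<close>. This
    \<open>\<gamma>\<close> is where the costs \<open>a powr (- \<alpha> / (2 - \<alpha>))\<close>
    and \<open>(\<epsilon> powr \<delta>) powr (- 2 p / (p - 2))\<close> both equal
    \<open>\<epsilon> powr (- r)\<close>. As \<open>p > 2\<close>, \<open>\<delta>\<close> is
    positive, so the radius tends to 0 and the Brownian limit applies.\<close>
  define \<gamma> where "\<gamma> = p * (2 - \<alpha>) / (p - \<alpha>)"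
  define \<delta> where "\<delta> = 1 - \<gamma> / 2"
  have g_pos: "0 < \<gamma>" using assms by (simp add: \<gamma>_def)
  have d_form: "\<delta> = \<alpha> * (p - 2) / (2 * (p - \<alpha>))"
    using assms by (simp add: \<delta>_def \<gamma>_def divide_simps) (simp add: algebra_simps)
  then have d_pos: "0 < \<delta>" using assms by simp
  have \<gamma>r: "\<gamma> * (- \<beta> / (1 - \<beta>)) = - r"
  proof -
    have "\<gamma> * (- \<beta> / (1 - \<beta>)) = - (\<gamma> * (\<alpha> / (2 - \<alpha>)))" unfolding e1[symmetric] by simp
    also have "\<gamma> * (\<alpha> / (2 - \<alpha>)) = r" using assms by (simp add: \<gamma>_def r_def)
    finally show ?thesis .
  qed
  have \<delta>r: "\<delta> * (2 * p / (p - 2)) = r"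
    using assms unfolding d_form by (simp add: r_def divide_simps)
  have lim_\<gamma>: "filterlim (\<lambda>\<epsilon>::real. \<epsilon> powr \<gamma>) (at_right 0) (at_right 0)" using g_pos by real_asymp
  have lim_\<delta>: "filterlim (\<lambda>\<epsilon>::real. \<epsilon> powr \<delta>) (at_right 0) (at_right 0)" using d_pos by real_asymp
  have "((\<lambda>\<epsilon>. (\<epsilon> powr \<delta>) powr (2 * p / (p - 2)) * ln (w (\<epsilon> powr \<delta>))) \<longlongrightarrow> - c) (at_right 0)"
    using w_lim lim_\<delta> by (rule filterlim_compose)
  then have wd_lim: "((\<lambda>\<epsilon>. \<epsilon> powr r * ln (w (\<epsilon> powr \<delta>))) \<longlongrightarrow> - c) (at_right 0)"
    by (simp only: powr_powr \<delta>r)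
  \<comment> \<open>The tilting estimate requires a constant strictly above \<open>d\<close>;
    \<open>\<eta>\<close> is this slack and is removed at the end.\<close>
  have "K \<le> (c + d) + \<eta>" if \<eta>: "0 < \<eta>" for \<eta>
  proof -
    have "(1 - \<beta>) * \<beta> powr (\<beta> / (1 - \<beta>)) * b powr (1 / (1 - \<beta>)) < d + \<eta>"
      using \<eta> by (simp add: d_eq)
    note eventually_compose_filterlim[OF eventually_prob_le_ge_exp[OF b \<beta> this, where 'a="nat \<Rightarrow> real"] lim_\<gamma>]
    moreover have "\<forall>\<^sub>F \<epsilon> in at_right 0. 0 < w (\<epsilon> powr \<delta>)"
      using w_pos lim_\<delta> by (rule eventually_compose_filterlim)
    ultimately have ev: "\<forall>\<^sub>F \<epsilon> in at_right 0. - (d + \<eta>) + \<epsilon> powr r * ln (w (\<epsilon> powr \<delta>)) \<le> \<epsilon> powr r * ln (f \<epsilon>)"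
      using f_pos pos
    proof eventually_elim
      case (elim \<epsilon>)
      have s: "sqrt (\<epsilon> powr \<gamma>) * \<epsilon> powr \<delta> = \<epsilon>"
        using \<open>0 < \<epsilon>\<close> by (simp add: powr_half_sqrt[symmetric] powr_powr powr_add[symmetric] \<delta>_def)
      have x: "(\<epsilon> powr \<gamma>) powr (- \<beta> / (1 - \<beta>)) = \<epsilon> powr (- r)"
        by (simp only: powr_powr \<gamma>r)
      have sets: "{\<omega> \<in> space M. strong_variation p (\<lambda>t. Z t \<omega>) \<le> ennreal \<epsilon>} \<in> sets M"
      proof (rule ccontr)
        assume "{\<omega> \<in> space M. strong_variation p (\<lambda>t. Z t \<omega>) \<le> ennreal \<epsilon>} \<notin> sets M"
        then have "f \<epsilon> = 0" unfolding f_def by (rule measure_notin_sets)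
        then show False using elim by simp
      qed
      have "exp (- ((d + \<eta>) * \<epsilon> powr (- r))) * measure N {\<omega> \<in> space N. holder_seminorm (1 / p) (\<lambda>t. W t \<omega>) \<le> ennreal (\<epsilon> powr \<delta>)}
        \<le> measure M {\<omega> \<in> space M. strong_variation p (\<lambda>t. Z t \<omega>) \<le> ennreal (sqrt (\<epsilon> powr \<gamma>) * \<epsilon> powr \<delta>)}"
      proof (rule strong_variation_holder_lower_bound[OF assms(1,2) _ assms(4) _ _ assms(5,6,9)])
        show "{\<omega> \<in> space M. strong_variation p (\<lambda>t. Z t \<omega>) \<le> ennreal (sqrt (\<epsilon> powr \<gamma>) * \<epsilon> powr \<delta>)} \<in> sets M"
          unfolding s by (rule sets)
      qed (use elim(1)[unfolded x, unfolded b_def \<beta>_def] assms(3) \<open>0 < \<epsilon>\<close> in simp_all)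
      then have "exp (- ((d + \<eta>) * \<epsilon> powr (- r))) * w (\<epsilon> powr \<delta>) \<le> f \<epsilon>"
        unfolding s w_def f_def .
      then have "ln (exp (- ((d + \<eta>) * \<epsilon> powr (- r))) * w (\<epsilon> powr \<delta>)) \<le> ln (f \<epsilon>)"
        using elim by (intro ln_mono) auto
      then have "- ((d + \<eta>) * \<epsilon> powr (- r)) + ln (w (\<epsilon> powr \<delta>)) \<le> ln (f \<epsilon>)"
        using elim by (simp add: ln_mult)
      then have "\<epsilon> powr r * (- ((d + \<eta>) * \<epsilon> powr (- r)) + ln (w (\<epsilon> powr \<delta>))) \<le> \<epsilon> powr r * ln (f \<epsilon>)"
        by (rule mult_left_mono) simp
      also have "\<epsilon> powr r * (- ((d + \<eta>) * \<epsilon> powr (- r)) + ln (w (\<epsilon> powr \<delta>))) = - (d + \<eta>) + \<epsilon> powr r * ln (w (\<epsilon> powr \<delta>))"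
        using \<open>0 < \<epsilon>\<close> by (simp add: powr_minus field_simps)
      finally show ?case .
    qed
    have "((\<lambda>\<epsilon>. - (d + \<eta>) + \<epsilon> powr r * ln (w (\<epsilon> powr \<delta>))) \<longlongrightarrow> - (d + \<eta>) + - c) (at_right 0)"
      by (intro tendsto_intros wd_lim)
    from tendsto_le[OF _ f_lim this ev] show ?thesis by simp
  qed
  then have "K \<le> c + d" by (rule field_le_epsilon)
  then show "K \<le> c + (2 - \<alpha>) / 2 * \<alpha> powr (\<alpha> / (2 - \<alpha>)) * \<kappa> powr (2 / (2 - \<alpha>))"
    by (simp add: d_def)
qed

end
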